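(* Assume the setting described in the context (in particular $\sigma(A)\subset\{\lambda\in\mathbb{C}:|\arg\lambda|>\frac{\alpha\pi}{2}\}$). Then there exists a constant $C(\alpha,\lambda)>0$, depending only on $\alpha$ and $\lambda:=(\lambda_1,\dots,\lambda_n)$, such that for all $x\in\mathbb{C}^d$ and all $\xi,\widehat\xi\in C_\infty([t_0,\infty),\mathbb{C}^d)$: $$\|\mathcal{F}_x\xi-\mathcal{F}_x\widehat\xi\|_\infty\le C(\alpha,\lambda)\,\ell_h\big(\max(\|\xi\|_\infty,\|\widehat\xi\|_\infty)\big)\,\|\xi-\widehat\xi\|_\infty$$ and $$\|\mathcal{F}_x\xi\|_\infty\le \max_{1\le i\le n}\sup_{t\ge t_0}\Big|E_\alpha\Big(\lambda_i\Big(\frac{t^\rho-t_0^\rho}{\rho}\Big)^{\alpha}\Big)\Big|\,\|x\|+C(\alpha,\lambda)\,\ell_h(\|\xi\|_\infty)\,\|\xi\|_\infty .$$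
   Context: Fix $0<\alpha<1$, $\rho>0$, $t_0>0$. Mittag-Leffler functions: $E_{\alpha,\beta}(z)=\sum_{k\ge0}\frac{z^k}{\Gamma(k\alpha+\beta)}$, $E_\alpha=E_{\alpha,1}$. Let $A\in\mathbb{R}^{d\times d}$ and let $f:\mathbb{R}^d\to\mathbb{R}^d$ be locally Lipschitz with $f(0)=0$ and $\lim_{r\to0}\ell_f(r)=0$, where $\ell_f(r)=\sup_{x,y\in B(0,r),x\ne y}\|f(x)-f(y)\|/\|x-y\|$. Let $T\in\mathbb{C}^{d\times d}$ be nonsingular with $T^{-1}AT=\mathrm{diag}(A_1,\dots,A_n)$ (Jordan form), $A_i=\lambda_i I_{d_i}+\eta_iN_{d_i}$, $\eta_i\in\{0,1\}$, where $N_{d_i}$ is the $d_i\times d_i$ matrix with ones on the superdiagonal and zeros elsewhere, and $\lambda_i$ are eigenvalues of $A$. For a fixed $\delta>0$ let $P=\mathrm{diag}(P_1,\dots,P_n)$, $P_i=\mathrm{diag}(1,\delta,\dots,\delta^{d_i-1})$, so $P_i^{-1}A_iP_i=\lambda_iI_{d_i}+\delta_iN_{d_i}$ with $\delta_i\in\{0,\delta\}$. Put $J_i=\lambda_iI_{d_i}$ and $$h(y)=\mathrm{diag}(\delta_1N_{d_1},\dots,\delta_nN_{d_n})\,y+(TP)^{-1}f(TPy),$$ $\ell_h(r)=\sup_{y,z\in B(0,r),y\ne z}\|h(y)-h(z)\|/\|y-z\|$. Let $C_\infty([t_0,\infty),\mathbb{C}^d)$ be the space of continuous bounded $\xi:[t_0,\infty)\to\mathbb{C}^d$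 with $\|\xi\|_\infty=\sup_{t\ge t_0}\|\xi(t)\|$. Writing vectors as $x=(x^1,\dots,x^n)\in\mathbb{C}^{d_1}\times\dots\times\mathbb{C}^{d_n}$ and similarly $h=(h^1,\dots,h^n)$, define for $x\in\mathbb{C}^d$ the operator $\mathcal{F}_x$ by $(\mathcal{F}_x\xi)(t)=((\mathcal{F}_x\xi)^1(t),\dots,(\mathcal{F}_x\xi)^n(t))$, $$(\mathcal{F}_x\xi)^i(t)=E_\alpha\Big(\Big(\tfrac{t^\rho-t_0^\rho}{\rho}\Big)^{\alpha}J_i\Big)x^i+\int_{t_0}^t\Big(\tfrac{t^\rho-s^\rho}{\rho}\Big)^{\alpha-1}E_{\alpha,\alpha}\Big(\Big(\tfrac{t^\rho-s^\rho}{\rho}\Big)^{\alpha}J_i\Big)s^{\rho-1}h^i(\xi(s))\,ds.$$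
   Formalization: Since f is defined only on R^d while h evaluates f at the possibly complex vector TPy, f is extended to C^d by f(z) := f(Re z), with real parts taken componentwise; h and ℓ_h are formed with this extension. *)

theory Defs
  imports "HOL-Analysis.Analysis" "Jordan_Normal_Form.Matrix" "Jordan_Normal_Form.Char_Poly"
begin

definition vnorm :: "'a::real_normed_vector Matrix.vec \<Rightarrow> real" where
  "vnorm v = sqrt (\<Sum>i<dim_vec v. (norm (v $ i))\<^sup>2)"

definition mittag_leffler :: "real \<Rightarrow> real \<Rightarrow> complex \<Rightarrow> complex" where
  "mittag_leffler a b z = (\<Sum>k. z ^ k / complex_of_real (Gamma (real k * a + b)))"

definition minv :: "complex mat \<Rightarrow> complex mat" where
  "minv M = (SOME B. inverts_mat M B \<and> inverts_mat B M)"

definition Nmat :: "nat \<Rightarrow> complex mat" where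
  "Nmat m = Matrix.mat m m (\<lambda>(j,k). if Suc j = k then 1 else 0)"

definition Ablk :: "complex list \<Rightarrow> nat list \<Rightarrow> bool list \<Rightarrow> nat \<Rightarrow> complex mat" where
  "Ablk lam ds eta i = (lam ! i) \<cdot>\<^sub>m 1\<^sub>m (ds ! i) + (if eta ! i then 1 else 0) \<cdot>\<^sub>m Nmat (ds ! i)"

definition Jform :: "complex list \<Rightarrow> nat list \<Rightarrow> bool list \<Rightarrow> complex mat" where
  "Jform lam ds eta = diag_block_mat (map (Ablk lam ds eta) [0..<length lam])"

definition Pmat :: "nat list \<Rightarrow> real \<Rightarrow> complex mat" where
  "Pmat ds \<delta> = diag_block_mat (map (\<lambda>m. Matrix.mat m m (\<lambda>(j,k). if j = k then complex_of_real (\<delta> ^ j) else 0)) ds)"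

definition Dmat :: "nat list \<Rightarrow> bool list \<Rightarrow> real \<Rightarrow> complex mat" where
  "Dmat ds eta \<delta> = diag_block_mat (map (\<lambda>i. complex_of_real (if eta ! i then \<delta> else 0) \<cdot>\<^sub>m Nmat (ds ! i)) [0..<length ds])"

definition fC :: "(real Matrix.vec \<Rightarrow> real Matrix.vec) \<Rightarrow> complex Matrix.vec \<Rightarrow> complex Matrix.vec" where
  "fC f z = map_vec complex_of_real (f (map_vec Re z))"

definition hfun :: "(real Matrix.vec \<Rightarrow> real Matrix.vec) \<Rightarrow> complex mat \<Rightarrow> nat list \<Rightarrow> bool list \<Rightarrow> real
    \<Rightarrow> complex Matrix.vec \<Rightarrow> complex Matrix.vec" where
  "hfun f T ds eta \<delta> y = Dmat ds eta \<delta> *\<^sub>v y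
     + minv (T * Pmat ds \<delta>) *\<^sub>v fC f ((T * Pmat ds \<delta>) *\<^sub>v y)"

(* Lipschitz constant on the closed ball B(0,r) of the d-dimensional space (sup of empty set := 0) *)
definition lipc :: "nat \<Rightarrow> ('a::real_normed_vector Matrix.vec \<Rightarrow> 'b::real_normed_vector Matrix.vec) \<Rightarrow> real \<Rightarrow> real" where
  "lipc d g r = Sup (insert 0 {vnorm (g y - g z) / vnorm (y - z) | y z.
       y \<in> carrier_vec d \<and> z \<in> carrier_vec d \<and> vnorm y \<le> r \<and> vnorm z \<le> r \<and> y \<noteq> z})"

definition loc_lipschitz :: "nat \<Rightarrow> (real Matrix.vec \<Rightarrow> real Matrix.vec) \<Rightarrow> bool" where
  "loc_lipschitz d f = (\<forall>x\<in>carrier_vec d. \<exists>\<epsilon>>0. \<exists>L. \<forall>y\<in>carrier_vec d. \<forall>z\<in>carrier_vec d.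
      vnorm (y - x) < \<epsilon> \<longrightarrow> vnorm (z - x) < \<epsilon> \<longrightarrow> vnorm (f y - f z) \<le> L * vnorm (y - z))"

definition Cinf :: "nat \<Rightarrow> real \<Rightarrow> (real \<Rightarrow> complex Matrix.vec) set" where
  "Cinf d t0 = {\<xi>. (\<forall>t\<ge>t0. \<xi> t \<in> carrier_vec d) \<and> (\<forall>j<d. continuous_on {t0..} (\<lambda>t. \<xi> t $ j))
                \<and> (\<exists>B. \<forall>t\<ge>t0. vnorm (\<xi> t) \<le> B)}"

definition supn :: "real \<Rightarrow> (real \<Rightarrow> complex Matrix.vec) \<Rightarrow> real" where
  "supn t0 \<xi> = Sup ((\<lambda>t. vnorm (\<xi> t)) ` {t0..})"

(* index i of the Jordan block containing coordinate j (0-based) *)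
definition blk :: "nat list \<Rightarrow> nat \<Rightarrow> nat" where
  "blk ds j = (LEAST i. j < sum_list (take (Suc i) ds))"

(* the operator F_x; E_alpha(u^alpha J_i) = E_alpha(u^alpha lambda_i) I since J_i = lambda_i I *)
definition Fop :: "real \<Rightarrow> real \<Rightarrow> real \<Rightarrow> complex list \<Rightarrow> nat list
    \<Rightarrow> (complex Matrix.vec \<Rightarrow> complex Matrix.vec) \<Rightarrow> complex Matrix.vec
    \<Rightarrow> (real \<Rightarrow> complex Matrix.vec) \<Rightarrow> real \<Rightarrow> complex Matrix.vec" where
  "Fop \<alpha> \<rho> t0 lam ds h x \<xi> t = Matrix.vec (sum_list ds) (\<lambda>j.
      mittag_leffler \<alpha> 1 (complex_of_real (((t powr \<rho> - t0 powr \<rho>) / \<rho>) powr \<alpha>) * lam ! blk ds j) * x $ j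
    + integral {t0..t} (\<lambda>s.
        complex_of_real (((t powr \<rho> - s powr \<rho>) / \<rho>) powr (\<alpha> - 1))
        * mittag_leffler \<alpha> \<alpha> (complex_of_real (((t powr \<rho> - s powr \<rho>) / \<rho>) powr \<alpha>) * lam ! blk ds j)
        * complex_of_real (s powr (\<rho> - 1)) * (h (\<xi> s) $ j)))"

end

theory Submission
  imports Defs "HOL-Complex_Analysis.Complex_Analysis" "HOL-Real_Asymp.Real_Asymp"
begin

text \<open>
  The kernel of the integral operator is dominated by an explicit derivative once
  \<open>E_{\<alpha>,\<alpha>}(\<lambda> x) = O((1 + x)^{-2})\<close> for \<open>x \<ge> 0\<close>, so its \<open>L^1\<close> norm is bounded by a constant
  depending only on \<open>\<alpha>\<close> and \<open>\<lambda>\<close>. The decay comes from the representation of \<open>E_{\<alpha>,\<beta>}(z)\<close> as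
  \<open>1/(2 \<pi> i)\<close> times the integral of \<open>e^s s^{\<alpha>-\<beta>} / (s^\<alpha> - z)\<close> along the two rays
  \<open>p + r e^{\<plusminus>i(\<pi>/2 + \<psi>)}\<close>, which follows from Hankel's formula for \<open>1/\<Gamma>\<close> by expanding in powers of \<open>z\<close>
  for large \<open>p\<close>. If \<open>|arg z| > \<alpha>(\<pi>/2 + \<psi>)\<close>, the integrand has no pole to the right of the rays, so the vertex can
  be moved back to \<open>p = 1\<close>. For \<open>\<beta> = \<alpha>\<close> the leading term \<open>-1/z\<close> of \<open>1/(s^\<alpha> - z)\<close> contributes zero,
  and the remainder is \<open>O(|z|^{-2})\<close>.
\<close>

section \<open>Integrals along two rays in a sector\<close>

text \<open>The estimates need constants that see neither p nor the data of the equation. The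
  expansion in powers of z needs |s|^\<alpha> to dominate |z| on the rays, so its vertex grows with
  z and would leave a factor e^p in every bound; hence the return to a fixed vertex. Closed contours
  are avoided: on the starlike sector each integrand has a primitive, the vertex values cancel
  between the two rays, and only differences at the far ends remain, which tend to 0.

  Hankel's formula uses the opposite motion: for 0 < b < 1 the vertex tends to 0, each ray integral
  becomes a Gamma integral along a rotated ray, and the reflection formula turns the two phases into
  1/\<Gamma>(b). A recurrence in b and a limit reach the other exponents.

  Independence of \<rho> and t_0 comes from the variable u = (t^\<rho> - s^\<rho>)/\<rho>, whose
  differential -s^(\<rho>-1) ds is already present in the operator. Independence of d comes from
  estimating the Euclidean norm of the vector integral as a whole; summing coordinate bounds would
  cost a factor that grows with d.\<close>

text \<open>For \<open>0 < \<psi> < \<pi>/2\<close> this is the open sector \<open>|arg s| < \<pi>/2 + \<psi>\<close>.\<close>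
definition sect :: "real \<Rightarrow> complex set" where
  "sect \<psi> = {s. 0 < Re s * cos \<psi> + \<bar>Im s\<bar> * sin \<psi>}"

definition ray_integral :: "complex \<Rightarrow> real \<Rightarrow> (complex \<Rightarrow> complex) \<Rightarrow> complex" where
  "ray_integral D p F = integral {0..} (\<lambda>r. F (of_real p + of_real r * D) * D)"

lemma absolutely_integrable_exp_bounded:
  fixes f :: "real \<Rightarrow> complex"
  assumes "continuous_on {0..} f" "0 < c" "\<And>r. 0 \<le> r \<Longrightarrow> norm (f r) \<le> B * exp (- c * r)"
  shows "f absolutely_integrable_on {0..}"
proof (rule measurable_bounded_by_integrable_imp_absolutely_integrable)
  show "f \<in> borel_measurable (lebesgue_on {0..})"
    by (rule continuous_imp_measurable_on_sets_lebesgue[OF assms(1)]) simp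
  have "((\<lambda>x. exp (- c * x)) has_integral exp (- c * 0) / c) {0..}"
    using has_integral_exp_minus_to_infinity[OF assms(2), of 0] by simp
  then show "(\<lambda>r. B * exp (- c * r)) integrable_on {0..}"
    by (intro integrable_on_mult_right) blast
qed (use assms in auto)

lemma integral_tendsto_at_top:
  fixes f :: "real \<Rightarrow> complex"
  assumes "f absolutely_integrable_on {0..}"
  shows "((\<lambda>M. integral {0..M} f) \<longlongrightarrow> integral {0..} f) at_top"
proof -
  have "((\<lambda>b. set_lebesgue_integral lebesgue {0..b} f) \<longlongrightarrow> set_lebesgue_integral lebesgue {0..} f) at_top"
    by (rule tendsto_set_lebesgue_integral_at_top) (use assms in auto)
  moreover have "set_lebesgue_integral lebesgue {0..b} f = integral {0..b} f" for b
    by (rule set_lebesgue_integral_eq_integral, rule set_integrable_subset[OF assms]) auto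
  moreover have "set_lebesgue_integral lebesgue {0..} f = integral {0..} f"
    by (rule set_lebesgue_integral_eq_integral[OF assms])
  ultimately show ?thesis by simp
qed

section \<open>Geometry of the sector and of its rays\<close>

lemma open_sect: "open (sect \<psi>)"
  unfolding sect_def by (intro open_Collect_less continuous_intros)

lemma sect_subset_slit:
  assumes "0 < \<psi>" "\<psi> < pi/2" "s \<in> sect \<psi>" shows "s \<notin> \<real>\<^sub>\<le>\<^sub>0"
proof
  assume "s \<in> \<real>\<^sub>\<le>\<^sub>0"
  then have "Im s = 0" "Re s \<le> 0" by (auto simp: complex_nonpos_Reals_iff)
  moreover have "cos \<psi> > 0" using assms by (intro cos_gt_zero_pi) auto
  ultimately show False using assms(3) by (auto simp: sect_def zero_less_mult_iff)
qed

text \<open>The sector opens by more than \<pi> and is not convex, so primitives have to come from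
  star-shapedness. The centre 1 is real: along a segment from 1 the imaginary part is only scaled,
  so the defining form interpolates linearly in spite of its absolute value.\<close>

lemma starlike_sect:
  assumes "0 < \<psi>" "\<psi> < pi/2" shows "starlike (sect \<psi>)"
  unfolding starlike_def
proof (intro bexI ballI subsetI)
  have c: "cos \<psi> > 0" and sn: "sin \<psi> > 0" using assms by (auto intro: cos_gt_zero_pi sin_gt_zero)
  then show "1 \<in> sect \<psi>" by (simp add: sect_def)
  fix x y assume x: "x \<in> sect \<psi>" and "y \<in> closed_segment 1 x"
  then obtain u where u: "0 \<le> u" "u \<le> 1" "y = (1-u) *\<^sub>R 1 + u *\<^sub>R x"
    by (auto simp: closed_segment_def)
  have "Re y * cos \<psi> + \<bar>Im y\<bar> * sin \<psi> = (1-u) * cos \<psi> + u * (Re x * cos \<psi> + \<bar>Im x\<bar> * sin \<psi>)"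
    unfolding u(3) using u(1) by (simp add: abs_mult algebra_simps)
  also have "\<dots> > 0"
    using x c u by (cases "u = 1") (auto simp: sect_def intro!: add_pos_nonneg)
  finally show "y \<in> sect \<psi>" by (simp add: sect_def)
qed

text \<open>Only the absolute value of \<open>Im D\<close> is fixed, so that every estimate is
  proved once for both directions.\<close>

locale sect_ray =
  fixes \<psi> :: real and D :: complex
  assumes psi: "0 < \<psi>" "\<psi> < pi/2" and ReD: "Re D = - sin \<psi>" and ImD: "\<bar>Im D\<bar> = cos \<psi>"
begin

lemma cos_pos: "0 < cos \<psi>" and sin_pos: "0 < sin \<psi>"
  using psi by (auto intro: cos_gt_zero_pi sin_gt_zero)

lemma norm_D: "norm D = 1"
proof -
  have "(Im D)\<^sup>2 = (cos \<psi>)\<^sup>2" using ImD by (metis power2_abs)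
  then show ?thesis using ReD by (simp add: cmod_def)
qed

lemma ray_in_sect: "0 < p \<Longrightarrow> 0 \<le> r \<Longrightarrow> of_real p + of_real r * D \<in> sect \<psi>"
  using cos_pos by (simp add: sect_def ReD ImD abs_mult algebra_simps)

lemma Re_ray: "Re (of_real p + of_real r * D) = p - sin \<psi> * r"
  by (simp add: ReD)

text \<open>Along the ray the form that defines the sector keeps its vertex value
  \<open>p * cos \<psi>\<close>, and Cauchy-Schwarz with the unit vector
  \<open>(cos \<psi>, sin \<psi>)\<close> bounds the form by the modulus. Hence the rays avoid a
  disc about 0 with radius proportional to p.\<close>

lemma norm_ray_ge1: assumes "0 < p" "0 \<le> r" shows "p * cos \<psi> \<le> norm (of_real p + of_real r * D)"
proof -
  let ?s = "of_real p + of_real r * D"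
  have "p * cos \<psi> = Re ?s * cos \<psi> + \<bar>Im ?s\<bar> * sin \<psi>"
    using assms by (simp add: ReD ImD abs_mult algebra_simps)
  also have "\<dots> \<le> norm (Complex (cos \<psi>) (sin \<psi>)) * norm (Complex (Re ?s) \<bar>Im ?s\<bar>)"
    using complex_Re_le_cmod[of "Complex (cos \<psi>) (- sin \<psi>) * Complex (Re ?s) \<bar>Im ?s\<bar>"]
    unfolding norm_mult by (simp add: cmod_def mult.commute)
  also have "\<dots> = norm ?s" by (simp add: cmod_def)
  finally show ?thesis .
qed

lemma norm_ray_ge2: assumes "0 \<le> r" shows "r * cos \<psi> \<le> norm (of_real p + of_real r * D)"
  using abs_Im_le_cmod[of "of_real p + of_real r * D"] assms by (simp add: abs_mult ImD)

lemma norm_ray_le: assumes "0 \<le> p" "0 \<le> r" shows "norm (of_real p + of_real r * D) \<le> p + r"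
  using norm_triangle_ineq[of "of_real p" "of_real r * D"] assms by (simp add: norm_mult norm_D)

lemma ray_field_deriv:
  assumes "(G has_field_derivative g) (at (of_real p + of_real r * D))"
  shows "((\<lambda>r. G (of_real p + of_real r * D)) has_vector_derivative g * D) (at r within S)"
proof -
  have "((\<lambda>r. of_real p + of_real r * D) has_vector_derivative D) (at r within S)"
    by (auto intro!: derivative_eq_intros simp: has_vector_derivative_def fun_eq_iff scaleR_conv_of_real)
  then have "(G \<circ> (\<lambda>r. of_real p + of_real r * D) has_vector_derivative D * g) (at r within S)"
    by (rule field_vector_diff_chain_within)
       (use assms has_field_derivative_at_within in blast)
  then show ?thesis by (simp add: o_def mult.commute)
qed

lemma integral_ray_primitive:
  assumes "\<And>s. s \<in> sect \<psi> \<Longrightarrow> (G has_field_derivative F s) (at s)" "0 < p" "0 \<le> M"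
  shows "integral {0..M} (\<lambda>r. F (of_real p + of_real r * D) * D)
     = G (of_real p + of_real M * D) - G (of_real p)"
proof -
  have "((\<lambda>r. F (of_real p + of_real r * D) * D) has_integral
     (G (of_real p + of_real M * D) - G (of_real p + of_real 0 * D))) {0..M}"
    by (rule fundamental_theorem_of_calculus[OF assms(3)], rule ray_field_deriv, rule assms(1), rule ray_in_sect)
      (use assms in auto)
  from integral_unique[OF this] show ?thesis by (simp del: integral_mult_left)
qed

text \<open>The kernels below may be singular at 0, so \<open>exp (Re s)\<close> controls them only
  outside a disc of radius m, which the rays avoid when \<open>m \<le> p * cos \<psi>\<close>. As
  the real part falls by \<open>sin \<psi>\<close> per unit of r, this growth bound becomes
  exponential decay in r.\<close>

lemma ray_exp_bound:
  assumes F: "\<And>s. s \<in> sect \<psi> \<Longrightarrow> m \<le> norm s \<Longrightarrow> norm (F s) \<le> B * exp (Re s)"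
    and "0 < p" "m \<le> p * cos \<psi>" "0 \<le> r"
  shows "norm (F (of_real p + of_real r * D)) \<le> B * exp p * exp (- sin \<psi> * r)"
proof -
  have "m \<le> norm (of_real p + of_real r * D)" using norm_ray_ge1[of p r] assms by linarith
  from F[OF ray_in_sect this] assms have "norm (F (of_real p + of_real r * D)) \<le> B * exp (p - sin \<psi> * r)"
    by (simp add: ReD mult.commute)
  also have "\<dots> = B * exp p * exp (- sin \<psi> * r)"
    by (simp add: exp_diff exp_minus field_simps)
  finally show ?thesis .
qed

lemma continuous_on_ray:
  assumes "continuous_on (sect \<psi>) F" "0 < p"
  shows "continuous_on {0..} (\<lambda>r. F (of_real p + of_real r * D) * D)"
  by (intro continuous_intros continuous_on_compose2[OF assms(1)]) (use assms ray_in_sect in auto)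

lemma ray_absolutely_integrable:
  assumes "continuous_on (sect \<psi>) F"
    and F: "\<And>s. s \<in> sect \<psi> \<Longrightarrow> m \<le> norm s \<Longrightarrow> norm (F s) \<le> B * exp (Re s)"
    and "0 < p" "m \<le> p * cos \<psi>"
  shows "(\<lambda>r. F (of_real p + of_real r * D) * D) absolutely_integrable_on {0..}"
  by (rule absolutely_integrable_exp_bounded[OF continuous_on_ray sin_pos, of _ _ "B * exp p"])
     (use assms ray_exp_bound[OF F] in \<open>auto simp: norm_mult norm_D\<close>)

lemma ray_primitive_tendsto:
  assumes "continuous_on (sect \<psi>) F"
    and F: "\<And>s. s \<in> sect \<psi> \<Longrightarrow> m \<le> norm s \<Longrightarrow> norm (F s) \<le> B * exp (Re s)"
    and "0 < p" "m \<le> p * cos \<psi>"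
    and G: "\<And>s. s \<in> sect \<psi> \<Longrightarrow> (G has_field_derivative F s) (at s)"
  shows "((\<lambda>M. G (of_real p + of_real M * D) - G (of_real p)) \<longlongrightarrow> ray_integral D p F) at_top"
proof -
  have "((\<lambda>M. integral {0..M} (\<lambda>r. F (of_real p + of_real r * D) * D)) \<longlongrightarrow> ray_integral D p F) at_top"
    unfolding ray_integral_def
    by (rule integral_tendsto_at_top[OF ray_absolutely_integrable[OF assms(1-4)]])
  moreover have "\<forall>\<^sub>F M in at_top. integral {0..M} (\<lambda>r. F (of_real p + of_real r * D) * D)
     = G (of_real p + of_real M * D) - G (of_real p)"
    using eventually_ge_at_top[of 0] by eventually_elim (rule integral_ray_primitive[OF G assms(3)])
  ultimately show ?thesis by (rule Lim_transform_eventually)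
qed

lemma exp_decay: "((\<lambda>M. K * exp (- sin \<psi> * M)) \<longlongrightarrow> 0) at_top"
proof -
  have "filterlim (\<lambda>M. sin \<psi> * M) at_top at_top"
    by (rule filterlim_tendsto_pos_mult_at_top[OF tendsto_const sin_pos filterlim_ident])
  then have "filterlim (\<lambda>M. - sin \<psi> * M) at_bot at_top"
    by (simp add: filterlim_uminus_at_bot)
  then have "((\<lambda>M. exp (- sin \<psi> * M)) \<longlongrightarrow> 0) at_top"
    by (rule filterlim_compose[OF exp_at_bot])
  from tendsto_mult_right_zero[OF this] show ?thesis by simp
qed

lemma ray_integral_derivative:
  assumes "continuous_on (sect \<psi>) F"
    and F: "\<And>s. s \<in> sect \<psi> \<Longrightarrow> m \<le> norm s \<Longrightarrow> norm (F s) \<le> B * exp (Re s)"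
    and p: "0 < p" "m \<le> p * cos \<psi>"
    and G: "\<And>s. s \<in> sect \<psi> \<Longrightarrow> (G has_field_derivative F s) (at s)"
    and Gb: "\<And>s. s \<in> sect \<psi> \<Longrightarrow> m \<le> norm s \<Longrightarrow> norm (G s) \<le> B' * exp (Re s)"
  shows "ray_integral D p F = - G (of_real p)"
proof -
  have "((\<lambda>M. G (of_real p + of_real M * D)) \<longlongrightarrow> 0) at_top"
  proof (rule tendsto_0_le[OF exp_decay[of "B' * exp p"], of _ 1])
    show "\<forall>\<^sub>F M in at_top. norm (G (of_real p + of_real M * D)) \<le> norm (B' * exp p * exp (- sin \<psi> * M)) * 1"
      using eventually_ge_at_top[of 0]
    proof eventually_elim
      fix M :: real assume "0 \<le> M"
      then have "norm (G (of_real p + of_real M * D)) \<le> B' * exp p * exp (- sin \<psi> * M)"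
        using ray_exp_bound[OF Gb p] by blast
      then show "norm (G (of_real p + of_real M * D)) \<le> norm (B' * exp p * exp (- sin \<psi> * M)) * 1"
        using abs_ge_self[of "B' * exp p * exp (- sin \<psi> * M)"] by simp
    qed
  qed
  then have "((\<lambda>M. G (of_real p + of_real M * D) - G (of_real p)) \<longlongrightarrow> 0 - G (of_real p)) at_top"
    by (intro tendsto_intros)
  with ray_primitive_tendsto[OF assms(1-5)] show ?thesis
    by (auto dest: tendsto_unique[OF trivial_limit_at_top_linorder])
qed

text \<open>This is the far side of the contour: the two points are joined by a horizontal segment
  of length q - p, on which the derivative of G is of order exp(-M sin \<psi>).\<close>

lemma primitive_shift_tendsto:
  assumes F: "\<And>s. s \<in> sect \<psi> \<Longrightarrow> m \<le> norm s \<Longrightarrow> norm (F s) \<le> B * exp (Re s)"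
    and p: "0 < p" "p \<le> q" "m \<le> p * cos \<psi>"
    and G: "\<And>s. s \<in> sect \<psi> \<Longrightarrow> (G has_field_derivative F s) (at s)"
  shows "((\<lambda>M. G (of_real p + of_real M * D) - G (of_real q + of_real M * D)) \<longlongrightarrow> 0) at_top"
proof (rule tendsto_0_le[OF exp_decay[of "\<bar>B\<bar> * exp q * (q - p)"], of _ 1])
  show "\<forall>\<^sub>F M in at_top. norm (G (of_real p + of_real M * D) - G (of_real q + of_real M * D))
      \<le> norm (\<bar>B\<bar> * exp q * (q - p) * exp (- sin \<psi> * M)) * 1"
    using eventually_ge_at_top[of 0]
  proof eventually_elim
    fix M :: real assume M: "0 \<le> M"
    let ?P = "\<lambda>t. of_real t + of_real M * D"
    have seg: "\<exists>t. p \<le> t \<and> t \<le> q \<and> x = ?P t" if "x \<in> closed_segment (?P q) (?P p)" for x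
    proof -
      from that obtain u where u: "0 \<le> u" "u \<le> 1" "x = (1 - u) *\<^sub>R ?P q + u *\<^sub>R ?P p"
        by (auto simp: closed_segment_def)
      have "x = ?P ((1-u) * q + u * p)" using u(3) by (simp add: scaleR_conv_of_real algebra_simps)
      moreover have "p \<le> (1-u) * q + u * p" "(1-u) * q + u * p \<le> q"
        using convex_bound_le[of p q q "1-u" u] convex_bound_le[of "-p" "-p" "-q" u "1-u"] u p
        by (auto simp: algebra_simps)
          (smt (verit, best) mult_left_mono mult_right_mono)+
      ultimately show ?thesis by blast
    qed
    have "norm (G (?P p) - G (?P q)) \<le> (\<bar>B\<bar> * exp q * exp (- sin \<psi> * M)) * norm (?P p - ?P q)"
    proof (rule field_differentiable_bound[of "closed_segment (?P q) (?P p)"])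
      fix x assume "x \<in> closed_segment (?P q) (?P p)"
      then obtain t where t: "p \<le> t" "t \<le> q" "x = ?P t" using seg by blast
      have "x \<in> sect \<psi>" using t p M ray_in_sect by auto
      then show "(G has_field_derivative F x) (at x within closed_segment (?P q) (?P p))"
        using G has_field_derivative_at_within by blast
      have "m \<le> t * cos \<psi>" using p(3) t cos_pos by (meson mult_right_mono less_imp_le order_trans)
      then have "norm (F x) \<le> B * exp t * exp (- sin \<psi> * M)"
        using ray_exp_bound[where p=t, OF F _ _ M] t p by auto
      \<comment> \<open>No sign of B is assumed, so replacing \<open>exp t\<close> by
        \<open>exp q\<close> needs the absolute value.\<close>
      also have "\<dots> \<le> \<bar>B\<bar> * exp q * exp (- sin \<psi> * M)"
        using t by (intro mult_right_mono mult_mono) auto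
      finally show "norm (F x) \<le> \<bar>B\<bar> * exp q * exp (- sin \<psi> * M)" .
    qed auto
    also have "norm (?P p - ?P q) = q - p"
      using p by (simp flip: of_real_diff)
    finally show "norm (G (?P p) - G (?P q)) \<le> norm (\<bar>B\<bar> * exp q * (q - p) * exp (- sin \<psi> * M)) * 1"
      using p by (simp add: abs_mult mult_ac)
  qed
qed

end

text \<open>The two directions are \<open>e^{\<plusminus>i(\<pi>/2 + \<psi>)}\<close>; starting both rays at a positive vertex \<open>p\<close> avoids the
  circular arc of the usual Hankel contour.\<close>
definition hankel_integral :: "real \<Rightarrow> real \<Rightarrow> (complex \<Rightarrow> complex) \<Rightarrow> complex" where
  "hankel_integral \<psi> p F = ray_integral (Complex (- sin \<psi>) (cos \<psi>)) p F
      - ray_integral (Complex (- sin \<psi>) (- cos \<psi>)) p F"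

lemma sect_rayI:
  assumes "0 < \<psi>" "\<psi> < pi/2"
  shows "sect_ray \<psi> (Complex (- sin \<psi>) (cos \<psi>))" "sect_ray \<psi> (Complex (- sin \<psi>) (- cos \<psi>))"
  using assms cos_gt_zero_pi[of \<psi>] by (auto simp: sect_ray_def)

lemma hankel_integral_shift:
  assumes psi: "0 < \<psi>" "\<psi> < pi/2"
    and hol: "F holomorphic_on sect \<psi>"
    and F: "\<And>s. s \<in> sect \<psi> \<Longrightarrow> m \<le> norm s \<Longrightarrow> norm (F s) \<le> B * exp (Re s)"
    and p: "0 < p" "p \<le> q" "m \<le> p * cos \<psi>"
  shows "hankel_integral \<psi> p F = hankel_integral \<psi> q F"
proof -
  have cont: "continuous_on (sect \<psi>) F" by (rule holomorphic_on_imp_continuous_on[OF hol])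
  obtain G where G: "\<And>s. s \<in> sect \<psi> \<Longrightarrow> (G has_field_derivative F s) (at s)"
    using holomorphic_starlike_primitive[OF cont starlike_sect[OF psi] open_sect, of "{}"] hol
    by (auto simp: holomorphic_on_open[OF open_sect] field_differentiable_def)
  have q: "0 < q" "m \<le> q * cos \<psi>"
    using p cos_gt_zero_pi[of \<psi>] psi by (auto intro: order_trans[OF _ mult_right_mono])
  let ?D = "Complex (- sin \<psi>) (cos \<psi>)" and ?E = "Complex (- sin \<psi>) (- cos \<psi>)"
  interpret D: sect_ray \<psi> ?D by (rule sect_rayI[OF psi])
  interpret E: sect_ray \<psi> ?E by (rule sect_rayI[OF psi])
  let ?P = "\<lambda>p D M. of_real p + of_real M * D"
  note prim = D.ray_primitive_tendsto[OF cont F p(1,3) G] E.ray_primitive_tendsto[OF cont F p(1,3) G]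
     D.ray_primitive_tendsto[OF cont F q G] E.ray_primitive_tendsto[OF cont F q G]
  \<comment> \<open>The vertex values of G are kept here to match the limits of the four ray
    integrals. They cancel on regrouping, which leaves one far-end difference per direction.\<close>
  have "((\<lambda>M. ((G (?P p ?D M) - G p) - (G (?P p ?E M) - G p)) - ((G (?P q ?D M) - G q) - (G (?P q ?E M) - G q)))
     \<longlongrightarrow> hankel_integral \<psi> p F - hankel_integral \<psi> q F) at_top"
    unfolding hankel_integral_def by (intro tendsto_diff prim)
  moreover have "((\<lambda>M. (G (?P p ?D M) - G (?P q ?D M)) - (G (?P p ?E M) - G (?P q ?E M))) \<longlongrightarrow> 0 - 0) at_top"
    by (intro tendsto_diff D.primitive_shift_tendsto[OF F p G] E.primitive_shift_tendsto[OF F p G])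
  moreover have "(\<lambda>M. (G (?P p ?D M) - G (?P q ?D M)) - (G (?P p ?E M) - G (?P q ?E M)))
     = (\<lambda>M. ((G (?P p ?D M) - G p) - (G (?P p ?E M) - G p)) - ((G (?P q ?D M) - G q) - (G (?P q ?E M) - G q)))"
    by (simp add: fun_eq_iff)
  ultimately have "hankel_integral \<psi> p F - hankel_integral \<psi> q F = 0 - 0"
    by (simp only: tendsto_unique[OF trivial_limit_at_top_linorder])
  then show ?thesis by simp
qed

lemma hankel_integral_derivative:
  assumes psi: "0 < \<psi>" "\<psi> < pi/2"
    and cont: "continuous_on (sect \<psi>) F"
    and F: "\<And>s. s \<in> sect \<psi> \<Longrightarrow> m \<le> norm s \<Longrightarrow> norm (F s) \<le> B * exp (Re s)"
    and p: "0 < p" "m \<le> p * cos \<psi>"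
    and G: "\<And>s. s \<in> sect \<psi> \<Longrightarrow> (G has_field_derivative F s) (at s)"
    and Gb: "\<And>s. s \<in> sect \<psi> \<Longrightarrow> m \<le> norm s \<Longrightarrow> norm (G s) \<le> B' * exp (Re s)"
  shows "hankel_integral \<psi> p F = 0"
  unfolding hankel_integral_def
  using sect_ray.ray_integral_derivative[OF sect_rayI(1)[OF psi] cont F p G Gb]
    sect_ray.ray_integral_derivative[OF sect_rayI(2)[OF psi] cont F p G Gb] by simp

section \<open>The Gamma integral along a rotated ray\<close>

text \<open>Compares a primitive of the Gamma integrand on the ray through w with its value on the
  positive axis. Joining the points by a segment instead of an arc keeps the real part above t\<mu>,
  which controls the power and the exponential together. The factor
  \<open>t powr a * exp (- (\<mu> * t))\<close> vanishes both for t near 0 and for t near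
  infinity.\<close>

lemma norm_segment_Gamma_primitive:
  fixes w :: complex
  assumes a: "0 < a" "a < 1" and w: "0 < Re w" and t: "0 < t"
    and G: "\<And>s. 0 < Re s \<Longrightarrow> (G has_field_derivative (s powr (of_real a - 1) * exp (- s))) (at s)"
  defines "\<mu> \<equiv> min 1 (Re w)"
  shows "norm (G (of_real t * w) - G (of_real t)) \<le> norm (w - 1) * \<mu> powr (a - 1) * (t powr a * exp (- (\<mu> * t)))"
proof -
  have mu: "0 < \<mu>" using w by (simp add: \<mu>_def)
  let ?S = "closed_segment (of_real t) (of_real t * w)"
  have Re: "t * \<mu> \<le> Re x" if "x \<in> ?S" for x
  proof -
    from that obtain u where u: "0 \<le> u" "u \<le> 1" "x = (1 - u) *\<^sub>R of_real t + u *\<^sub>R (of_real t * w)"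
      by (auto simp: closed_segment_def)
    have "(1 - u) * \<mu> + u * \<mu> \<le> (1 - u) * 1 + u * Re w"
      using u by (intro add_mono mult_left_mono) (auto simp: \<mu>_def)
    then have "\<mu> \<le> (1 - u) + u * Re w" by (simp add: algebra_simps)
    then have "t * \<mu> \<le> t * ((1 - u) + u * Re w)" using t by (intro mult_left_mono) auto
    also have "\<dots> = Re x" unfolding u(3) by (simp add: algebra_simps)
    finally show ?thesis .
  qed
  have "norm (G (of_real t * w) - G (of_real t)) \<le>
     ((t * \<mu>) powr (a - 1) * exp (- (t * \<mu>))) * norm (of_real t * w - of_real t)"
  proof (rule field_differentiable_bound[of ?S])
    fix x assume "x \<in> ?S"
    then have x: "t * \<mu> \<le> Re x" by (rule Re)
    moreover have "0 < t * \<mu>" using t mu by simp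
    ultimately have pos: "0 < Re x" by linarith
    show "(G has_field_derivative x powr (of_real a - 1) * exp (- x)) (at x within ?S)"
      using G[OF pos] by (rule has_field_derivative_at_within)
    have "norm x powr (a - 1) \<le> (t * \<mu>) powr (a - 1)"
      using x complex_Re_le_cmod[of x] a \<open>0 < t * \<mu>\<close> by (intro powr_mono2') linarith+
    moreover have "norm (x powr (of_real a - 1)) = norm x powr (a - 1)"
      using norm_powr_real_powr'[of "of_real a - 1" x] by simp
    ultimately show "norm (x powr (of_real a - 1) * exp (- x)) \<le> (t * \<mu>) powr (a - 1) * exp (- (t * \<mu>))"
      unfolding norm_mult using x by (intro mult_mono) auto
  qed auto
  also have "norm (of_real t * w - of_real t) = t * norm (w - 1)"
  proof -
    have "of_real t * w - of_real t = of_real t * (w - 1)" by (simp add: algebra_simps)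
    then show ?thesis using t by (simp add: norm_mult)
  qed
  also have "(t * \<mu>) powr (a - 1) * exp (- (t * \<mu>)) * (t * norm (w - 1))
     = norm (w - 1) * \<mu> powr (a - 1) * ((t powr (a - 1) * t) * exp (- (\<mu> * t)))"
    using t mu by (simp add: powr_mult mult_ac)
  also have "t powr (a - 1) * t = t powr a" using t powr_add[of t "a - 1" 1] by simp
  finally show ?thesis .
qed

lemma absolutely_integrable_rotated_Gamma:
  fixes w :: complex
  assumes a: "0 < a" and w: "0 < Re w"
  shows "(\<lambda>r. of_real r powr (of_real a - 1) * exp (- (of_real r * w))) absolutely_integrable_on {0<..}"
proof (rule measurable_bounded_by_integrable_imp_absolutely_integrable)
  show "(\<lambda>r. of_real r powr (of_real a - 1) * exp (- (of_real r * w))) \<in> borel_measurable (lebesgue_on {0<..})"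
    by (rule continuous_imp_measurable_on_sets_lebesgue)
       (auto intro!: continuous_intros)
  have "(\<lambda>r. complex_of_real r powr (of_real a - 1) / of_real (exp (Re w * r))) absolutely_integrable_on {0<..}"
    by (rule absolutely_integrable_Gamma_integral) (use a w in auto)
  then have "(\<lambda>r. norm (complex_of_real r powr (of_real a - 1) / of_real (exp (Re w * r)))) integrable_on {0<..}"
    unfolding absolutely_integrable_on_def by blast
  then show "(\<lambda>r. norm (complex_of_real r powr (of_real a - 1) / of_real (exp (Re w * r)))) integrable_on {0<..}" .
qed (auto simp: norm_mult norm_divide exp_minus field_simps)

text \<open>With s = r w the left side is the integral of s^(a-1) e^(-s) along the ray through w. It
  does not depend on w, since the difference to the case w = 1 is made of end contributions that
  vanish; for w = 1 it is Euler's integral.\<close>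

lemma rotated_Gamma_integral:
  fixes w :: complex
  assumes a: "0 < a" "a < 1" and w: "0 < Re w"
  shows "w powr of_real a * integral {0<..} (\<lambda>r. of_real r powr (of_real a - 1) * exp (- (of_real r * w)))
    = of_real (Gamma a)"
proof -
  define f where "f = (\<lambda>s. s powr (of_real a - 1) * exp (- s) :: complex)"
  have hol: "f holomorphic_on {s. 0 < Re s}" unfolding f_def
    by (intro holomorphic_intros) (auto simp: complex_nonpos_Reals_iff)
  have op: "open {s. 0 < Re s}" by (simp add: open_halfspace_Re_gt)
  obtain G where G: "\<And>s. 0 < Re s \<Longrightarrow> (G has_field_derivative f s) (at s)"
    using holomorphic_convex_primitive'[OF convex_halfspace_Re_gt op hol] at_within_open[OF _ op] by auto
  \<comment> \<open>The primitive is available only on the open half-plane and not at 0, hence the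
    exhaustion by compact intervals that stay away from both ends.\<close>
  define A where "A n = {1 / real (Suc n) .. real (Suc n)}" for n
  have inc: "incseq A" unfolding A_def incseq_def by (auto simp: frac_le intro: order_trans[rotated])
  have meas: "A n \<in> sets lebesgue" for n unfolding A_def by simp
  have UA: "(\<Union>n. A n) = {0<..}"
  proof (intro equalityI subsetI)
    fix x :: real assume "x \<in> {0<..}"
    then have x: "0 < x" by simp
    obtain n where n: "max x (1 / x) < real n" using reals_Archimedean2 by blast
    have "1 / real (Suc n) \<le> x" using n x by (simp add: field_simps)
    with n show "x \<in> (\<Union>n. A n)" by (auto simp: A_def intro!: exI[of _ n])
  qed (auto simp: A_def intro: less_le_trans[rotated])
  let ?I = "\<lambda>v. (\<lambda>r. of_real r powr (of_real a - 1) * exp (- (of_real r * v))) :: real \<Rightarrow> complex"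
  have lim: "(\<lambda>n. v powr of_real a * integral (A n) (?I v)) \<longlonglongrightarrow> v powr of_real a * integral {0<..} (?I v)"
    if v: "0 < Re v" for v
  proof (intro tendsto_mult_left)
    note ai = absolutely_integrable_rotated_Gamma[OF a(1) v]
    have "(\<lambda>n. set_lebesgue_integral lebesgue (A n) (?I v)) \<longlonglongrightarrow> set_lebesgue_integral lebesgue (\<Union>n. A n) (?I v)"
      by (rule set_integral_cont_up) (use inc ai in \<open>auto simp: UA meas\<close>)
    moreover have "set_lebesgue_integral lebesgue (A n) (?I v) = integral (A n) (?I v)" for n
      by (rule set_lebesgue_integral_eq_integral, rule set_integrable_subset[OF ai])
         (auto simp: A_def intro: less_le_trans[rotated])
    moreover have "set_lebesgue_integral lebesgue {0<..} (?I v) = integral {0<..} (?I v)"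
      by (rule set_lebesgue_integral_eq_integral[OF ai])
    ultimately show "(\<lambda>n. integral (A n) (?I v)) \<longlonglongrightarrow> integral {0<..} (?I v)" by (simp add: UA)
  qed
  have fin: "v powr of_real a * integral (A n) (?I v) = G (of_real (real (Suc n)) * v) - G (of_real (1 / real (Suc n)) * v)"
    if v: "0 < Re v" for v n
  proof -
    have "((\<lambda>r. f (of_real r * v) * v) has_integral
       (G (of_real (real (Suc n)) * v) - G (of_real (1 / real (Suc n)) * v))) (A n)"
      unfolding A_def
    proof (rule fundamental_theorem_of_calculus)
      show "1 / real (Suc n) \<le> real (Suc n)" by (simp add: divide_simps) (simp add: field_simps)
      fix r assume "r \<in> {1 / real (Suc n) .. real (Suc n)}"
      then have "0 < 1 / real (Suc n)" "1 / real (Suc n) \<le> r" by auto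
      then have r: "0 < r" by linarith
      have "((\<lambda>r. of_real r * v) has_vector_derivative v) (at r within {1 / real (Suc n) .. real (Suc n)})"
        by (auto intro!: derivative_eq_intros simp: has_vector_derivative_def fun_eq_iff scaleR_conv_of_real)
      then have "(G \<circ> (\<lambda>r. of_real r * v) has_vector_derivative v * f (of_real r * v)) (at r within {1 / real (Suc n) .. real (Suc n)})"
        by (rule field_vector_diff_chain_within)
           (use G[of "of_real r * v"] r v has_field_derivative_at_within in auto)
      then show "((\<lambda>r. G (of_real r * v)) has_vector_derivative f (of_real r * v) * v) (at r within {1 / real (Suc n) .. real (Suc n)})"
        by (simp add: o_def mult.commute)
    qed
    moreover have "f (of_real r * v) * v = v powr of_real a * ?I v r" if "r \<in> A n" for r
    proof -
      have "0 < 1 / real (Suc n)" "1 / real (Suc n) \<le> r" using that by (auto simp: A_def)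
      then have r: "0 < r" by linarith
      have v0: "v \<noteq> 0" using v by auto
      have "(of_real r * v) powr (of_real a - 1) = of_real r powr (of_real a - 1) * v powr (of_real a - 1)"
        using r by (intro powr_times_real_left) auto
      moreover have "v powr (of_real a - 1) * v = v powr of_real a"
        using v0 by (simp add: powr_diff)
      ultimately show ?thesis by (simp add: f_def mult_ac)
    qed
    ultimately have "((\<lambda>r. v powr of_real a * ?I v r) has_integral
       (G (of_real (real (Suc n)) * v) - G (of_real (1 / real (Suc n)) * v))) (A n)"
      by (rule has_integral_cong[THEN iffD1, rotated]) auto
    from integral_unique[OF this] show ?thesis by simp
  qed
  define \<mu> where "\<mu> = min 1 (Re w)"
  have mu: "0 < \<mu>" using w by (simp add: \<mu>_def)
  define E where "E t = G (of_real t * w) - G (of_real t)" for t :: real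
  have Eb: "norm (E t) \<le> norm (w - 1) * \<mu> powr (a - 1) * (t powr a * exp (- (\<mu> * t)))" if "0 < t" for t
    unfolding E_def \<mu>_def by (rule norm_segment_Gamma_primitive[OF a w that G[unfolded f_def]])
  have l1: "(\<lambda>n. norm (w - 1) * \<mu> powr (a - 1) * (real (Suc n) powr a * exp (- (\<mu> * real (Suc n))))) \<longlonglongrightarrow> 0"
    using mu a by real_asymp
  have l2: "(\<lambda>n. norm (w - 1) * \<mu> powr (a - 1) * ((1 / real (Suc n)) powr a * exp (- (\<mu> * (1 / real (Suc n)))))) \<longlonglongrightarrow> 0"
    using mu a by real_asymp
  have E1: "(\<lambda>n. E (real (Suc n))) \<longlonglongrightarrow> 0"
    by (rule Lim_null_comparison[OF _ l1]) (intro always_eventually allI Eb, simp)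
  have E2: "(\<lambda>n. E (1 / real (Suc n))) \<longlonglongrightarrow> 0"
    by (rule Lim_null_comparison[OF _ l2]) (intro always_eventually allI Eb, simp)
  have "(\<lambda>n. w powr of_real a * integral (A n) (?I w) - 1 powr of_real a * integral (A n) (?I 1)) \<longlonglongrightarrow> 0 - 0"
  proof -
    have one: "0 < Re 1" by simp
    have "w powr of_real a * integral (A n) (?I w) - 1 powr of_real a * integral (A n) (?I 1)
       = E (real (Suc n)) - E (1 / real (Suc n))" for n
      unfolding fin[OF w] fin[OF one] E_def by (simp add: algebra_simps)
    then show ?thesis using tendsto_diff[OF E1 E2] by (simp only:)
  qed
  moreover have "(\<lambda>n. w powr of_real a * integral (A n) (?I w) - 1 powr of_real a * integral (A n) (?I 1)) \<longlonglongrightarrow>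
     w powr of_real a * integral {0<..} (?I w) - 1 powr of_real a * integral {0<..} (?I 1)"
    by (intro tendsto_diff lim w) auto
  ultimately have "w powr of_real a * integral {0<..} (?I w) - 1 powr of_real a * integral {0<..} (?I 1) = 0"
    using LIMSEQ_unique by fastforce
  moreover have "integral {0<..} (?I 1) = of_real (Gamma a)"
    using Gamma_integral_complex'[of "of_real a"] a
    by (intro integral_unique) (simp add: exp_minus exp_of_real field_simps flip: Gamma_complex_of_real)
  ultimately show ?thesis by simp
qed

section \<open>Hankel's formula\<close>

definition hankel_kernel :: "real \<Rightarrow> complex \<Rightarrow> complex" where
  "hankel_kernel b s = exp s * s powr of_real (- b)"

lemma norm_hankel_kernel: "norm (hankel_kernel b s) = norm s powr (- b) * exp (Re s)"
  using norm_powr_real_powr'[of "of_real (- b)" s] by (simp add: hankel_kernel_def norm_mult del: of_real_minus)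

lemma hankel_kernel_bound:
  assumes "0 \<le> b" "0 < m" "m \<le> norm s"
  shows "norm (hankel_kernel b s) \<le> m powr (- b) * exp (Re s)"
  unfolding norm_hankel_kernel using assms by (intro mult_right_mono powr_mono2') auto

lemma holomorphic_hankel_kernel:
  assumes "0 < \<psi>" "\<psi> < pi/2" shows "hankel_kernel b holomorphic_on sect \<psi>"
  unfolding hankel_kernel_def using sect_subset_slit[OF assms] by (intro holomorphic_intros) auto

lemma continuous_hankel_kernel:
  assumes "0 < \<psi>" "\<psi> < pi/2" shows "continuous_on (sect \<psi>) (hankel_kernel b)"
  by (rule holomorphic_on_imp_continuous_on[OF holomorphic_hankel_kernel[OF assms]])

lemma hankel_kernel_derivative:
  assumes "s \<notin> \<real>\<^sub>\<le>\<^sub>0"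
  shows "(hankel_kernel b has_field_derivative hankel_kernel b s - of_real b * hankel_kernel (b + 1) s) (at s)"
proof -
  have e: "- complex_of_real b - 1 = - 1 - complex_of_real b" by simp
  show ?thesis unfolding hankel_kernel_def
    by (auto intro!: derivative_eq_intros simp: assms algebra_simps e)
qed

lemma hankel_integral_diff:
  assumes psi: "0 < \<psi>" "\<psi> < pi/2"
    and F: "continuous_on (sect \<psi>) F" "\<And>s. s \<in> sect \<psi> \<Longrightarrow> m \<le> norm s \<Longrightarrow> norm (F s) \<le> B * exp (Re s)"
    and G: "continuous_on (sect \<psi>) G" "\<And>s. s \<in> sect \<psi> \<Longrightarrow> m \<le> norm s \<Longrightarrow> norm (G s) \<le> B' * exp (Re s)"
    and p: "0 < p" "m \<le> p * cos \<psi>"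
  shows "hankel_integral \<psi> p (\<lambda>s. F s - G s) = hankel_integral \<psi> p F - hankel_integral \<psi> p G"
proof -
  have "ray_integral D p (\<lambda>s. F s - G s) = ray_integral D p F - ray_integral D p G" if "sect_ray \<psi> D" for D
  proof -
    interpret sect_ray \<psi> D by (rule that)
    have "(\<lambda>r. F (of_real p + of_real r * D) * D) integrable_on {0..}"
         "(\<lambda>r. G (of_real p + of_real r * D) * D) integrable_on {0..}"
      using ray_absolutely_integrable[OF F p] ray_absolutely_integrable[OF G p]
      by (auto intro: set_lebesgue_integral_eq_integral)
    from integral_diff[OF this] show ?thesis
      unfolding ray_integral_def left_diff_distrib by simp
  qed
  from this[OF sect_rayI(1)[OF psi]] this[OF sect_rayI(2)[OF psi]] show ?thesis
    by (simp add: hankel_integral_def)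
qed

lemma ray_integral_cmult: "ray_integral D p (\<lambda>s. c * F s) = c * ray_integral D p F"
  unfolding ray_integral_def by (simp add: mult.assoc del: integral_mult_left)

lemma hankel_integral_cmult: "hankel_integral \<psi> p (\<lambda>s. c * F s) = c * hankel_integral \<psi> p F"
  unfolding hankel_integral_def ray_integral_cmult by (simp add: algebra_simps)

text \<open>Integration by parts: the difference of the two sides integrates the derivative of e^s
  s^(-b), whose vertex contributions cancel between the rays. For b = 0 it says that e^s integrates
  to zero, which later removes the leading term of the Mittag-Leffler integrand.\<close>

lemma hankel_integral_recurrence:
  assumes psi: "0 < \<psi>" "\<psi> < pi/2" and b: "0 \<le> b" and p: "0 < p"
  shows "hankel_integral \<psi> p (hankel_kernel b) = of_real b * hankel_integral \<psi> p (hankel_kernel (b + 1))"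
proof -
  define m where "m = p * cos \<psi>"
  have m: "0 < m" using p psi cos_gt_zero_pi[of \<psi>] by (auto simp: m_def)
  let ?F = "\<lambda>s. hankel_kernel b s - of_real b * hankel_kernel (b + 1) s"
  note k0 = hankel_kernel_bound[OF b m]
  have k1: "norm (of_real b * hankel_kernel (b + 1) s) \<le> (b * m powr (- (b + 1))) * exp (Re s)" if "m \<le> norm s" for s
    using mult_left_mono[OF hankel_kernel_bound[of "b + 1" m s] b] that m b by (simp add: norm_mult mult.assoc)
  have cont1: "continuous_on (sect \<psi>) (\<lambda>s. of_real b * hankel_kernel (b + 1) s)"
    by (intro continuous_intros continuous_hankel_kernel psi)
  have "hankel_integral \<psi> p ?F = 0"
  proof (rule hankel_integral_derivative[OF psi, where G = "hankel_kernel b"])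
    show "continuous_on (sect \<psi>) ?F"
      by (intro continuous_intros continuous_hankel_kernel psi)
    show "norm (?F s) \<le> (m powr (- b) + b * m powr (- (b + 1))) * exp (Re s)" if "m \<le> norm s" for s
      using norm_triangle_ineq4[of "hankel_kernel b s" "of_real b * hankel_kernel (b + 1) s"] k0[OF that] k1[OF that]
      by (simp add: algebra_simps)
    show "0 < p" "m \<le> p * cos \<psi>" using p by (auto simp: m_def)
    show "norm (hankel_kernel b s) \<le> m powr (- b) * exp (Re s)" if "m \<le> norm s" for s by (rule k0[OF that])
    show "(hankel_kernel b has_field_derivative ?F s) (at s)" if "s \<in> sect \<psi>" for s
      by (rule hankel_kernel_derivative[OF sect_subset_slit[OF psi that]])
  qed
  moreover have "hankel_integral \<psi> p ?F = hankel_integral \<psi> p (hankel_kernel b)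
      - hankel_integral \<psi> p (\<lambda>s. of_real b * hankel_kernel (b + 1) s)"
    by (rule hankel_integral_diff[OF psi continuous_hankel_kernel[OF psi] k0 cont1 k1 p]) (auto simp: m_def)
  ultimately show ?thesis by (simp add: hankel_integral_cmult)
qed

text \<open>As b < 1, the power s^(-b) is integrable at the origin, so the vertex may tend to 0.
  Since -D has positive real part, the limit is the Gamma integral with exponent 1 - b along the ray
  through -D; the quotient of the powers of D and -D carries the phase.\<close>

lemma hankel_kernel_ray_limit:
  assumes "sect_ray \<psi> D" and b: "0 < b" "b < 1"
  shows "(\<lambda>n. ray_integral D (1 / real (Suc n)) (hankel_kernel b)) \<longlonglongrightarrow>
     of_real (Gamma (1 - b)) * D powr of_real (1 - b) / (- D) powr of_real (1 - b)"
proof -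
  interpret sect_ray \<psi> D by (rule assms)
  define a where "a = 1 - b"
  have a: "0 < a" "a < 1" using b by (auto simp: a_def)
  have D0: "D \<noteq> 0" using norm_D by auto
  have Dslit: "of_real r * D \<notin> \<real>\<^sub>\<le>\<^sub>0" if "0 < r" for r
    using ImD cos_pos that by (auto simp: complex_nonpos_Reals_iff)
  let ?f = "\<lambda>n r. hankel_kernel b (of_real (1 / real (Suc n)) + of_real r * D) * D"
  let ?g = "\<lambda>r. hankel_kernel b (of_real r * D) * D"
  \<comment> \<open>The factor \<open>exp 1\<close> pays for vertices up to 1, and the power of
    \<open>cos \<psi>\<close> comes from \<open>norm_ray_ge2\<close>. What remains is r^(-b) exp(-r
    sin \<psi>), written as the modulus of a Gamma integrand whose integrability is known.\<close>
  let ?h = "\<lambda>r. exp 1 * cos \<psi> powr (- b) * norm (complex_of_real r powr (of_real a - 1) / of_real (exp (sin \<psi> * r)))"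
  have sp: "integral {0..} F = integral {0<..} F" for F :: "real \<Rightarrow> complex"
    by (rule integral_spike_set; rule negligible_subset[of "{0}"]) auto
  have lim: "(\<lambda>n. integral {0<..} (?f n)) \<longlonglongrightarrow> integral {0<..} ?g"
  proof (rule dominated_convergence)
    show "?f n integrable_on {0<..}" for n
    proof -
      have "(\<lambda>r. ?f n r) absolutely_integrable_on {0..}"
        by (rule ray_absolutely_integrable[OF continuous_hankel_kernel[OF psi]
              hankel_kernel_bound[OF less_imp_le[OF b(1)], of "(1 / real (Suc n)) * cos \<psi>"]])
           (use cos_pos in auto)
      then have "?f n absolutely_integrable_on {0<..}"
        by (rule set_integrable_subset) auto
      then show ?thesis by (rule set_lebesgue_integral_eq_integral)
    qed
    have "(\<lambda>r. complex_of_real r powr (of_real a - 1) / of_real (exp (sin \<psi> * r))) absolutely_integrable_on {0<..}"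
      by (rule absolutely_integrable_Gamma_integral) (use a sin_pos in auto)
    then show "?h integrable_on {0<..}"
      unfolding absolutely_integrable_on_def by (intro integrable_on_mult_right) blast
    show "norm (?f n r) \<le> ?h r" if "r \<in> {0<..}" for n r
    proof -
      have r: "0 < r" using that by simp
      let ?s = "of_real (1 / real (Suc n)) + of_real r * D"
      have "norm (?f n r) = norm ?s powr (- b) * exp (Re ?s)"
        by (simp add: norm_mult norm_D norm_hankel_kernel)
      also have "\<dots> \<le> (r * cos \<psi>) powr (- b) * exp (1 - sin \<psi> * r)"
      proof (intro mult_mono powr_mono2')
        show "r * cos \<psi> \<le> norm ?s" using norm_ray_ge2[of r "1 / real (Suc n)"] r by linarith
        have "Re ?s = 1 / real (Suc n) - sin \<psi> * r" by (rule Re_ray)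
        moreover have "1 / real (Suc n) \<le> 1" by simp
        ultimately show "exp (Re ?s) \<le> exp (1 - sin \<psi> * r)"
          unfolding exp_le_cancel_iff by linarith
      qed (use r cos_pos b in auto)
      also have "\<dots> = ?h r"
      proof -
        have "norm (complex_of_real r powr (of_real a - 1)) = r powr (- b)"
          using norm_powr_real_powr[of "of_real r" "of_real a - 1"] r by (simp add: a_def)
        then show ?thesis using r cos_pos
          by (simp add: norm_divide powr_mult exp_diff)
      qed
      finally show ?thesis .
    qed
    show "(\<lambda>n. ?f n r) \<longlonglongrightarrow> ?g r" if "r \<in> {0<..}" for r
    proof -
      have r: "0 < r" using that by simp
      have "(\<lambda>n. of_real (1 / real (Suc n)) + of_real r * D) \<longlonglongrightarrow> of_real 0 + of_real r * D"
        by (intro tendsto_intros LIMSEQ_inverse_real_of_nat[unfolded inverse_eq_divide])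
      moreover have "isCont (hankel_kernel b) (of_real r * D)"
        by (rule DERIV_isCont[OF hankel_kernel_derivative[OF Dslit[OF r]]])
      ultimately have "(\<lambda>n. hankel_kernel b (of_real (1 / real (Suc n)) + of_real r * D)) \<longlonglongrightarrow> hankel_kernel b (of_real r * D)"
        by (intro isCont_tendsto_compose[of _ "hankel_kernel b"]) simp_all
      then show ?thesis by (intro tendsto_intros)
    qed
  qed
  have g: "?g r = D powr of_real a * (of_real r powr (of_real a - 1) * exp (- (of_real r * (- D))))" if "r \<in> {0<..}" for r
  proof -
    have "(of_real r * D) powr of_real (- b) = of_real r powr of_real (- b) * D powr of_real (- b)"
      using that by (intro powr_times_real_left) auto
    moreover have "D powr of_real (- b) * D = D powr of_real a"
      using D0 powr_diff[of D "of_real a" 1] by (simp add: a_def powr_diff powr_minus field_simps)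
    ultimately show ?thesis by (simp add: hankel_kernel_def a_def mult_ac)
  qed
  have Dm: "0 < Re (- D)" using ReD sin_pos by simp
  have "integral {0<..} ?g = integral {0<..} (\<lambda>r. D powr of_real a * (of_real r powr (of_real a - 1) * exp (- (of_real r * (- D)))))"
    by (rule integral_cong) (rule g)
  also have "\<dots> = D powr of_real a * integral {0<..} (\<lambda>r. of_real r powr (of_real a - 1) * exp (- (of_real r * (- D))))"
    by (rule integral_mult_right)
  also have "\<dots> = D powr of_real a * (of_real (Gamma a) / (- D) powr of_real a)"
    using rotated_Gamma_integral[OF a Dm] D0 by (simp add: field_simps)
  finally show ?thesis
    using lim unfolding ray_integral_def sp a_def by (simp add: mult_ac)
qed

text \<open>The integral does not change with the vertex, so it equals its limit at vertex 0. The
  angles of D and -D differ by \<pi>, hence \<psi> drops out and the phases are e^(i\<pi>(1-b)) and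
  its conjugate. Their difference is 2i sin(\<pi>b), and reflection converts \<Gamma>(1-b)
  sin(\<pi>b) into \<pi>/\<Gamma>(b).\<close>

lemma hankel_integral_rGamma_unit_interval:
  assumes psi: "0 < \<psi>" "\<psi> < pi/2" and b: "0 < b" "b < 1"
  shows "hankel_integral \<psi> 1 (hankel_kernel b) = 2 * of_real pi * \<i> * of_real (rGamma b)"
proof -
  let ?D = "Complex (- sin \<psi>) (cos \<psi>)" and ?E = "Complex (- sin \<psi>) (- cos \<psi>)"
  let ?c = "\<lambda>D. of_real (Gamma (1 - b)) * D powr of_real (1 - b) / (- D) powr of_real (1 - b) :: complex"
  have c: "0 < cos \<psi>" using psi by (auto intro!: cos_gt_zero_pi)
  have "hankel_integral \<psi> (1 / real (Suc n)) (hankel_kernel b) = hankel_integral \<psi> 1 (hankel_kernel b)" for n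
    by (rule hankel_integral_shift[OF psi holomorphic_hankel_kernel[OF psi]
        hankel_kernel_bound[OF less_imp_le[OF b(1)], of "(1 / real (Suc n)) * cos \<psi>"]]) (use c in auto)
  moreover have "(\<lambda>n. hankel_integral \<psi> (1 / real (Suc n)) (hankel_kernel b)) \<longlonglongrightarrow> ?c ?D - ?c ?E"
    unfolding hankel_integral_def by (intro tendsto_diff hankel_kernel_ray_limit[OF sect_rayI(1)[OF psi]] hankel_kernel_ray_limit[OF sect_rayI(2)[OF psi]] b)
  ultimately have 1: "hankel_integral \<psi> 1 (hankel_kernel b) = ?c ?D - ?c ?E"
    by (simp add: LIMSEQ_const_iff)
  \<comment> \<open>All four directions are given by angles in the principal range, so that
    \<open>powr\<close> simply multiplies the angle.\<close>
  have D: "?D = exp (\<i> * of_real (pi/2 + \<psi>))" "- ?D = exp (\<i> * of_real (\<psi> - pi/2))"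
          "?E = exp (\<i> * of_real (- (pi/2 + \<psi>)))" "- ?E = exp (\<i> * of_real (pi/2 - \<psi>))"
    unfolding cis_conv_exp[symmetric] by (auto simp: complex_eq_iff cos_add sin_add cos_diff sin_diff)
  have pw: "exp (\<i> * of_real t) powr of_real x = exp (\<i> * of_real (t * x))" if "- pi < t" "t \<le> pi" for t x
    using that by (subst powr_def) (simp add: Ln_exp mult_ac)
  have ed: "exp (\<i> * of_real x) / exp (\<i> * of_real y) = exp (\<i> * complex_of_real (x - y))" for x y
    by (simp add: exp_diff right_diff_distrib)
  have "?c ?D = of_real (Gamma (1 - b)) * (exp (\<i> * of_real ((pi/2 + \<psi>) * (1 - b))) / exp (\<i> * of_real ((\<psi> - pi/2) * (1 - b))))"
    unfolding D(2) unfolding D(1) using psi by (subst (1 2) pw) auto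
  also have "\<dots> = of_real (Gamma (1 - b)) * exp (\<i> * of_real (pi * (1 - b)))"
    unfolding ed by (intro arg_cong2[where f = "(*)"] arg_cong[where f = exp] arg_cong[where f = complex_of_real] refl)
      (simp add: field_simps)
  finally have cD: "?c ?D = of_real (Gamma (1 - b)) * cis (pi * (1 - b))" by (simp add: cis_conv_exp)
  have "?c ?E = of_real (Gamma (1 - b)) * (exp (\<i> * of_real (- (pi/2 + \<psi>) * (1 - b))) / exp (\<i> * of_real ((pi/2 - \<psi>) * (1 - b))))"
    unfolding D(4) unfolding D(3) using psi by (subst (1 2) pw) auto
  also have "\<dots> = of_real (Gamma (1 - b)) * exp (\<i> * of_real (- (pi * (1 - b))))"
    unfolding ed by (intro arg_cong2[where f = "(*)"] arg_cong[where f = exp] arg_cong[where f = complex_of_real] refl)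
      (simp add: field_simps)
  finally have cE: "?c ?E = of_real (Gamma (1 - b)) * cis (- (pi * (1 - b)))" by (simp add: cis_conv_exp)
  have "cis (pi * (1 - b)) - cis (- (pi * (1 - b))) = 2 * \<i> * of_real (sin (pi * (1 - b)))"
    by (simp add: complex_eq_iff)
  then have 2: "hankel_integral \<psi> 1 (hankel_kernel b) = of_real (Gamma (1 - b) * sin (pi * (1 - b))) * (2 * \<i>)"
    unfolding 1 cD cE right_diff_distrib[symmetric] by simp
  have "sin (pi * (1 - b)) = sin (pi * b)" by (simp add: right_diff_distrib sin_diff)
  moreover have "pi * (rGamma b * rGamma (1 - b)) = sin (pi * b)"
  proof -
    have "complex_of_real (rGamma b * rGamma (1 - b)) = rGamma (of_real b) * rGamma (1 - complex_of_real b)"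
      using rGamma_complex_of_real[of "1 - b"] by (simp add: rGamma_complex_of_real)
    also have "\<dots> = complex_of_real (sin (pi * b) / pi)"
      unfolding rGamma_reflection_complex by (simp flip: sin_of_real)
    finally have "rGamma b * rGamma (1 - b) = sin (pi * b) / pi" by (simp only: of_real_eq_iff)
    then show ?thesis by (simp add: field_simps)
  qed
  moreover have "Gamma (1 - b) * rGamma (1 - b) = 1" 
  proof -
    have "0 < Gamma (1 - b)" using b by (intro Gamma_real_pos) auto
    then show ?thesis by (simp add: rGamma_inverse_Gamma)
  qed
  ultimately have "Gamma (1 - b) * sin (pi * (1 - b)) = pi * rGamma b"
    by (metis mult.left_commute mult.right_neutral)
  with 2 show ?thesis by simp
qed


lemma hankel_integral_dominated:
  assumes psi: "0 < \<psi>" "\<psi> < pi/2"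
    and cont: "\<And>n. continuous_on (sect \<psi>) (F n)"
    and F: "\<And>n s. s \<in> sect \<psi> \<Longrightarrow> m \<le> norm s \<Longrightarrow> norm (F n s) \<le> B * exp (Re s)"
    and lim: "\<And>s. s \<in> sect \<psi> \<Longrightarrow> m \<le> norm s \<Longrightarrow> (\<lambda>n. F n s) \<longlonglongrightarrow> G s"
    and p: "0 < p" "m \<le> p * cos \<psi>"
  shows "(\<lambda>n. hankel_integral \<psi> p (F n)) \<longlonglongrightarrow> hankel_integral \<psi> p G"
proof -
  have "(\<lambda>n. ray_integral D p (F n)) \<longlonglongrightarrow> ray_integral D p G" if "sect_ray \<psi> D" for D
  proof -
    interpret sect_ray \<psi> D by (rule that)
    have m: "m \<le> norm (of_real p + of_real r * D)" if "0 \<le> r" for r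
      using norm_ray_ge1[OF p(1) that] p by linarith
    show ?thesis unfolding ray_integral_def
    proof (rule dominated_convergence)
      show "(\<lambda>r. F n (of_real p + of_real r * D) * D) integrable_on {0..}" for n
        by (rule set_lebesgue_integral_eq_integral, rule ray_absolutely_integrable[OF cont F p])
      have "((\<lambda>x. exp (- sin \<psi> * x)) has_integral exp (- sin \<psi> * 0) / sin \<psi>) {0..}"
        using has_integral_exp_minus_to_infinity[OF sin_pos, of 0] by simp
      then show "(\<lambda>r. B * exp p * exp (- sin \<psi> * r)) integrable_on {0..}"
        by (intro integrable_on_mult_right) blast
      show "norm (F n (of_real p + of_real r * D) * D) \<le> B * exp p * exp (- sin \<psi> * r)" if "r \<in> {0..}" for n r
        using ray_exp_bound[OF F p, of r] that by (simp add: norm_mult norm_D)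
      show "(\<lambda>n. F n (of_real p + of_real r * D) * D) \<longlonglongrightarrow> G (of_real p + of_real r * D) * D" if "r \<in> {0..}" for r
        using that by (intro tendsto_mult_right lim ray_in_sect m p) auto
    qed
  qed
  from this[OF sect_rayI(1)[OF psi]] this[OF sect_rayI(2)[OF psi]] show ?thesis
    unfolding hankel_integral_def by (rule tendsto_diff)
qed

lemma hankel_integral_rGamma_nonint:
  assumes psi: "0 < \<psi>" "\<psi> < pi/2" and b: "0 < b" "b < 1"
  shows "hankel_integral \<psi> 1 (hankel_kernel (b + real n)) = 2 * of_real pi * \<i> * of_real (rGamma (b + real n))"
proof (induction n)
  case 0
  show ?case using hankel_integral_rGamma_unit_interval[OF psi b] by simp
next
  case (Suc n)
  let ?b = "b + real n"
  have pos: "0 < ?b" using b by linarith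
  have "of_real ?b * hankel_integral \<psi> 1 (hankel_kernel (?b + 1)) = hankel_integral \<psi> 1 (hankel_kernel ?b)"
    using hankel_integral_recurrence[OF psi less_imp_le[OF pos], of 1] by simp
  also have "\<dots> = 2 * of_real pi * \<i> * of_real (rGamma ?b)" by (rule Suc.IH)
  also have "rGamma ?b = ?b * rGamma (?b + 1)" by (rule rGamma_plus1[symmetric])
  also have "2 * of_real pi * \<i> * of_real (?b * rGamma (?b + 1)) = of_real ?b * (2 * of_real pi * \<i> * of_real (rGamma (?b + 1)))"
    by simp
  finally have "hankel_integral \<psi> 1 (hankel_kernel (?b + 1)) = 2 * of_real pi * \<i> * of_real (rGamma (?b + 1))"
    using pos by (subst (asm) mult_left_cancel) (simp_all del: of_real_add)
  then show ?case by (simp add: add_ac)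
qed

theorem hankel_integral_rGamma:
  assumes psi: "0 < \<psi>" "\<psi> < pi/2" and b: "0 < b" and p: "1 \<le> p"
  shows "hankel_integral \<psi> p (hankel_kernel b) = 2 * of_real pi * \<i> * of_real (rGamma b)"
proof -
  have c: "0 < cos \<psi>" using psi by (auto intro!: cos_gt_zero_pi)
  have "hankel_integral \<psi> 1 (hankel_kernel b) = hankel_integral \<psi> p (hankel_kernel b)"
    by (rule hankel_integral_shift[OF psi holomorphic_hankel_kernel[OF psi]
        hankel_kernel_bound[OF less_imp_le[OF b] c]]) (use p in auto)
  moreover have "hankel_integral \<psi> 1 (hankel_kernel b) = 2 * of_real pi * \<i> * of_real (rGamma b)"
  proof (cases "frac b = 0")
    case False
    have eq: "frac b + real (nat \<lfloor>b\<rfloor>) = b" using b by (simp add: frac_def)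
    moreover have "0 < frac b" using False frac_ge_0[of b] by linarith
    ultimately show ?thesis
      using hankel_integral_rGamma_nonint[OF psi _ frac_lt_1, of b "nat \<lfloor>b\<rfloor>"] by (simp only: eq)
  next
    \<comment> \<open>The recurrence carries no information at \<open>b = 0\<close>, so integers are reached by continuity in \<open>b\<close>.\<close>
    case True
    then have bn: "real (nat \<lfloor>b\<rfloor>) = b" using b by (simp add: frac_def)
    \<comment> \<open>These values stay strictly between 0 and 1, so \<open>e k + b\<close> is a
      fractional start plus an integer and the non-integer case applies.\<close>
    define e where "e k = 1 / (real k + 2)" for k :: nat
    have e: "0 < e k" "e k < 1" for k by (auto simp: e_def)
    have e0: "e \<longlonglongrightarrow> 0" unfolding e_def by real_asymp
    have "(\<lambda>k. hankel_integral \<psi> 1 (hankel_kernel (e k + b))) \<longlonglongrightarrow> hankel_integral \<psi> 1 (hankel_kernel b)"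
    proof (rule hankel_integral_dominated[OF psi continuous_hankel_kernel[OF psi], of "cos \<psi>" _ "cos \<psi> powr (- (1 + b))"])
      fix n s assume s: "s \<in> sect \<psi>" "cos \<psi> \<le> norm s"
      have "norm (hankel_kernel (e n + b) s) \<le> cos \<psi> powr (- (e n + b)) * exp (Re s)"
        using e[of n] b by (intro hankel_kernel_bound c s) linarith
      also have "\<dots> \<le> cos \<psi> powr (- (1 + b)) * exp (Re s)"
        using c e[of n] by (intro mult_right_mono powr_mono') auto
      finally show "norm (hankel_kernel (e n + b) s) \<le> cos \<psi> powr (- (1 + b)) * exp (Re s)" .
    next
      fix s assume s: "s \<in> sect \<psi>" "cos \<psi> \<le> norm s"
      have "s \<noteq> 0" using c s by auto
      have "(\<lambda>n. exp s * exp (of_real (- (e n + b)) * Ln s)) \<longlonglongrightarrow> exp s * exp (of_real (- (0 + b)) * Ln s)"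
        by (intro tendsto_intros e0)
      then show "(\<lambda>n. hankel_kernel (e n + b) s) \<longlonglongrightarrow> hankel_kernel b s"
        using \<open>s \<noteq> 0\<close> by (simp add: hankel_kernel_def powr_def)
    qed auto
    moreover have "hankel_integral \<psi> 1 (hankel_kernel (e k + b)) = 2 * of_real pi * \<i> * of_real (rGamma (e k + b))" for k
      using hankel_integral_rGamma_nonint[OF psi e, of k "nat \<lfloor>b\<rfloor>"] by (simp only: bn)
    moreover have "(\<lambda>k. 2 * of_real pi * \<i> * of_real (rGamma (e k + b)) :: complex) \<longlonglongrightarrow> 2 * of_real pi * \<i> * of_real (rGamma (0 + b))"
      by (intro tendsto_intros e0 isCont_tendsto_compose[of _ rGamma] DERIV_isCont[OF has_field_derivative_rGamma])
    ultimately show ?thesis by (simp add: LIMSEQ_unique)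
  qed
  ultimately show ?thesis by simp
qed

section \<open>Mittag-Leffler functions in the stable sector\<close>

text \<open>The rate c is kept apart from \<open>sin \<psi>\<close>, because the decay estimate
  spends half of that rate on absorbing a growing factor.\<close>

lemma norm_hankel_integral_le:
  assumes psi: "0 < \<psi>" "\<psi> < pi/2" and cont: "continuous_on (sect \<psi>) F" and p: "0 < p" and c: "0 < c"
    and F: "\<And>D r. sect_ray \<psi> D \<Longrightarrow> 0 \<le> r \<Longrightarrow> norm (F (of_real p + of_real r * D)) \<le> B * exp (- c * r)"
  shows "norm (hankel_integral \<psi> p F) \<le> 2 * B / c"
proof -
  have "norm (ray_integral D p F) \<le> B / c" if "sect_ray \<psi> D" for D
  proof -
    interpret sect_ray \<psi> D by (rule that)
    have b: "norm (F (of_real p + of_real r * D) * D) \<le> B * exp (- c * r)" if "0 \<le> r" for r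
      using F[OF sect_ray_axioms that] by (simp add: norm_mult norm_D)
    have "(\<lambda>r. F (of_real p + of_real r * D) * D) integrable_on {0..}"
      by (rule set_lebesgue_integral_eq_integral,
          rule absolutely_integrable_exp_bounded[OF continuous_on_ray[OF cont p] c b])
    moreover have hi: "((\<lambda>r. B * exp (- c * r)) has_integral B * (exp (- c * 0) / c)) {0..}"
      by (intro has_integral_mult_right) (use has_integral_exp_minus_to_infinity[OF c, of 0] in simp)
    ultimately have "norm (ray_integral D p F) \<le> integral {0..} (\<lambda>r. B * exp (- c * r))"
      unfolding ray_integral_def by (intro integral_norm_bound_integral) (use b in auto)
    then show ?thesis using integral_unique[OF hi] by simp
  qed
  from this[OF sect_rayI(1)[OF psi]] this[OF sect_rayI(2)[OF psi]] show ?thesis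
    using norm_triangle_ineq4[of "ray_integral (Complex (- sin \<psi>) (cos \<psi>)) p F" "ray_integral (Complex (- sin \<psi>) (- cos \<psi>)) p F"]
    unfolding hankel_integral_def by (simp flip: times_divide_eq_right)
qed

definition ml_kernel :: "real \<Rightarrow> real \<Rightarrow> complex \<Rightarrow> complex \<Rightarrow> complex" where
  "ml_kernel a b z s = exp s * s powr of_real (a - b) / (s powr of_real a - z)"

lemma hankel_kernel_geometric:
  assumes "s \<noteq> 0"
  shows "z ^ k * hankel_kernel (real k * a + b) s = hankel_kernel b s * (z / s powr of_real a) ^ k"
proof -
  have "s powr of_real (- (real k * a + b)) = s powr of_real (- b) / (s powr of_real a) ^ k"
  proof -
    have "s powr of_real (- (real k * a + b)) = exp (- of_real b * Ln s - of_nat k * (of_real a * Ln s))"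
      using assms by (simp add: powr_def algebra_simps)
    also have "\<dots> = exp (- of_real b * Ln s) / exp (of_real a * Ln s) ^ k"
      by (simp add: exp_diff exp_of_nat_mult)
    finally show ?thesis using assms by (simp add: powr_def)
  qed
  then show ?thesis by (simp add: hankel_kernel_def power_divide)
qed

text \<open>The size condition on p makes |z/s^a| at most 1/2 along both rays, so all partial sums
  of the geometric series are dominated by twice the Hankel kernel, and summation commutes with the
  integral. Convergence of the power series is part of the conclusion and not an assumption.\<close>

lemma mittag_leffler_sums_hankel:
  assumes psi: "0 < \<psi>" "\<psi> < pi/2" and a: "0 < a" and b: "0 < b" and p: "1 \<le> p"
    and m: "1 \<le> p * cos \<psi>" "2 * norm z \<le> (p * cos \<psi>) powr a"
  shows "(\<lambda>k. z ^ k / complex_of_real (Gamma (real k * a + b))) sums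
     (hankel_integral \<psi> p (ml_kernel a b z) / (2 * of_real pi * \<i>))"
proof -
  define m where "m = p * cos \<psi>"
  have m1: "1 \<le> m" and m2: "2 * norm z \<le> m powr a" using m by (auto simp: m_def)
  have p0: "0 < p" using p by simp
  have s0: "s \<noteq> 0" if "s \<in> sect \<psi>" for s using sect_subset_slit[OF psi that] by auto
  let ?S = "\<lambda>n s. \<Sum>k<n. z ^ k * hankel_kernel (real k * a + b) s"
  have cont: "continuous_on (sect \<psi>) (?S n)" for n
    by (intro continuous_intros continuous_hankel_kernel psi)
  have q: "norm (z / s powr of_real a) \<le> 1 / 2" if "m \<le> norm s" for s
  proof -
    have "m powr a \<le> norm s powr a" using that m1 a by (intro powr_mono2) auto
    then have "2 * norm z \<le> norm s powr a" using m2 by linarith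
    moreover have "norm (s powr of_real a) = norm s powr a" using norm_powr_real_powr'[of "of_real a" s] by simp
    moreover have "0 < norm s powr a" using that m1 by auto
    ultimately show ?thesis by (simp add: norm_divide field_simps)
  qed
  have Sb: "norm (?S n s) \<le> (2 * m powr (- b)) * exp (Re s)" if "s \<in> sect \<psi>" "m \<le> norm s" for n s
  proof -
    have "norm (?S n s) = norm (hankel_kernel b s) * norm (\<Sum>k<n. (z / s powr of_real a) ^ k)"
      using hankel_kernel_geometric[OF s0[OF that(1)]] by (simp add: norm_mult flip: sum_distrib_left)
    also have "norm (\<Sum>k<n. (z / s powr of_real a) ^ k) \<le> (\<Sum>k<n. (1/2) ^ k)"
      by (rule sum_norm_le) (auto simp: norm_power intro!: power_mono q that simp del: norm_divide)
    also have "\<dots> \<le> (2::real)" by (simp add: sum_gp_strict)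
    finally have "norm (?S n s) \<le> norm (hankel_kernel b s) * 2" by (simp add: mult_left_mono)
    also have "norm (hankel_kernel b s) \<le> m powr (- b) * exp (Re s)"
      using m1 that b by (intro hankel_kernel_bound) auto
    finally show ?thesis by simp
  qed
  have lim: "(\<lambda>n. ?S n s) \<longlonglongrightarrow> ml_kernel a b z s" if "s \<in> sect \<psi>" "m \<le> norm s" for s
  proof -
    have sa: "s powr of_real a \<noteq> 0" using s0[OF that(1)] by simp
    have nq: "norm (z / s powr of_real a) < 1" using q[OF that(2)] by linarith
    have "(\<lambda>k. hankel_kernel b s * (z / s powr of_real a) ^ k) sums (hankel_kernel b s * (1 / (1 - z / s powr of_real a)))"
      by (rule sums_mult[OF geometric_sums[OF nq]])
    moreover have "hankel_kernel b s * (1 / (1 - z / s powr of_real a)) = ml_kernel a b z s"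
    proof -
      have "s powr of_real a \<noteq> z" using nq sa by auto
      moreover have "s powr of_real (a - b) = s powr of_real (- b) * s powr of_real a"
        using s0[OF that(1)] by (simp add: powr_diff powr_minus field_simps)
      ultimately show ?thesis unfolding hankel_kernel_def ml_kernel_def using sa by (simp add: field_simps)
    qed
    ultimately show ?thesis
      unfolding sums_def by (simp add: hankel_kernel_geometric[OF s0[OF that(1)]])
  qed
  have H: "hankel_integral \<psi> p (?S n) = (\<Sum>k<n. z ^ k * (2 * of_real pi * \<i> * of_real (rGamma (real k * a + b))))" for n
  proof (induction n)
    case 0
    show ?case by (simp add: hankel_integral_def ray_integral_def)
  next
    case (Suc n)
    have "hankel_integral \<psi> p (\<lambda>s. ?S (Suc n) s - ?S n s) = hankel_integral \<psi> p (?S (Suc n)) - hankel_integral \<psi> p (?S n)"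
      by (rule hankel_integral_diff[OF psi cont Sb cont Sb p0]) (auto simp: m_def)
    moreover have "(\<lambda>s. ?S (Suc n) s - ?S n s) = (\<lambda>s. z ^ n * hankel_kernel (real n * a + b) s)" by simp
    moreover have "hankel_integral \<psi> p (hankel_kernel (real n * a + b)) = 2 * of_real pi * \<i> * of_real (rGamma (real n * a + b))"
      by (rule hankel_integral_rGamma[OF psi _ p]) (use a b in \<open>simp add: add_nonneg_pos\<close>)
    ultimately show ?case using Suc by (simp add: hankel_integral_cmult)
  qed
  have "(\<lambda>n. hankel_integral \<psi> p (?S n)) \<longlonglongrightarrow> hankel_integral \<psi> p (ml_kernel a b z)"
    by (rule hankel_integral_dominated[OF psi cont Sb lim p0]) (auto simp: m_def)
  then have "(\<lambda>k. z ^ k * (2 * of_real pi * \<i> * of_real (rGamma (real k * a + b)))) sums hankel_integral \<psi> p (ml_kernel a b z)"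
    unfolding H sums_def .
  then have "(\<lambda>k. z ^ k * (2 * of_real pi * \<i> * of_real (rGamma (real k * a + b))) / (2 * of_real pi * \<i>)) sums
      (hankel_integral \<psi> p (ml_kernel a b z) / (2 * of_real pi * \<i>))"
    by (rule sums_divide)
  moreover have e: "u * (c * v) / c = u * v" if "c \<noteq> 0" for u v c :: complex using that by simp
  have "z ^ k * (2 * of_real pi * \<i> * of_real (rGamma (real k * a + b))) / (2 * of_real pi * \<i>)
      = z ^ k / complex_of_real (Gamma (real k * a + b))" for k
    by (subst e) (simp_all add: rGamma_inverse_Gamma divide_inverse)
  ultimately show ?thesis by (simp only:)
qed

lemma mittag_leffler_vertex_exists:
  assumes psi: "0 < \<psi>" "\<psi> < pi/2" and a: "0 < a"
  obtains p where "1 \<le> p" "1 \<le> p * cos \<psi>" "2 * norm (z::complex) \<le> (p * cos \<psi>) powr a"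
proof -
  have c: "0 < cos \<psi>" "cos \<psi> \<le> 1" using psi by (auto intro!: cos_gt_zero_pi)
  define R where "R = max 1 ((2 * norm z) powr (1 / a))"
  have R: "1 \<le> R" by (simp add: R_def)
  have "((2 * norm z) powr (1 / a)) powr a \<le> R powr a"
    using a by (intro powr_mono2) (auto simp: R_def)
  then have "2 * norm z \<le> R powr a" using a by (simp add: powr_powr)
  moreover have "R / cos \<psi> \<ge> 1" using R c order_trans[of "cos \<psi>" 1 R] by (simp add: field_simps)
  ultimately show ?thesis using that[of "R / cos \<psi>"] R c by simp
qed

text \<open>Convergence is a by-product of the integral representation and takes no growth estimate
  for \<Gamma>. The angle \<pi>/4 is an arbitrary admissible choice.\<close>

lemma mittag_leffler_summable:
  assumes "0 < a" "0 < b"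
  shows "summable (\<lambda>k. z ^ k / complex_of_real (Gamma (real k * a + b)))"
proof -
  have psi: "0 < pi/4" "pi/4 < pi/2" by auto
  obtain p where "1 \<le> p" "1 \<le> p * cos (pi/4)" "2 * norm z \<le> (p * cos (pi/4)) powr a"
    using mittag_leffler_vertex_exists[OF psi assms(1)] by blast
  from mittag_leffler_sums_hankel[OF psi assms this] show ?thesis by (rule sums_summable)
qed

lemma isCont_mittag_leffler:
  assumes "0 < a" "0 < b" shows "isCont (mittag_leffler a b) z"
proof -
  have "isCont (\<lambda>z. \<Sum>k. (1 / complex_of_real (Gamma (real k * a + b))) * z ^ k) z"
    by (rule isCont_powser_converges_everywhere) (use mittag_leffler_summable[OF assms] in simp)
  then show ?thesis unfolding mittag_leffler_def[abs_def] by simp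
qed

text \<open>The lower bound k excludes poles in the whole sector, so
  \<open>hankel_integral_shift\<close> applies between 1 and the large vertex that the series
  requires. The assumption \<open>a \<le> b\<close> makes the exponent a - b nonpositive, so the
  power of s stays bounded outside a disc about 0.\<close>

lemma mittag_leffler_hankel:
  assumes psi: "0 < \<psi>" "\<psi> < pi/2" and a: "0 < a" "a \<le> b" and k: "0 < k"
    and sep: "\<And>s. s \<in> sect \<psi> \<Longrightarrow> k \<le> norm (s powr of_real a - z)"
  shows "mittag_leffler a b z = hankel_integral \<psi> 1 (ml_kernel a b z) / (2 * of_real pi * \<i>)"
proof -
  have b: "0 < b" using a by simp
  have c: "0 < cos \<psi>" using psi by (auto intro!: cos_gt_zero_pi)
  obtain p where p: "1 \<le> p" "1 \<le> p * cos \<psi>" "2 * norm z \<le> (p * cos \<psi>) powr a"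
    using mittag_leffler_vertex_exists[OF psi a(1)] by blast
  have "hankel_integral \<psi> 1 (ml_kernel a b z) = hankel_integral \<psi> p (ml_kernel a b z)"
  proof (rule hankel_integral_shift[OF psi, where m = "cos \<psi>"])
    have "s powr of_real a - z \<noteq> 0" if "s \<in> sect \<psi>" for s using sep[OF that] k by auto
    then show "ml_kernel a b z holomorphic_on sect \<psi>"
      unfolding ml_kernel_def using sect_subset_slit[OF psi] by (intro holomorphic_intros) auto
    show "norm (ml_kernel a b z s) \<le> (cos \<psi> powr (a - b) / k) * exp (Re s)"
      if "s \<in> sect \<psi>" "cos \<psi> \<le> norm s" for s
    proof -
      have "norm (s powr of_real (a - b)) = norm s powr (a - b)"
        using norm_powr_real_powr'[of "of_real (a - b)" s] by (simp del: of_real_diff)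
      then have "norm (ml_kernel a b z s) = exp (Re s) * norm s powr (a - b) / norm (s powr of_real a - z)"
        by (simp add: ml_kernel_def norm_mult norm_divide del: of_real_diff)
      also have "\<dots> \<le> exp (Re s) * cos \<psi> powr (a - b) / k"
        using that a c k by (intro frac_le mult_left_mono powr_mono2' sep) auto
      finally show ?thesis by (simp add: mult_ac)
    qed
  qed (use p in auto)
  with mittag_leffler_sums_hankel[OF psi a(1) b p] show ?thesis
    unfolding mittag_leffler_def by (simp add: sums_iff)
qed


section \<open>Separating the powers of the sector from the ray through the eigenvalue\<close>

lemma Arg_sect:
  assumes psi: "0 < \<psi>" "\<psi> < pi/2" and s: "s \<in> sect \<psi>"
  shows "\<bar>Arg s\<bar> < pi/2 + \<psi>"
proof (rule ccontr)
  assume n: "\<not> ?thesis"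
  have s0: "s \<noteq> 0" using sect_subset_slit[OF psi s] by auto
  have "Re s = norm s * cos \<bar>Arg s\<bar>" "\<bar>Im s\<bar> = norm s * sin \<bar>Arg s\<bar>"
  proof -
    have s': "s = of_real (norm s) * cis (Arg s)" using rcis_cmod_Arg[of s] by (simp add: rcis_def)
    show "Re s = norm s * cos \<bar>Arg s\<bar>" using arg_cong[OF s', of Re] by (simp add: cos_abs_real)
    have "\<bar>sin (Arg s)\<bar> = sin \<bar>Arg s\<bar>"
    proof (cases "0 \<le> Arg s")
      case True
      then show ?thesis using sin_ge_zero[of "Arg s"] Arg_le_pi[of s] by simp
    next
      case False
      then show ?thesis using sin_ge_zero[of "- Arg s"] mpi_less_Arg[of s] by simp
    qed
    then show "\<bar>Im s\<bar> = norm s * sin \<bar>Arg s\<bar>" using arg_cong[OF s', of "\<lambda>s. \<bar>Im s\<bar>"] by (simp add: abs_mult)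
  qed
  \<comment> \<open>In polar form the expression that defines the sector is |s| cos(|Arg s| -
    \<psi>), which turns membership into a condition on the argument alone.\<close>
  then have "0 < norm s * cos (\<bar>Arg s\<bar> - \<psi>)" using s by (simp add: sect_def cos_diff algebra_simps)
  then have "0 < cos (\<bar>Arg s\<bar> - \<psi>)" using s0 by (simp add: zero_less_mult_iff)
  moreover have "cos (\<bar>Arg s\<bar> - \<psi>) \<le> cos (pi/2)"
  proof (rule cos_monotone_0_pi_le)
    show "pi / 2 \<le> \<bar>Arg s\<bar> - \<psi>" using n by linarith
    show "\<bar>Arg s\<bar> - \<psi> \<le> pi" using Arg_le_pi[of s] mpi_less_Arg[of s] psi by linarith
  qed simp
  ultimately show False by simp
qed

text \<open>The power multiplies arguments by a. The resulting angular bound is phrased as a weak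
  inequality between real part and modulus, which describes a closed cone containing 0 and invariant
  under positive scaling; the separation argument uses both closedness and scaling.\<close>

lemma sect_powr_cone:
  assumes psi: "0 < \<psi>" "\<psi> < pi/2" and a: "0 < a" "a < 1" and s: "s \<in> sect \<psi>"
  shows "norm (s powr of_real a) * cos (a * (pi/2 + \<psi>)) \<le> Re (s powr of_real a)"
proof -
  have s0: "s \<noteq> 0" using sect_subset_slit[OF psi s] by auto
  have "s powr of_real a = exp (of_real (a * ln (norm s)) + \<i> * of_real (a * Arg s))"
  proof -
    have "Ln s = of_real (ln (norm s)) + \<i> * of_real (Arg s)"
      using s0 Ln_Arg by blast
    then show ?thesis using s0 by (simp add: powr_def algebra_simps)
  qed
  then have "Re (s powr of_real a) = norm (s powr of_real a) * cos (a * Arg s)"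
    by (simp only: Re_exp norm_exp_eq_Re) simp
  moreover have "cos (a * (pi/2 + \<psi>)) \<le> cos (\<bar>a * Arg s\<bar>)"
  proof (rule cos_monotone_0_pi_le)
    show "\<bar>a * Arg s\<bar> \<le> a * (pi/2 + \<psi>)" using Arg_sect[OF psi s] a by (simp add: abs_mult)
    have "a * (pi/2 + \<psi>) \<le> 1 * (pi/2 + \<psi>)" using a psi by (intro mult_right_mono) auto
    also have "\<dots> \<le> pi" using psi by simp
    finally show "a * (pi/2 + \<psi>) \<le> pi" .
  qed simp
  ultimately show ?thesis by (simp add: mult_left_mono cos_abs_real)
qed

text \<open>The point \<open>lam\<close> has a positive distance k to a closed cone that contains
  all s^a. Scaling by x preserves the cone and multiplies the distance, which gives the linear
  factor x.\<close>

lemma sect_powr_separation: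
  assumes a: "0 < a" "a < 1" and lam: "a * pi / 2 < \<bar>Arg lam\<bar>"
  obtains \<psi> k where "0 < \<psi>" "\<psi> < pi/2" "0 < k"
    "\<And>s x. s \<in> sect \<psi> \<Longrightarrow> 0 < x \<Longrightarrow> k * x \<le> norm (s powr of_real a - of_real x * lam)"
proof -
  define q where "q = \<bar>Arg lam\<bar> / a"
  \<comment> \<open>This puts \<pi>/2 + \<psi> midway between \<pi>/2 and the smaller of q and
    \<pi>: below q for the separation, and capped by \<pi> to keep \<psi> below \<pi>/2 when a is
    small.\<close>
  define \<psi> where "\<psi> = (min q pi - pi/2) / 2"
  have gt: "pi/2 < q" using lam a by (simp add: q_def field_simps)
  then have psi: "0 < \<psi>" "\<psi> < pi/2" and "pi/2 + \<psi> < q"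
    using pi_gt_zero unfolding \<psi>_def by (auto simp: min_def field_simps)
  then have lt: "a * (pi/2 + \<psi>) < \<bar>Arg lam\<bar>" using a by (simp add: q_def field_simps)
  define K where "K = {w::complex. norm w * cos (a * (pi/2 + \<psi>)) \<le> Re w}"
  have "closed K" unfolding K_def by (intro closed_Collect_le continuous_intros)
  moreover have "lam \<notin> K"
  proof -
    have "cos \<bar>Arg lam\<bar> < cos (a * (pi/2 + \<psi>))"
      using lt a psi Arg_le_pi[of lam] mpi_less_Arg[of lam] by (intro cos_monotone_0_pi) auto
    \<comment> \<open>\<open>Arg 0\<close> is 0 by convention, so a positive lower bound on |Arg
      lam| rules out the origin.\<close>
    moreover have "lam \<noteq> 0"
    proof
      assume "lam = 0"
      then have "\<bar>Arg lam\<bar> = 0" by (simp add: Arg_def)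
      moreover have "0 < a * (pi/2 + \<psi>)" using a psi by simp
      ultimately show False using lt by linarith
    qed
    moreover have "Re lam = norm lam * cos \<bar>Arg lam\<bar>"
      using arg_cong[OF rcis_cmod_Arg[of lam], of Re] by (simp add: cos_abs_real)
    ultimately show ?thesis by (simp add: K_def)
  qed
  ultimately obtain k where k: "0 < k" "\<And>w. w \<in> K \<Longrightarrow> k \<le> dist lam w"
    using separate_point_closed[of K lam] by blast
  show ?thesis
  proof (rule that[OF psi k(1)])
    fix s :: complex and x :: real assume s: "s \<in> sect \<psi>" and x: "0 < x"
    let ?w = "s powr of_real a"
    have "?w / of_real x \<in> K"
      using divide_right_mono[OF sect_powr_cone[OF psi a s], of x] x by (simp add: K_def norm_divide)
    then have "k * x \<le> dist lam (?w / of_real x) * x" using k(2) x by (intro mult_right_mono) auto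
    also have "\<dots> = norm ((?w / of_real x - lam) * of_real x)"
      using x by (simp add: dist_norm norm_minus_commute norm_mult)
    also have "(?w / of_real x - lam) * of_real x = ?w - of_real x * lam"
      using x by (simp add: left_diff_distrib)
    finally show "k * x \<le> norm (?w - of_real x * lam)" .
  qed
qed

lemma continuous_ml_kernel:
  assumes psi: "0 < \<psi>" "\<psi> < pi/2" and "\<And>s. s \<in> sect \<psi> \<Longrightarrow> s powr of_real a \<noteq> z"
  shows "continuous_on (sect \<psi>) (ml_kernel a b z)"
proof (rule holomorphic_on_imp_continuous_on)
  show "ml_kernel a b z holomorphic_on sect \<psi>"
    unfolding ml_kernel_def using sect_subset_slit[OF psi] assms(3) by (intro holomorphic_intros) auto
qed

section \<open>Boundedness and quadratic decay on the ray through the eigenvalue\<close>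

lemma mittag_leffler_bounded_near_0:
  assumes "0 < a" "0 < b"
  obtains M where "0 < M" "\<And>x. 0 \<le> x \<Longrightarrow> x \<le> 1 \<Longrightarrow> norm (mittag_leffler a b (of_real x * lam)) \<le> M"
proof -
  have "continuous_on {0..1} (\<lambda>x. mittag_leffler a b (of_real x * lam))"
    by (intro continuous_at_imp_continuous_on ballI isCont_o2[OF _ isCont_mittag_leffler[OF assms]])
       (auto intro!: continuous_intros)
  then have "bounded ((\<lambda>x. mittag_leffler a b (of_real x * lam)) ` {0..1})"
    by (intro compact_imp_bounded compact_continuous_image) auto
  then show ?thesis using that unfolding bounded_pos by auto
qed

text \<open>This makes the suprema in the second estimate genuine: a supremum of reals bounds its
  set only if the set is bounded above. For x > 1 the pole distance k x is weakened to k, which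
  suffices for a uniform bound.\<close>

theorem mittag_leffler_bounded:
  assumes a: "0 < a" "a < 1" and lam: "a * pi / 2 < \<bar>Arg lam\<bar>"
  obtains M where "\<And>x. 0 \<le> x \<Longrightarrow> norm (mittag_leffler a 1 (of_real x * lam)) \<le> M"
proof -
  obtain \<psi> k where psi: "0 < \<psi>" "\<psi> < pi/2" and k: "0 < k"
    and sep: "\<And>s x. s \<in> sect \<psi> \<Longrightarrow> 0 < x \<Longrightarrow> k * x \<le> norm (s powr of_real a - of_real x * lam)"
    using sect_powr_separation[OF assms] by blast
  obtain M where M: "\<And>x. 0 \<le> x \<Longrightarrow> x \<le> 1 \<Longrightarrow> norm (mittag_leffler a 1 (of_real x * lam)) \<le> M"
    using mittag_leffler_bounded_near_0[of a 1 lam] a(1) by auto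
  have one: "(0::real) < 1" by simp
  have c: "0 < cos \<psi>" and sn: "0 < sin \<psi>" using psi by (auto intro!: cos_gt_zero_pi sin_gt_zero)
  define B where "B = exp 1 * cos \<psi> powr (a - 1) / k"
  show ?thesis
  proof (rule that)
    fix x :: real assume x: "0 \<le> x"
    show "norm (mittag_leffler a 1 (of_real x * lam)) \<le> max M (2 * B / sin \<psi> / (2 * pi))"
    proof (cases "x \<le> 1")
      case True
      then show ?thesis using M[OF x] by (simp add: le_max_iff_disj)
    next
      case False
      then have x1: "1 < x" by simp
      have sep': "k \<le> norm (s powr of_real a - of_real x * lam)" if "s \<in> sect \<psi>" for s
      proof -
        have "k * 1 \<le> k * x" using x1 k by (intro mult_left_mono) auto
        then show ?thesis using sep[OF that, of x] x1 by simp
      qed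
      have ne: "s powr of_real a \<noteq> of_real x * lam" if "s \<in> sect \<psi>" for s using sep'[OF that] k by auto
      have cont: "continuous_on (sect \<psi>) (ml_kernel a 1 (of_real x * lam))" by (rule continuous_ml_kernel[OF psi ne])
      have "norm (hankel_integral \<psi> 1 (ml_kernel a 1 (of_real x * lam))) \<le> 2 * B / sin \<psi>"
      proof (rule norm_hankel_integral_le[OF psi cont one sn])
        fix D r assume "sect_ray \<psi> D" and r: "0 \<le> (r::real)"
        then interpret sect_ray \<psi> D by simp
        let ?s = "of_real 1 + of_real r * D"
        have s: "?s \<in> sect \<psi>" by (rule ray_in_sect) (use r in auto)
        have "norm (?s powr of_real (a - 1)) = norm ?s powr (a - 1)"
          using norm_powr_real_powr'[of "of_real (a - 1)" ?s] by (simp del: of_real_diff)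
        then have "norm (ml_kernel a 1 (of_real x * lam) ?s) = exp (Re ?s) * norm ?s powr (a - 1) / norm (?s powr of_real a - of_real x * lam)"
          unfolding ml_kernel_def norm_mult norm_divide norm_exp_eq_Re by (simp only:)
        also have "\<dots> \<le> exp (Re ?s) * cos \<psi> powr (a - 1) / k"
          using norm_ray_ge1[of 1 r] r a c k by (intro frac_le mult_left_mono powr_mono2' sep'[OF s]) auto
        also have "exp (Re ?s) = exp 1 * exp (- sin \<psi> * r)"
          unfolding Re_ray by (simp add: exp_diff exp_minus field_simps)
        finally show "norm (ml_kernel a 1 (of_real x * lam) ?s) \<le> B * exp (- sin \<psi> * r)"
          by (simp add: B_def mult_ac)
      qed
      moreover have "mittag_leffler a 1 (of_real x * lam) = hankel_integral \<psi> 1 (ml_kernel a 1 (of_real x * lam)) / (2 * of_real pi * \<i>)"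
        by (rule mittag_leffler_hankel[OF psi a(1) less_imp_le[OF a(2)] k]) (rule sep')
      ultimately have "norm (mittag_leffler a 1 (of_real x * lam)) \<le> 2 * B / sin \<psi> / (2 * pi)"
        by (simp only: norm_divide norm_mult) (simp add: divide_right_mono del: divide_divide_eq_left)
      then show ?thesis by simp
    qed
  qed
qed


text \<open>The exponent 2 gives uniformity in t: with x = u^a the weight u^(a-1)/(1+x)^2 decays
  like u^(-a-1), whereas a bound by 1/(1+x) would leave 1/u and a logarithm that grows with
  t.\<close>

theorem mittag_leffler_decay:
  assumes a: "0 < a" "a < 1" and lam: "a * pi / 2 < \<bar>Arg lam\<bar>"
  obtains M where "0 < M" "\<And>x. 0 \<le> x \<Longrightarrow> norm (mittag_leffler a a (of_real x * lam)) \<le> M / (1 + x)\<^sup>2"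
proof -
  obtain \<psi> k where psi: "0 < \<psi>" "\<psi> < pi/2" and k: "0 < k"
    and sep: "\<And>s x. s \<in> sect \<psi> \<Longrightarrow> 0 < x \<Longrightarrow> k * x \<le> norm (s powr of_real a - of_real x * lam)"
    using sect_powr_separation[OF assms] by blast
  obtain M where M: "0 < M" "\<And>x. 0 \<le> x \<Longrightarrow> x \<le> 1 \<Longrightarrow> norm (mittag_leffler a a (of_real x * lam)) \<le> M"
    using mittag_leffler_bounded_near_0[OF a(1) a(1), of lam] by blast
  have one: "(0::real) < 1" by simp
  have c: "0 < cos \<psi>" and sn: "0 < sin \<psi>" using psi by (auto intro!: cos_gt_zero_pi sin_gt_zero)
  have lam0: "lam \<noteq> 0"
  proof
    assume "lam = 0"
    then have "\<bar>Arg lam\<bar> = 0" by (simp add: Arg_def)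
    moreover have "0 < a * pi / 2" using a by simp
    ultimately show False using lam by linarith
  qed
  \<comment> \<open>After the subtraction the integrand carries |s|^a, which is at most 1 + r on the
    rays. Half of the exponential rate absorbs it through 1 + r \<le> (1 + 1/c2) exp(c2 r), and the
    other half remains for integration.\<close>
  define c2 where "c2 = sin \<psi> / 2"
  have c2: "0 < c2" using sn by (simp add: c2_def)
  define B where "B = exp 1 * (1 + 1 / c2) / (norm lam * k)"
  define N where "N = 2 * B / c2 / (2 * pi)"
  have large: "norm (mittag_leffler a a (of_real x * lam)) \<le> N / x\<^sup>2" if x: "1 \<le> x" for x
  proof -
    have x0: "0 < x" using x by simp
    define z where "z = of_real x * lam"
    have z0: "z \<noteq> 0" using lam0 x0 by (simp add: z_def)
    have nz: "norm z = x * norm lam" using x0 by (simp add: z_def norm_mult)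
    have sep': "k * x \<le> norm (s powr of_real a - z)" if "s \<in> sect \<psi>" for s
      using sep[OF that x0] by (simp add: z_def)
    have kx: "0 < k * x" using k x0 by simp
    have ne: "s powr of_real a \<noteq> z" if "s \<in> sect \<psi>" for s using sep'[OF that] kx by auto
    have contF: "continuous_on (sect \<psi>) (ml_kernel a a z)" by (rule continuous_ml_kernel[OF psi ne])
    \<comment> \<open>\<open>hankel_kernel 0\<close> is the exponential off 0, so this is the
      leading term -e^s/z, obtained when s^a is neglected against z.\<close>
    let ?G = "\<lambda>s. (- 1 / z) * hankel_kernel 0 s"
    have s0: "s \<noteq> 0" if "s \<in> sect \<psi>" for s using sect_subset_slit[OF psi that] by auto
    have contG: "continuous_on (sect \<psi>) ?G" by (intro continuous_intros continuous_hankel_kernel psi)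
    have "hankel_integral \<psi> 1 (\<lambda>s. ml_kernel a a z s - ?G s) = hankel_integral \<psi> 1 (ml_kernel a a z) - hankel_integral \<psi> 1 ?G"
    proof (rule hankel_integral_diff[OF psi contF _ contG, where m = "cos \<psi>"])
      show "norm (ml_kernel a a z s) \<le> (1 / (k * x)) * exp (Re s)" if "s \<in> sect \<psi>" for s
        using divide_left_mono[OF sep'[OF that], of "exp (Re s)"] kx s0[OF that] ne[OF that]
        by (simp add: ml_kernel_def norm_divide norm_mult)
      show "norm (?G s) \<le> (1 / norm z) * exp (Re s)" if "s \<in> sect \<psi>" for s
        using s0[OF that] by (simp add: hankel_kernel_def norm_divide norm_mult)
    qed auto
    moreover have "hankel_integral \<psi> 1 ?G = 0"
      unfolding hankel_integral_cmult using hankel_integral_recurrence[OF psi, of 0 1] by simp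
    moreover have "norm (hankel_integral \<psi> 1 (\<lambda>s. ml_kernel a a z s - ?G s)) \<le> 2 * (B / x\<^sup>2) / c2"
    proof (rule norm_hankel_integral_le[OF psi continuous_on_diff[OF contF contG] one c2])
      fix D r assume "sect_ray \<psi> D" and r: "0 \<le> (r::real)"
      then interpret sect_ray \<psi> D by simp
      let ?s = "of_real 1 + of_real r * D"
      have s: "?s \<in> sect \<psi>" by (rule ray_in_sect) (use r in auto)
      have "ml_kernel a a z ?s - ?G ?s = exp ?s * ?s powr of_real a / (z * (?s powr of_real a - z))"
        using s0[OF s] z0 ne[OF s] by (simp add: ml_kernel_def hankel_kernel_def field_simps)
      then have "norm (ml_kernel a a z ?s - ?G ?s) = exp (Re ?s) * norm ?s powr a / (norm z * norm (?s powr of_real a - z))"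
        using norm_powr_real_powr'[of "of_real a" ?s] by (simp add: norm_mult norm_divide)
      also have "\<dots> \<le> exp (Re ?s) * ((1 + 1 / c2) * exp (c2 * r)) / (norm z * (k * x))"
      proof (intro frac_le mult_left_mono sep'[OF s])
        have "norm ?s powr a \<le> (1 + r) powr a"
          using norm_ray_le[of 1 r] r a by (intro powr_mono2) auto
        also have "\<dots> \<le> (1 + r) powr 1" using r a by (intro powr_mono) auto
        also have "\<dots> = 1 + r" using r by simp
        also have "\<dots> \<le> exp (c2 * r) + (1 / c2) * exp (c2 * r)"
        proof (intro add_mono)
          show "1 \<le> exp (c2 * r)" using c2 r by simp
          have "c2 * r \<le> exp (c2 * r)" using exp_ge_add_one_self[of "c2 * r"] by linarith
          then show "r \<le> (1 / c2) * exp (c2 * r)" using c2 by (simp add: field_simps)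
        qed
        finally show "norm ?s powr a \<le> (1 + 1 / c2) * exp (c2 * r)" by (simp add: algebra_simps)
      qed (use z0 kx c2 in auto)
      also have "exp (Re ?s) = exp 1 * exp (- c2 * r) * exp (- c2 * r)"
        unfolding Re_ray by (simp add: c2_def flip: exp_add)
      also have "exp 1 * exp (- c2 * r) * exp (- c2 * r) * ((1 + 1 / c2) * exp (c2 * r)) / (norm z * (k * x))
         = B / x\<^sup>2 * exp (- c2 * r) * (exp (- c2 * r) * exp (c2 * r))"
        unfolding nz B_def by (simp add: power2_eq_square mult_ac)
      also have "exp (- c2 * r) * exp (c2 * r) = 1" by (simp flip: exp_add)
      finally show "norm (ml_kernel a a z ?s - ?G ?s) \<le> B / x\<^sup>2 * exp (- c2 * r)" by simp
    qed
    ultimately have "norm (hankel_integral \<psi> 1 (ml_kernel a a z)) \<le> 2 * (B / x\<^sup>2) / c2" by simp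
    moreover have "mittag_leffler a a z = hankel_integral \<psi> 1 (ml_kernel a a z) / (2 * of_real pi * \<i>)"
      by (rule mittag_leffler_hankel[OF psi a(1) order_refl kx]) (rule sep')
    ultimately have "norm (mittag_leffler a a z) \<le> 2 * (B / x\<^sup>2) / c2 / (2 * pi)"
      by (simp only: norm_divide norm_mult) (simp add: divide_right_mono del: divide_divide_eq_left)
    then show ?thesis by (simp add: z_def N_def mult_ac)
  qed
  show ?thesis
  proof (rule that)
    \<comment> \<open>The factor 4 passes from the two regimes to one formula: (1 + x)^2 is at most
      4 for x \<le> 1 and at most 4x^2 for x \<ge> 1.\<close>
    show "0 < 4 * max M N" using M(1) by (simp add: less_max_iff_disj)
    fix x :: real assume x: "0 \<le> x"
    show "norm (mittag_leffler a a (of_real x * lam)) \<le> 4 * max M N / (1 + x)\<^sup>2"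
    proof (cases "x \<le> 1")
      case True
      have "(1 + x)\<^sup>2 \<le> 2\<^sup>2" using x True by (intro power_mono) auto
      then have "M * (1 + x)\<^sup>2 \<le> max M N * 4" using M(1) by (intro mult_mono) auto
      then have "M \<le> 4 * max M N / (1 + x)\<^sup>2" using x by (simp add: field_simps)
      then show ?thesis using M(2)[OF x True] by linarith
    next
      case False
      then have x1: "1 \<le> x" by simp
      have "(1 + x)\<^sup>2 \<le> (2 * x)\<^sup>2" using x1 by (intro power_mono) auto
      then have q: "(1 + x)\<^sup>2 \<le> 4 * x\<^sup>2" by (simp add: power_mult_distrib)
      have "N / x\<^sup>2 \<le> max M N / x\<^sup>2" by (intro divide_right_mono) auto
      also have "\<dots> = 4 * max M N / (4 * x\<^sup>2)" by simp
      also have "\<dots> \<le> 4 * max M N / (1 + x)\<^sup>2"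
        using q x1 M(1) by (intro divide_left_mono mult_pos_pos) (auto simp: le_max_iff_disj)
      finally show ?thesis using large[OF x1] by linarith
    qed
  qed
qed

section \<open>Vectors, Jordan blocks and Lipschitz bounds\<close>

lemma vnorm_L2_set: "vnorm v = L2_set (\<lambda>i. norm (v $ i)) {..<dim_vec v}"
  by (simp add: vnorm_def L2_set_def)

lemma vnorm_nonneg [simp]: "0 \<le> vnorm v"
  by (simp add: vnorm_L2_set)

lemma vnorm_triangle:
  assumes "dim_vec v = dim_vec w" shows "vnorm (v + w) \<le> vnorm v + vnorm w"
proof -
  have "vnorm (v + w) \<le> L2_set (\<lambda>i. norm (v $ i) + norm (w $ i)) {..<dim_vec w}"
    unfolding vnorm_L2_set by (auto intro!: L2_set_mono norm_triangle_ineq)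
  also have "\<dots> \<le> vnorm v + vnorm w"
    unfolding vnorm_L2_set assms by (rule L2_set_triangle_ineq)
  finally show ?thesis .
qed

lemma vnorm_minus_commute:
  assumes "dim_vec v = dim_vec w" shows "vnorm (v - w) = vnorm (w - v)"
  using assms by (simp add: vnorm_def norm_minus_commute)

lemma vnorm_diff_triangle:
  assumes "dim_vec u = dim_vec v" "dim_vec v = dim_vec w"
  shows "vnorm (u - w) \<le> vnorm (u - v) + vnorm (v - w)"
proof -
  have "u - w = (u - v) + (v - w)" using assms by auto
  then show ?thesis using vnorm_triangle[of "u - v" "v - w"] assms by simp
qed

lemma norm_index_le_vnorm: "i < dim_vec v \<Longrightarrow> norm (v $ i) \<le> vnorm v"
  unfolding vnorm_L2_set by (rule member_le_L2_set) auto

lemma vnorm_le_sum: "vnorm v \<le> (\<Sum>i<dim_vec v. norm (v $ i))"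
  unfolding vnorm_L2_set by (rule L2_set_le_sum) auto

lemma vnorm_zero [simp]: "vnorm (0\<^sub>v n) = 0"
  by (simp add: vnorm_def)

lemma vnorm_diff_eq_0:
  fixes y z :: "'a::real_normed_vector Matrix.vec"
  assumes "vnorm (y - z) = 0" "dim_vec y = dim_vec z" shows "y = z"
  using norm_index_le_vnorm[of _ "y - z"] assms by (intro eq_vecI) auto

text \<open>A crude entrywise constant is enough: it serves only to show that Lipschitz quotients
  are bounded and never enters the final constant.\<close>

lemma vnorm_mult_mat_vec_le:
  fixes M :: "complex mat"
  obtains K where "0 \<le> K" "\<And>y. y \<in> carrier_vec (dim_col M) \<Longrightarrow> vnorm (M *\<^sub>v y) \<le> K * vnorm y"
proof
  let ?K = "\<Sum>i<dim_row M. \<Sum>j<dim_col M. norm (M $$ (i,j))"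
  show "0 \<le> ?K" by (intro sum_nonneg) auto
  fix y :: "complex Matrix.vec" assume y: "y \<in> carrier_vec (dim_col M)"
  have "vnorm (M *\<^sub>v y) \<le> (\<Sum>i<dim_row M. norm ((M *\<^sub>v y) $ i))"
    using vnorm_le_sum[of "M *\<^sub>v y"] by simp
  also have "\<dots> \<le> (\<Sum>i<dim_row M. (\<Sum>j<dim_col M. norm (M $$ (i,j))) * vnorm y)"
  proof (rule sum_mono)
    fix i assume i: "i \<in> {..<dim_row M}"
    have "norm ((M *\<^sub>v y) $ i) = norm (\<Sum>j<dim_col M. M $$ (i,j) * y $ j)"
      using i y by (simp add: scalar_prod_def lessThan_atLeast0)
    also have "\<dots> \<le> (\<Sum>j<dim_col M. norm (M $$ (i,j)) * vnorm y)"
      by (rule sum_norm_le) (use y norm_index_le_vnorm[of _ y] in \<open>auto simp: norm_mult intro!: mult_left_mono\<close>)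
    finally show "norm ((M *\<^sub>v y) $ i) \<le> (\<Sum>j<dim_col M. norm (M $$ (i,j))) * vnorm y"
      by (simp add: sum_distrib_right)
  qed
  finally show "vnorm (M *\<^sub>v y) \<le> ?K * vnorm y" by (simp add: sum_distrib_right)
qed

section \<open>From local Lipschitz continuity to Lipschitz bounds on balls\<close>

lemma carrier_vec_bounded_subsequence:
  fixes Y :: "nat \<Rightarrow> real Matrix.vec"
  assumes Y: "\<And>n. Y n \<in> carrier_vec d" "\<And>n. vnorm (Y n) \<le> R"
  obtains l r where "l \<in> carrier_vec d" "strict_mono (r :: nat \<Rightarrow> nat)" "(\<lambda>n. vnorm (Y (r n) - l)) \<longlonglongrightarrow> 0"
proof -
  have "\<forall>D\<subseteq>{..<d}. \<exists>l::nat \<Rightarrow> real. \<exists>r::nat \<Rightarrow> nat. strict_mono r \<and>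
     (\<forall>e>0. eventually (\<lambda>n. \<forall>i\<in>D. dist ((\<lambda>x k. x k) ((\<lambda>n i. Y n $ i) (r n)) i) ((\<lambda>x k. x k) l i) < e) sequentially)"
  \<comment> \<open>The dimension is not part of the type of vectors, so the coordinatewise
    Bolzano-Weierstrass argument is run on coordinate functions, with identities as the projection
    maps.\<close>
  proof (rule compact_lemma_general[where unproj = "\<lambda>x. x" and proj = "\<lambda>x k. x k" and f = "\<lambda>n i. Y n $ i"])
    show "bounded ((\<lambda>x. x k) ` range (\<lambda>n i. Y n $ i))" if "k \<in> {..<d}" for k
    proof (rule boundedI)
      fix x assume "x \<in> (\<lambda>x. x k) ` range (\<lambda>n i. Y n $ i)"
      then obtain n where "x = Y n $ k" by auto
      then show "norm x \<le> R" using norm_index_le_vnorm[of k "Y n"] Y[of n] that by auto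
    qed
  qed auto
  from this[rule_format, OF order_refl] obtain l :: "nat \<Rightarrow> real" and r :: "nat \<Rightarrow> nat" where r: "strict_mono r"
    and lim: "\<And>e. e > 0 \<Longrightarrow> eventually (\<lambda>n. \<forall>i\<in>{..<d}. dist (Y (r n) $ i) (l i) < e) sequentially" by blast
  show ?thesis
  proof (rule that[of "Matrix.vec d l" r])
    have "(\<lambda>n. \<Sum>i<d. norm (Y (r n) $ i - l i)) \<longlonglongrightarrow> (\<Sum>i<d. 0)"
    proof (rule tendsto_sum)
      fix i assume i: "i \<in> {..<d}"
      have "(\<lambda>n. Y (r n) $ i) \<longlonglongrightarrow> l i"
        unfolding tendsto_iff
      proof (intro allI impI)
        fix e :: real assume "0 < e"
        from lim[OF this] show "eventually (\<lambda>n. dist (Y (r n) $ i) (l i) < e) sequentially"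
          by eventually_elim (use i in auto)
      qed
      then show "(\<lambda>n. norm (Y (r n) $ i - l i)) \<longlonglongrightarrow> 0"
        by (intro tendsto_norm_zero LIM_zero)
    qed
    then have "(\<lambda>n. \<Sum>i<d. norm (Y (r n) $ i - l i)) \<longlonglongrightarrow> 0" by simp
    then show "(\<lambda>n. vnorm (Y (r n) - Matrix.vec d l)) \<longlonglongrightarrow> 0"
    proof (rule Lim_null_comparison[rotated])
      have "vnorm (Y (r n) - Matrix.vec d l) \<le> (\<Sum>i<d. norm (Y (r n) $ i - l i))" for n
        using vnorm_le_sum[of "Y (r n) - Matrix.vec d l"] Y(1)[of "r n"] by simp
      then show "\<forall>\<^sub>F n in sequentially. norm (vnorm (Y (r n) - Matrix.vec d l)) \<le> (\<Sum>i<d. norm (Y (r n) $ i - l i))"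
        by simp
    qed
  qed (use r in auto)
qed

text \<open>If no constant works, there are pairs that violate the constant n for each n, and along
  a subsequence both members converge. A common limit contradicts the local constant there. Distinct
  limits keep the denominators away from 0 while the values of f stay bounded.\<close>

lemma loc_lipschitz_on_ball:
  assumes f: "\<And>x. x \<in> carrier_vec d \<Longrightarrow> f x \<in> carrier_vec d" and lip: "loc_lipschitz d f"
  obtains L where "0 \<le> L" "\<And>y z. y \<in> carrier_vec d \<Longrightarrow> z \<in> carrier_vec d \<Longrightarrow> vnorm y \<le> R \<Longrightarrow> vnorm z \<le> R
     \<Longrightarrow> vnorm (f y - f z) \<le> L * vnorm (y - z)"
proof (rule ccontr)
  assume neg: "\<not> thesis"
  have "\<exists>y z. y \<in> carrier_vec d \<and> z \<in> carrier_vec d \<and> vnorm y \<le> R \<and> vnorm z \<le> R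
     \<and> real n * vnorm (y - z) < vnorm (f y - f z)" for n
    using neg that[of "real n"] by (meson not_less of_nat_0_le_iff)
  then obtain Y Z where YZ: "\<And>n. Y n \<in> carrier_vec d" "\<And>n. Z n \<in> carrier_vec d"
     "\<And>n. vnorm (Y n) \<le> R" "\<And>n. vnorm (Z n) \<le> R"
     "\<And>n. real n * vnorm (Y n - Z n) < vnorm (f (Y n) - f (Z n))" by metis
  obtain y r1 where y: "y \<in> carrier_vec d" "strict_mono r1" "(\<lambda>n. vnorm (Y (r1 n) - y)) \<longlonglongrightarrow> 0"
    using carrier_vec_bounded_subsequence[of Y d R] YZ by blast
  obtain z r2 where z: "z \<in> carrier_vec d" "strict_mono r2" "(\<lambda>n. vnorm (Z (r1 (r2 n)) - z)) \<longlonglongrightarrow> 0"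
    using carrier_vec_bounded_subsequence[of "\<lambda>n. Z (r1 n)" d R] YZ by blast
  define r where "r = r1 \<circ> r2"
  have r: "strict_mono r" using y z by (simp add: r_def strict_mono_o)
  have Yl: "(\<lambda>n. vnorm (Y (r n) - y)) \<longlonglongrightarrow> 0"
    using LIMSEQ_subseq_LIMSEQ[OF y(3) z(2)] by (simp add: r_def o_def)
  have Zl: "(\<lambda>n. vnorm (Z (r n) - z)) \<longlonglongrightarrow> 0" using z(3) by (simp add: r_def)
  have dim: "dim_vec (Y n) = d" "dim_vec (Z n) = d" "dim_vec y = d" "dim_vec z = d"
     "dim_vec (f (Y n)) = d" "dim_vec (f (Z n)) = d" "dim_vec (f y) = d" "dim_vec (f z) = d" for n
    using YZ[of n] y z f carrier_vecD by metis+
  obtain e1 L1 where e1: "0 < e1" and L1: "\<And>u v. u \<in> carrier_vec d \<Longrightarrow> v \<in> carrier_vec d \<Longrightarrow>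
      vnorm (u - y) < e1 \<Longrightarrow> vnorm (v - y) < e1 \<Longrightarrow> vnorm (f u - f v) \<le> L1 * vnorm (u - v)"
    using lip y(1) unfolding loc_lipschitz_def by blast
  obtain e2 L2 where e2: "0 < e2" and L2: "\<And>u v. u \<in> carrier_vec d \<Longrightarrow> v \<in> carrier_vec d \<Longrightarrow>
      vnorm (u - z) < e2 \<Longrightarrow> vnorm (v - z) < e2 \<Longrightarrow> vnorm (f u - f v) \<le> L2 * vnorm (u - v)"
    using lip z(1) unfolding loc_lipschitz_def by blast
  have ev: "\<forall>\<^sub>F n in sequentially. real n \<le> real (r n)"
    using seq_suble[OF r] by simp
  have [simp]: "vnorm (y - y) = 0" "vnorm (z - z) = 0" by (auto simp: vnorm_def)
  show False
  proof (cases "y = z")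
    case True
    have "\<forall>\<^sub>F n in sequentially. vnorm (Y (r n) - y) < e1" "\<forall>\<^sub>F n in sequentially. vnorm (Z (r n) - y) < e1"
      using order_tendstoD(2)[OF Yl e1] order_tendstoD(2)[OF Zl e1] True by auto
    then have "\<forall>\<^sub>F n in sequentially. False"
      using ev eventually_ge_at_top[of "nat \<lceil>L1\<rceil>"]
    proof eventually_elim
      case (elim n)
      have "L1 \<le> real (r n)" using elim by linarith
      then have "L1 * vnorm (Y (r n) - Z (r n)) \<le> real (r n) * vnorm (Y (r n) - Z (r n))"
        by (intro mult_right_mono) auto
      moreover have "vnorm (f (Y (r n)) - f (Z (r n))) \<le> L1 * vnorm (Y (r n) - Z (r n))"
        by (rule L1) (use YZ elim in auto)
      ultimately show False using YZ(5)[of "r n"] by linarith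
    qed
    then show False by simp
  next
    case False
    define \<eta> where "\<eta> = vnorm (y - z)"
    have eta: "0 < \<eta>" using False vnorm_diff_eq_0[of y z] dim by (force simp: \<eta>_def less_le)
    \<comment> \<open>Near y and z the values of f stay within |L1| e1 of \<open>f y\<close> and
      |L2| e2 of \<open>f z\<close>, so K bounds their mutual distance. The tolerance \<eta>/4 on
      each side keeps the arguments at least \<eta>/2 apart.\<close>
    define K where "K = \<bar>L1\<bar> * e1 + vnorm (f y - f z) + \<bar>L2\<bar> * e2"
    have "\<forall>\<^sub>F n in sequentially. vnorm (Y (r n) - y) < min e1 (\<eta>/4)" "\<forall>\<^sub>F n in sequentially. vnorm (Z (r n) - z) < min e2 (\<eta>/4)"
      using order_tendstoD(2)[OF Yl, of "min e1 (\<eta>/4)"] order_tendstoD(2)[OF Zl, of "min e2 (\<eta>/4)"] e1 e2 eta by auto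
    then have "\<forall>\<^sub>F n in sequentially. False"
      using ev eventually_ge_at_top[of "nat \<lceil>2 * K / \<eta>\<rceil>"]
    proof eventually_elim
      case (elim n)
      let ?y = "Y (r n)" and ?z = "Z (r n)"
      have "\<eta> \<le> vnorm (y - ?y) + (vnorm (?y - ?z) + vnorm (?z - z))"
        unfolding \<eta>_def
        using vnorm_diff_triangle[of y ?y z] vnorm_diff_triangle[of ?y ?z z] dim by auto
      moreover have "vnorm (y - ?y) = vnorm (?y - y)" using dim by (intro vnorm_minus_commute) auto
      ultimately have far: "\<eta> / 2 \<le> vnorm (?y - ?z)" using elim by (simp add: min_def split: if_splits)
      have "vnorm (f ?y - f y) \<le> L1 * vnorm (?y - y)"
        by (rule L1) (use YZ y elim e1 in auto)
      also have "\<dots> \<le> \<bar>L1\<bar> * e1" using elim by (intro mult_mono) auto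
      finally have 1: "vnorm (f ?y - f y) \<le> \<bar>L1\<bar> * e1" .
      have "vnorm (f z - f ?z) \<le> L2 * vnorm (z - ?z)"
        by (rule L2) (use YZ z elim e2 in auto)
      also have "vnorm (z - ?z) = vnorm (?z - z)" using dim by (intro vnorm_minus_commute) auto
      also have "L2 * \<dots> \<le> \<bar>L2\<bar> * e2" using elim by (intro mult_mono) auto
      finally have 2: "vnorm (f z - f ?z) \<le> \<bar>L2\<bar> * e2" .
      have "vnorm (f ?y - f ?z) \<le> K"
        using vnorm_diff_triangle[of "f ?y" "f y" "f ?z"] vnorm_diff_triangle[of "f y" "f z" "f ?z"] 1 2 dim
        by (auto simp: K_def)
      then have "real (r n) * vnorm (?y - ?z) < K" using YZ(5)[of "r n"] by linarith
      moreover have "2 * K / \<eta> \<le> real (r n)" using elim by linarith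
      then have "(2 * K / \<eta>) * (\<eta> / 2) \<le> real (r n) * vnorm (?y - ?z)"
        using far eta by (intro mult_mono) auto
      ultimately show False using eta by simp
    qed
    then show False by simp
  qed
qed


section \<open>Block-diagonal matrices, inverses and the spectrum of the Jordan form\<close>

lemma diag_mat_diag_block_mat:
  assumes "\<And>A. A \<in> set As \<Longrightarrow> square_mat A"
  shows "diag_mat (diag_block_mat As) = concat (map diag_mat As)"
  using assms
proof (induction As)
  case Nil
  then show ?case by (simp add: diag_mat_def)
next
  case (Cons A As)
  have "square_mat (diag_block_mat As)" using Cons.prems by (intro diag_block_mat_square) auto
  then have "diag_block_mat As \<in> carrier_mat (dim_row (diag_block_mat As)) (dim_row (diag_block_mat As))"
    by auto
  moreover have "A \<in> carrier_mat (dim_row A) (dim_row A)" using Cons.prems[of A] by auto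
  ultimately have "diag_mat (diag_block_mat (A # As)) = diag_mat A @ diag_mat (diag_block_mat As)"
    unfolding diag_block_mat.simps Let_def by (intro diag_four_block_mat)
  also have "diag_mat (diag_block_mat As) = concat (map diag_mat As)"
    by (rule Cons.IH, rule Cons.prems) simp
  finally show ?case by simp
qed

lemma upper_triangular_diag_block_mat:
  assumes "\<And>A. A \<in> set As \<Longrightarrow> square_mat A" "\<And>A. A \<in> set As \<Longrightarrow> upper_triangular A"
  shows "upper_triangular (diag_block_mat As)"
  unfolding upper_triangular_def
  by (intro allI impI, rule diag_block_upper_triangular) (use assms in \<open>auto simp: upper_triangular_def\<close>)

text \<open>The choice behind \<open>minv\<close> does not fix a shape; the shape is read off by
  comparing dimensions in the two product identities.\<close>

lemma minv_inverse:
  assumes "M \<in> carrier_mat n n" "invertible_mat M"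
  shows "minv M \<in> carrier_mat n n" "M * minv M = 1\<^sub>m n" "minv M * M = 1\<^sub>m n"
proof -
  have "inverts_mat M (minv M) \<and> inverts_mat (minv M) M"
    unfolding minv_def by (rule someI_ex) (use assms in \<open>auto simp: invertible_mat_def\<close>)
  then have 1: "M * minv M = 1\<^sub>m n" and 2: "minv M * M = 1\<^sub>m (dim_row (minv M))"
    using assms by (auto simp: inverts_mat_def)
  have "dim_col (minv M) = n" using arg_cong[OF 1, of dim_col] by simp
  moreover have "dim_row (minv M) = n" using arg_cong[OF 2, of dim_col] assms by simp
  ultimately show "minv M \<in> carrier_mat n n" by auto
  show "M * minv M = 1\<^sub>m n" by (rule 1)
  show "minv M * M = 1\<^sub>m n" using 2 \<open>dim_row (minv M) = n\<close> by simp
qed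

lemma det_nonzero_if_invertible:
  fixes M :: "complex mat"
  assumes "M \<in> carrier_mat n n" "invertible_mat M" shows "det M \<noteq> 0"
  using det_mult[OF assms(1) minv_inverse(1)[OF assms]] minv_inverse(2)[OF assms]
  by (metis det_one mult_zero_left zero_neq_one)

lemma invertible_if_det_nonzero:
  fixes M :: "complex mat"
  assumes "M \<in> carrier_mat n n" "det M \<noteq> 0" shows "invertible_mat M"
proof -
  have "M \<in> Units (ring_mat TYPE(complex) n ())" by (rule det_non_zero_imp_unit[OF assms])
  then obtain B where "B \<in> carrier_mat n n" "M * B = 1\<^sub>m n" "B * M = 1\<^sub>m n"
    unfolding Units_def by (auto simp: ring_mat_simps)
  then have "inverts_mat M B \<and> inverts_mat B M" using assms(1) by (simp add: inverts_mat_def)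
  then show ?thesis using assms(1) by (auto simp: invertible_mat_def)
qed

lemma Jform_carrier:
  assumes "length ds = length lam"
  shows "Jform lam ds eta \<in> carrier_mat (sum_list ds) (sum_list ds)"
proof -
  have "map (\<lambda>i. ds ! i) [0..<length lam] = ds" using assms by (metis map_nth)
  then show ?thesis
    unfolding Jform_def carrier_mat_def
    by (simp add: dim_diag_block_mat o_def Ablk_def Nmat_def)
qed

text \<open>The Jordan form is upper triangular, so its characteristic polynomial splits over the
  diagonal. Blocks of size at least 1 guarantee that each \<open>lam ! i\<close> really occurs
  there.\<close>

lemma Jform_eigenvalue:
  assumes "length ds = length lam" "\<And>i. i < length ds \<Longrightarrow> 1 \<le> ds ! i" "i < length lam"
  shows "eigenvalue (Jform lam ds eta) (lam ! i)"
proof -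
  let ?As = "map (Ablk lam ds eta) [0..<length lam]"
  have sq: "square_mat A" if "A \<in> set ?As" for A using that by (auto simp: Ablk_def Nmat_def)
  have ut: "upper_triangular A" if "A \<in> set ?As" for A
    using that by (auto simp: Ablk_def Nmat_def upper_triangular_def)
  have "lam ! i \<in> set (diag_mat (Ablk lam ds eta i))"
    using assms(1,3) assms(2)[of i] by (auto simp: diag_mat_def Ablk_def Nmat_def image_iff intro!: exI[of _ 0])
  then have "lam ! i \<in> set (diag_mat (Jform lam ds eta))"
  proof -
    have "diag_mat (Jform lam ds eta) = concat (map diag_mat ?As)"
      unfolding Jform_def by (rule diag_mat_diag_block_mat) (rule sq)
    moreover have "Ablk lam ds eta i \<in> set ?As" using assms(3) by auto
    ultimately show ?thesis using \<open>lam ! i \<in> set (diag_mat (Ablk lam ds eta i))\<close> by auto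
  qed
  moreover have "char_poly (Jform lam ds eta) = (\<Prod> a \<leftarrow> diag_mat (Jform lam ds eta). [:- a, 1:])"
    by (rule char_poly_upper_triangular[OF Jform_carrier[OF assms(1)]])
       (unfold Jform_def, rule upper_triangular_diag_block_mat, erule sq, erule ut)
  ultimately have "poly (char_poly (Jform lam ds eta)) (lam ! i) = 0"
    by (auto simp: poly_prod_list prod_list_zero_iff)
  then show ?thesis using eigenvalue_root_char_poly[OF Jform_carrier[OF assms(1)]] by blast
qed

lemma Pmat_carrier: "Pmat ds \<delta> \<in> carrier_mat (sum_list ds) (sum_list ds)"
proof -
  have "map (\<lambda>m. dim_row (Matrix.mat m m (g m) :: complex mat)) ds = ds"
    "map (\<lambda>m. dim_col (Matrix.mat m m (g m) :: complex mat)) ds = ds" for g by auto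
  then show ?thesis unfolding Pmat_def by (intro carrier_matI) (simp_all only: dim_diag_block_mat map_map o_def)
qed

lemma Pmat_det_nonzero:
  assumes "0 < \<delta>" shows "det (Pmat ds \<delta>) \<noteq> 0"
proof -
  let ?As = "map (\<lambda>m. Matrix.mat m m (\<lambda>(j,k). if j = k then complex_of_real (\<delta> ^ j) else 0)) ds"
  have sq: "square_mat A" if "A \<in> set ?As" for A using that by auto
  have ut: "upper_triangular A" if "A \<in> set ?As" for A using that by (auto simp: upper_triangular_def)
  have "det (Pmat ds \<delta>) = prod_list (diag_mat (Pmat ds \<delta>))"
    by (rule det_upper_triangular[OF _ Pmat_carrier])
       (unfold Pmat_def, rule upper_triangular_diag_block_mat, erule sq, erule ut)
  moreover have "0 \<notin> set (diag_mat (Pmat ds \<delta>))"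
  proof -
    have "diag_mat (Pmat ds \<delta>) = concat (map diag_mat ?As)"
      unfolding Pmat_def by (rule diag_mat_diag_block_mat) (rule sq)
    then show ?thesis using assms by (auto simp: diag_mat_def)
  qed
  ultimately show ?thesis by (simp add: prod_list_zero_iff)
qed

lemma Dmat_carrier:
  assumes "length ds = length eta" shows "Dmat ds eta \<delta> \<in> carrier_mat (sum_list ds) (sum_list ds)"
proof -
  have "map (\<lambda>i. ds ! i) [0..<length ds] = ds" by (metis map_nth)
  then show ?thesis
    unfolding Dmat_def carrier_mat_def
    by (simp add: dim_diag_block_mat o_def Nmat_def)
qed


text \<open>\<open>fC\<close> evaluates f at the real parts. Taking real parts is a contraction that
  maps the ball into the ball of the same radius, and embedding the reals is isometric, so a
  constant for f carries over unchanged.\<close>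

lemma fC_lipschitz_on_ball:
  assumes f: "\<And>x. x \<in> carrier_vec d \<Longrightarrow> f x \<in> carrier_vec d" and lip: "loc_lipschitz d f"
  obtains L where "0 \<le> L" "\<And>y z. y \<in> carrier_vec d \<Longrightarrow> z \<in> carrier_vec d \<Longrightarrow> vnorm y \<le> R \<Longrightarrow> vnorm z \<le> R
     \<Longrightarrow> vnorm (fC f y - fC f z) \<le> L * vnorm (y - z)"
proof -
  obtain L where L: "0 \<le> L" "\<And>y z. y \<in> carrier_vec d \<Longrightarrow> z \<in> carrier_vec d \<Longrightarrow> vnorm y \<le> R \<Longrightarrow> vnorm z \<le> R
     \<Longrightarrow> vnorm (f y - f z) \<le> L * vnorm (y - z)"
    using loc_lipschitz_on_ball[of d f R] f lip by blast
  have of_real: "vnorm (map_vec complex_of_real u) = vnorm u" for u by (simp add: vnorm_def)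
  have Re: "vnorm (map_vec Re u) \<le> vnorm u" for u :: "complex Matrix.vec"
    unfolding vnorm_L2_set by (auto intro!: L2_set_mono abs_Re_le_cmod)
  show ?thesis
  proof (rule that[OF L(1)])
    fix y z :: "complex Matrix.vec"
    assume yz: "y \<in> carrier_vec d" "z \<in> carrier_vec d" "vnorm y \<le> R" "vnorm z \<le> R"
    let ?y = "map_vec Re y" and ?z = "map_vec Re z"
    have c: "?y \<in> carrier_vec d" "?z \<in> carrier_vec d" using yz by auto
    have dim: "dim_vec (f ?y) = d" "dim_vec (f ?z) = d" using f[OF c(1)] f[OF c(2)] by auto
    have "fC f y - fC f z = map_vec complex_of_real (f ?y - f ?z)"
      using dim by (intro eq_vecI) (auto simp: fC_def)
    then have "vnorm (fC f y - fC f z) = vnorm (f ?y - f ?z)"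
      by (simp only: of_real)
    also have "\<dots> \<le> L * vnorm (?y - ?z)"
      by (rule L(2)[OF c]) (use Re[of y] Re[of z] yz in auto)
    also have "?y - ?z = map_vec Re (y - z)" using yz by (intro eq_vecI) auto
    also have "L * vnorm (map_vec Re (y - z)) \<le> L * vnorm (y - z)" using Re L(1) by (intro mult_left_mono)
    finally show "vnorm (fC f y - fC f z) \<le> L * vnorm (y - z)" .
  qed
qed

section \<open>The nonlinearity in Jordan coordinates\<close>

locale jordan_setting =
  fixes f :: "real Matrix.vec \<Rightarrow> real Matrix.vec" and T :: "complex mat" and ds :: "nat list"
    and eta :: "bool list" and \<delta> :: real and d :: nat
  assumes f: "\<And>x. x \<in> carrier_vec d \<Longrightarrow> f x \<in> carrier_vec d" and lip: "loc_lipschitz d f"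
    and f0: "f (0\<^sub>v d) = 0\<^sub>v d" and delta: "0 < \<delta>"
    and T: "T \<in> carrier_mat d d" "invertible_mat T" and len: "length ds = length eta"
    and dim: "sum_list ds = d"
begin

abbreviation "h \<equiv> hfun f T ds eta \<delta>"

lemma TP: "T * Pmat ds \<delta> \<in> carrier_mat d d" "minv (T * Pmat ds \<delta>) \<in> carrier_mat d d"
proof -
  have P: "Pmat ds \<delta> \<in> carrier_mat d d" using Pmat_carrier[of ds \<delta>] dim by simp
  then show c: "T * Pmat ds \<delta> \<in> carrier_mat d d" using T by auto
  have "det (T * Pmat ds \<delta>) \<noteq> 0"
    using det_mult[OF T(1) P] det_nonzero_if_invertible[OF T] Pmat_det_nonzero[OF delta] by simp
  then show "minv (T * Pmat ds \<delta>) \<in> carrier_mat d d"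
    using minv_inverse(1)[OF c invertible_if_det_nonzero[OF c]] by blast
qed

lemma D: "Dmat ds eta \<delta> \<in> carrier_mat d d"
  using Dmat_carrier[OF len, of \<delta>] dim by simp

lemma fC_carrier: "y \<in> carrier_vec d \<Longrightarrow> fC f y \<in> carrier_vec d"
  using f[of "map_vec Re y"] by (auto simp: fC_def)

lemma h_carrier: "y \<in> carrier_vec d \<Longrightarrow> h y \<in> carrier_vec d"
  unfolding hfun_def using TP D fC_carrier by (intro add_carrier_vec mult_mat_vec_carrier) auto

lemma h_zero: "h (0\<^sub>v d) = 0\<^sub>v d"
proof -
  have "map_vec Re (0\<^sub>v d) = 0\<^sub>v d" "map_vec complex_of_real (0\<^sub>v d) = 0\<^sub>v d" by auto
  then have "fC f (0\<^sub>v d) = 0\<^sub>v d" by (simp add: fC_def f0)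
  moreover have "M *\<^sub>v 0\<^sub>v d = 0\<^sub>v d" if "M \<in> carrier_mat d d" for M :: "complex mat"
    using that by (intro eq_vecI) auto
  ultimately show ?thesis using TP D by (simp add: hfun_def)
qed

lemma h_lipschitz_on_ball:
  obtains L where "0 \<le> L" "\<And>y z. y \<in> carrier_vec d \<Longrightarrow> z \<in> carrier_vec d \<Longrightarrow> vnorm y \<le> R \<Longrightarrow> vnorm z \<le> R
     \<Longrightarrow> vnorm (h y - h z) \<le> L * vnorm (y - z)"
proof -
  let ?M = "T * Pmat ds \<delta>" and ?N = "minv (T * Pmat ds \<delta>)" and ?D = "Dmat ds eta \<delta>"
  obtain K1 where K1: "0 \<le> K1" "\<And>y. y \<in> carrier_vec d \<Longrightarrow> vnorm (?M *\<^sub>v y) \<le> K1 * vnorm y"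
    using vnorm_mult_mat_vec_le[of ?M] carrier_matD(2)[OF TP(1)] by metis
  obtain K2 where K2: "0 \<le> K2" "\<And>y. y \<in> carrier_vec d \<Longrightarrow> vnorm (?N *\<^sub>v y) \<le> K2 * vnorm y"
    using vnorm_mult_mat_vec_le[of ?N] carrier_matD(2)[OF TP(2)] by metis
  obtain K3 where K3: "0 \<le> K3" "\<And>y. y \<in> carrier_vec d \<Longrightarrow> vnorm (?D *\<^sub>v y) \<le> K3 * vnorm y"
    using vnorm_mult_mat_vec_le[of ?D] carrier_matD(2)[OF D] by metis
  obtain L where L: "0 \<le> L" "\<And>y z. y \<in> carrier_vec d \<Longrightarrow> z \<in> carrier_vec d \<Longrightarrow> vnorm y \<le> K1 * R \<Longrightarrow> vnorm z \<le> K1 * R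
     \<Longrightarrow> vnorm (fC f y - fC f z) \<le> L * vnorm (y - z)"
    using fC_lipschitz_on_ball[of d f "K1 * R"] f lip by blast
  show ?thesis
  proof (rule that[of "K3 + K2 * (L * K1)"])
    show "0 \<le> K3 + K2 * (L * K1)" using K1 K2 K3 L by simp
    fix y z :: "complex Matrix.vec"
    assume yz: "y \<in> carrier_vec d" "z \<in> carrier_vec d" "vnorm y \<le> R" "vnorm z \<le> R"
    have c: "?M *\<^sub>v y \<in> carrier_vec d" "?M *\<^sub>v z \<in> carrier_vec d" using TP yz by auto
    have c2: "fC f (?M *\<^sub>v y) \<in> carrier_vec d" "fC f (?M *\<^sub>v z) \<in> carrier_vec d" using c fC_carrier by auto
    have "h y - h z = ?D *\<^sub>v (y - z) + ?N *\<^sub>v (fC f (?M *\<^sub>v y) - fC f (?M *\<^sub>v z))"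
      unfolding hfun_def mult_minus_distrib_mat_vec[OF D yz(1,2)] mult_minus_distrib_mat_vec[OF TP(2) c2]
      using D TP yz c2 by (intro eq_vecI) auto
    then have "vnorm (h y - h z) \<le> vnorm (?D *\<^sub>v (y - z)) + vnorm (?N *\<^sub>v (fC f (?M *\<^sub>v y) - fC f (?M *\<^sub>v z)))"
      using D TP by (simp add: vnorm_triangle)
    also have "\<dots> \<le> K3 * vnorm (y - z) + K2 * vnorm (fC f (?M *\<^sub>v y) - fC f (?M *\<^sub>v z))"
      using yz c2 by (intro add_mono K2 K3) auto
    finally have 1: "vnorm (h y - h z) \<le> K3 * vnorm (y - z) + K2 * vnorm (fC f (?M *\<^sub>v y) - fC f (?M *\<^sub>v z))" .
    have "vnorm (fC f (?M *\<^sub>v y) - fC f (?M *\<^sub>v z)) \<le> L * (K1 * vnorm (y - z))"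
    proof -
      have "vnorm (fC f (?M *\<^sub>v y) - fC f (?M *\<^sub>v z)) \<le> L * vnorm (?M *\<^sub>v y - ?M *\<^sub>v z)"
        using K1(2)[of y] K1(2)[of z] yz mult_left_mono[OF yz(3) K1(1)] mult_left_mono[OF yz(4) K1(1)]
        by (intro L(2) c) linarith+
      also have "?M *\<^sub>v y - ?M *\<^sub>v z = ?M *\<^sub>v (y - z)" by (rule mult_minus_distrib_mat_vec[OF TP(1) yz(1,2), symmetric])
      also have "L * vnorm (?M *\<^sub>v (y - z)) \<le> L * (K1 * vnorm (y - z))"
        using yz by (intro mult_left_mono K1 L) auto
      finally show ?thesis .
    qed
    then have 2: "K3 * vnorm (y - z) + K2 * vnorm (fC f (?M *\<^sub>v y) - fC f (?M *\<^sub>v z))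
        \<le> K3 * vnorm (y - z) + K2 * (L * (K1 * vnorm (y - z)))"
      using K2(1) by (intro add_left_mono mult_left_mono)
    from order_trans[OF 1 2] show "vnorm (h y - h z) \<le> (K3 + K2 * (L * K1)) * vnorm (y - z)"
      by (simp add: algebra_simps)
  qed
qed

text \<open>\<open>lipc\<close> is a supremum of reals and bounds its quotients only once they are
  known to be bounded; this makes it a true Lipschitz constant of h. The inserted 0 then yields its
  sign.\<close>

lemma bdd_above_lipc:
  "bdd_above (insert 0 {vnorm (h y - h z) / vnorm (y - z) | y z.
       y \<in> carrier_vec d \<and> z \<in> carrier_vec d \<and> vnorm y \<le> R \<and> vnorm z \<le> R \<and> y \<noteq> z})" (is "bdd_above ?S")
proof -
  obtain L where L: "0 \<le> L" "\<And>y z. y \<in> carrier_vec d \<Longrightarrow> z \<in> carrier_vec d \<Longrightarrow> vnorm y \<le> R \<Longrightarrow> vnorm z \<le> R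
     \<Longrightarrow> vnorm (h y - h z) \<le> L * vnorm (y - z)"
    using h_lipschitz_on_ball by blast
  show ?thesis
  proof (rule bdd_aboveI)
    fix x assume "x \<in> ?S"
    then consider "x = 0" | u v where "x = vnorm (h u - h v) / vnorm (u - v)" "u \<in> carrier_vec d" "v \<in> carrier_vec d"
        "vnorm u \<le> R" "vnorm v \<le> R" "u \<noteq> v" by blast
    then show "x \<le> L"
    proof cases
      case 2
      have "0 < vnorm (u - v)" using 2 vnorm_diff_eq_0[of u v] by (force simp: less_le)
      then show ?thesis using L(2)[OF 2(2-5)] unfolding 2(1) by (simp add: pos_divide_le_eq)
    qed (use L in auto)
  qed
qed

lemma lipc_nonneg: "0 \<le> lipc d h R"
  unfolding lipc_def by (rule cSup_upper[OF _ bdd_above_lipc]) simp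

lemma h_lipc:
  assumes "y \<in> carrier_vec d" "z \<in> carrier_vec d" "vnorm y \<le> R" "vnorm z \<le> R"
  shows "vnorm (h y - h z) \<le> lipc d h R * vnorm (y - z)"
proof (cases "y = z")
  case True
  have "h z - h z = 0\<^sub>v d" using h_carrier[OF assms(2)] by auto
  then show ?thesis using True assms by simp
next
  case False
  have pos: "0 < vnorm (y - z)"
    using False vnorm_diff_eq_0[of y z] assms by (force simp: less_le)
  have "vnorm (h y - h z) / vnorm (y - z) \<le> lipc d h R"
    unfolding lipc_def by (rule cSup_upper[OF _ bdd_above_lipc]) (use assms False in blast)
  then show ?thesis using pos by (simp add: pos_divide_le_eq)
qed

end

section \<open>The integral operator\<close>

lemma L2_set_integral_le:
  fixes K v :: "nat \<Rightarrow> real \<Rightarrow> complex"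
  assumes int: "\<And>j. j < d \<Longrightarrow> (\<lambda>s. K j s * v j s) integrable_on S"
    and K: "\<And>j s. j < d \<Longrightarrow> s \<in> S \<Longrightarrow> norm (K j s) \<le> \<kappa> s"
    and k: "\<kappa> integrable_on S" "integral S \<kappa> \<le> C" "\<And>s. s \<in> S \<Longrightarrow> 0 \<le> \<kappa> s"
    and v: "\<And>s. s \<in> S \<Longrightarrow> L2_set (\<lambda>j. norm (v j s)) {..<d} \<le> L" and L: "0 \<le> L"
  shows "L2_set (\<lambda>j. norm (integral S (\<lambda>s. K j s * v j s))) {..<d} \<le> C * L"
proof -
  \<comment> \<open>Duality: the squared norm of the integral is the integral of its inner product with the integrand.\<close>
  define I where "I j = integral S (\<lambda>s. K j s * v j s)" for j
  define N where "N = L2_set (\<lambda>j. norm (I j)) {..<d}"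
  have N0: "0 \<le> N" by (simp add: N_def)
  have C0: "0 \<le> C" using integral_nonneg[OF k(1,3)] k(2) by linarith
  have "N\<^sup>2 = (\<Sum>j<d. (norm (I j))\<^sup>2)" by (simp add: N_def L2_set_def sum_nonneg)
  then have "of_real (N\<^sup>2) = (\<Sum>j<d. cnj (I j) * I j)"
    by (simp add: complex_norm_square mult.commute del: of_real_power)
  also have "\<dots> = (\<Sum>j<d. integral S (\<lambda>s. cnj (I j) * (K j s * v j s)))"
    by (simp add: I_def)
  also have "\<dots> = integral S (\<lambda>s. \<Sum>j<d. cnj (I j) * (K j s * v j s))"
    by (rule integral_sum[symmetric]) (auto intro!: integrable_on_mult_right int)
  finally have eq: "of_real (N\<^sup>2) = integral S (\<lambda>s. \<Sum>j<d. cnj (I j) * (K j s * v j s))" .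
  have "norm (complex_of_real (N\<^sup>2)) \<le> integral S (\<lambda>s. \<kappa> s * (N * L))"
    unfolding eq
  proof (rule integral_norm_bound_integral)
    show "(\<lambda>s. \<Sum>j<d. cnj (I j) * (K j s * v j s)) integrable_on S"
      by (intro integrable_sum integrable_on_mult_right int) auto
    show "(\<lambda>s. \<kappa> s * (N * L)) integrable_on S" by (intro integrable_on_mult_left k)
    fix s assume s: "s \<in> S"
    have "norm (\<Sum>j<d. cnj (I j) * (K j s * v j s)) \<le> (\<Sum>j<d. \<kappa> s * \<bar>norm (I j) * norm (v j s)\<bar>)"
    proof (rule sum_norm_le)
      fix j assume "j \<in> {..<d}"
      then have "norm (K j s) * (norm (I j) * norm (v j s)) \<le> \<kappa> s * (norm (I j) * norm (v j s))"
        using K s by (intro mult_right_mono) auto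
      then show "norm (cnj (I j) * (K j s * v j s)) \<le> \<kappa> s * \<bar>norm (I j) * norm (v j s)\<bar>"
        by (simp add: norm_mult mult_ac)
    qed
    also have "\<dots> = \<kappa> s * (\<Sum>j<d. \<bar>norm (I j)\<bar> * \<bar>norm (v j s)\<bar>)" by (simp add: sum_distrib_left)
    also have "\<dots> \<le> \<kappa> s * (N * L2_set (\<lambda>j. norm (v j s)) {..<d})"
      unfolding N_def by (intro mult_left_mono L2_set_mult_ineq k s)
    also have "\<dots> \<le> \<kappa> s * (N * L)" by (intro mult_left_mono v s N0 k)
    finally show "norm (\<Sum>j<d. cnj (I j) * (K j s * v j s)) \<le> \<kappa> s * (N * L)" .
  qed
  also have "\<dots> = integral S \<kappa> * (N * L)" by simp
  also have "\<dots> \<le> C * (N * L)" using k(2) N0 L by (intro mult_right_mono) auto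
  finally have "N * N \<le> N * (C * L)" by (simp add: norm_power power2_eq_square norm_mult mult_ac)
  then have "N \<le> C * L" using N0 C0 L by (cases "N = 0") (auto simp: mult_le_cancel_left)
  then show ?thesis by (simp add: N_def I_def)
qed

section \<open>The singular convolution kernel and its integrable majorant\<close>

definition ml_conv_kernel :: "real \<Rightarrow> real \<Rightarrow> real \<Rightarrow> complex \<Rightarrow> real \<Rightarrow> complex" where
  "ml_conv_kernel \<alpha> \<rho> t l s = complex_of_real (((t powr \<rho> - s powr \<rho>) / \<rho>) powr (\<alpha> - 1))
        * mittag_leffler \<alpha> \<alpha> (complex_of_real (((t powr \<rho> - s powr \<rho>) / \<rho>) powr \<alpha>) * l)
        * complex_of_real (s powr (\<rho> - 1))"

text \<open>In terms of \<open>u = (t^\<rho> - s^\<rho>)/\<rho>\<close> this is the \<open>s\<close>-derivative of \<open>(M/\<alpha>) / (1 + u^\<alpha>)\<close>.\<close>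
definition kernel_majorant :: "real \<Rightarrow> real \<Rightarrow> real \<Rightarrow> real \<Rightarrow> real \<Rightarrow> real" where
  "kernel_majorant M \<alpha> \<rho> t s = M * (((t powr \<rho> - s powr \<rho>) / \<rho>) powr (\<alpha> - 1)
      / (1 + ((t powr \<rho> - s powr \<rho>) / \<rho>) powr \<alpha>)\<^sup>2 * s powr (\<rho> - 1))"

lemma kernel_majorant_nonneg: "0 \<le> M \<Longrightarrow> 0 \<le> kernel_majorant M \<alpha> \<rho> t s"
  by (simp add: kernel_majorant_def)

text \<open>The integral telescopes, and since u vanishes at s = t the upper end contributes exactly
  M/\<alpha> for all \<rho>, t_0 and t; the lower end is subtracted and nonnegative. The power
  u^(\<alpha>-1) can be singular at s = t, so the primitive is differentiated only in the interior
  and is merely continuous at the ends.\<close>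

lemma kernel_majorant_integral:
  assumes a: "0 < \<alpha>" and rho: "0 < \<rho>" and t: "0 < t0" "t0 \<le> t" and M: "0 \<le> M"
  shows "kernel_majorant M \<alpha> \<rho> t integrable_on {t0..t}" "integral {t0..t} (kernel_majorant M \<alpha> \<rho> t) \<le> M / \<alpha>"
proof -
  define u where "u s = (t powr \<rho> - s powr \<rho>) / \<rho>" for s
  have u0: "0 \<le> u s" if "s \<in> {t0..t}" for s
    using that t rho by (auto simp: u_def intro!: divide_nonneg_pos powr_mono2)
  have upos: "0 < u s" if "s \<in> {t0<..<t}" for s
    using that t rho by (auto simp: u_def intro!: divide_pos_pos powr_less_mono2)
  have den: "0 < 1 + x powr \<alpha>" for x :: real by (simp add: add_pos_nonneg)
  have quot: "((\<lambda>s. c / (1 + q s)) has_real_derivative - (c * q') / (1 + q s)\<^sup>2) (at s)"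
    if "(q has_real_derivative q') (at s)" "1 + q s \<noteq> 0" for c q q' and s :: real
    using that by (auto intro!: derivative_eq_intros simp: power2_eq_square)
  let ?f = "\<lambda>s. (M / \<alpha>) / (1 + u s powr \<alpha>)"
  have "(kernel_majorant M \<alpha> \<rho> t has_integral (?f t - ?f t0)) {t0..t}"
  proof (rule fundamental_theorem_of_calculus_interior[OF t(2)])
    have "continuous_on {t0..t} u" unfolding u_def using t rho by (intro continuous_intros) auto
    then have "continuous_on {t0..t} (\<lambda>s. u s powr \<alpha>)"
      using u0 a by (intro continuous_on_powr') (auto intro!: continuous_intros)
    then show "continuous_on {t0..t} ?f"
      using den by (intro continuous_on_divide continuous_on_add continuous_on_const) (auto simp: less_imp_neq[symmetric])
    fix s assume s: "s \<in> {t0<..<t}"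
    then have s0: "0 < s" using t by auto
    have du: "(u has_real_derivative - (s powr (\<rho> - 1))) (at s)"
      unfolding u_def using s0 rho by (auto intro!: derivative_eq_intros)
    have "((\<lambda>s. u s powr \<alpha>) has_real_derivative \<alpha> * u s powr (\<alpha> - 1) * (- (s powr (\<rho> - 1)))) (at s)"
      using du upos[OF s] by (auto intro!: derivative_eq_intros)
    then have "(?f has_real_derivative - ((M / \<alpha>) * (\<alpha> * u s powr (\<alpha> - 1) * (- (s powr (\<rho> - 1))))) / (1 + u s powr \<alpha>)\<^sup>2) (at s)"
      by (rule quot) (use den[of "u s"] in simp)
    moreover have "- ((M / \<alpha>) * (\<alpha> * u s powr (\<alpha> - 1) * (- (s powr (\<rho> - 1))))) / (1 + u s powr \<alpha>)\<^sup>2 = kernel_majorant M \<alpha> \<rho> t s"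
      using a by (simp add: kernel_majorant_def u_def)
    ultimately show "(?f has_vector_derivative kernel_majorant M \<alpha> \<rho> t s) (at s)"
      by (simp only: has_real_derivative_iff_has_vector_derivative)
  qed
  moreover have "?f t - ?f t0 \<le> M / \<alpha>"
  proof -
    have "?f t = M / \<alpha>" using a by (simp add: u_def)
    moreover have "0 \<le> ?f t0" using M a den[of "u t0"] by simp
    ultimately show ?thesis by linarith
  qed
  ultimately show "kernel_majorant M \<alpha> \<rho> t integrable_on {t0..t}" "integral {t0..t} (kernel_majorant M \<alpha> \<rho> t) \<le> M / \<alpha>"
    using integral_unique by (blast, metis)
qed

lemma norm_ml_conv_kernel_le:
  assumes "\<And>x. 0 \<le> x \<Longrightarrow> norm (mittag_leffler \<alpha> \<alpha> (of_real x * l)) \<le> M / (1 + x)\<^sup>2"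
  shows "norm (ml_conv_kernel \<alpha> \<rho> t l s) \<le> kernel_majorant M \<alpha> \<rho> t s"
proof -
  let ?u = "(t powr \<rho> - s powr \<rho>) / \<rho>"
  have "norm (ml_conv_kernel \<alpha> \<rho> t l s) =
      ?u powr (\<alpha> - 1) * norm (mittag_leffler \<alpha> \<alpha> (complex_of_real (?u powr \<alpha>) * l)) * s powr (\<rho> - 1)"
    unfolding ml_conv_kernel_def norm_mult norm_of_real by simp
  also have "\<dots> \<le> ?u powr (\<alpha> - 1) * (M / (1 + ?u powr \<alpha>)\<^sup>2) * s powr (\<rho> - 1)"
    by (intro mult_right_mono mult_left_mono assms) auto
  finally show ?thesis by (simp add: kernel_majorant_def mult_ac)
qed

text \<open>The kernel can blow up at s = t. It is continuous on the half-open interval and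
  dominated there by the majorant, and the missing endpoint is negligible.\<close>

lemma ml_conv_kernel_integrable:
  fixes w :: "real \<Rightarrow> complex"
  assumes a: "0 < \<alpha>" and rho: "0 < \<rho>" and t: "0 < t0" "t0 \<le> t" and M: "0 \<le> M"
    and ml: "\<And>x. 0 \<le> x \<Longrightarrow> norm (mittag_leffler \<alpha> \<alpha> (of_real x * l)) \<le> M / (1 + x)\<^sup>2"
    and w: "continuous_on {t0..} w" "\<And>s. t0 \<le> s \<Longrightarrow> norm (w s) \<le> B"
  shows "(\<lambda>s. ml_conv_kernel \<alpha> \<rho> t l s * w s) integrable_on {t0..t}"
proof -
  let ?S = "{t0..<t}"
  have u: "0 < (t powr \<rho> - s powr \<rho>) / \<rho>" if "s \<in> ?S" for s
    using that t rho by (auto intro!: divide_pos_pos powr_less_mono2)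
  have cu: "continuous_on ?S (\<lambda>s. (t powr \<rho> - s powr \<rho>) / \<rho>)"
    using t rho by (intro continuous_intros) auto
  have cp: "continuous_on ?S (\<lambda>s. complex_of_real (((t powr \<rho> - s powr \<rho>) / \<rho>) powr c))" for c
    by (intro continuous_on_of_real continuous_on_powr cu continuous_on_const) (use u in force)
  have cm: "continuous_on UNIV (mittag_leffler \<alpha> \<alpha>)"
    by (rule continuous_at_imp_continuous_on) (use isCont_mittag_leffler[OF a a] in auto)
  have "continuous_on ?S (ml_conv_kernel \<alpha> \<rho> t l)"
    unfolding ml_conv_kernel_def[abs_def]
    using t by (intro continuous_on_mult cp continuous_on_compose2[OF cm] continuous_on_const
        continuous_on_of_real continuous_on_powr continuous_on_id) auto
  then have cont: "continuous_on ?S (\<lambda>s. ml_conv_kernel \<alpha> \<rho> t l s * w s)"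
    by (intro continuous_on_mult continuous_on_subset[OF w(1)]) auto
  have sp: "f integrable_on {t0..t} \<longleftrightarrow> f integrable_on ?S" for f :: "real \<Rightarrow> 'b::euclidean_space"
    by (rule integrable_spike_set_eq) (rule negligible_subset[of "{t}"], auto)
  have "(\<lambda>s. ml_conv_kernel \<alpha> \<rho> t l s * w s) absolutely_integrable_on ?S"
  proof (rule measurable_bounded_by_integrable_imp_absolutely_integrable)
    show "(\<lambda>s. ml_conv_kernel \<alpha> \<rho> t l s * w s) \<in> borel_measurable (lebesgue_on ?S)"
      by (rule continuous_imp_measurable_on_sets_lebesgue[OF cont]) simp
    show "(\<lambda>s. kernel_majorant M \<alpha> \<rho> t s * B) integrable_on ?S"
      using kernel_majorant_integral(1)[OF a rho t M] unfolding sp by (intro integrable_on_mult_left)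
    fix s assume s: "s \<in> ?S"
    show "norm (ml_conv_kernel \<alpha> \<rho> t l s * w s) \<le> kernel_majorant M \<alpha> \<rho> t s * B"
      unfolding norm_mult using s
      by (intro mult_mono norm_ml_conv_kernel_le ml w kernel_majorant_nonneg M) auto
  qed auto
  then show ?thesis unfolding sp by (rule set_lebesgue_integral_eq_integral)
qed

section \<open>Block indices, the sup norm and the coordinates of the operator\<close>

lemma blk_less:
  assumes "j < sum_list ds" shows "blk ds j < length ds"
proof -
  have "ds \<noteq> []" using assms by auto
  then have "j < sum_list (take (Suc (length ds - 1)) ds)" using assms by simp
  then have "blk ds j \<le> length ds - 1" unfolding blk_def by (rule Least_le)
  then show ?thesis using \<open>ds \<noteq> []\<close> by (cases ds) auto
qed

lemma Cinf_vnorm_le_supn: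
  assumes "\<xi> \<in> Cinf d t0" "t0 \<le> t" shows "vnorm (\<xi> t) \<le> supn t0 \<xi>"
  unfolding supn_def by (rule cSup_upper) (use assms in \<open>auto simp: Cinf_def bdd_above_def\<close>)

lemma Cinf_carrier: "\<xi> \<in> Cinf d t0 \<Longrightarrow> t0 \<le> t \<Longrightarrow> \<xi> t \<in> carrier_vec d"
  by (simp add: Cinf_def)

lemma Cinf_diff_vnorm_le_supn:
  assumes "\<xi> \<in> Cinf d t0" "\<xi>' \<in> Cinf d t0" "t0 \<le> t"
  shows "vnorm (\<xi> t - \<xi>' t) \<le> supn t0 (\<lambda>t. \<xi> t - \<xi>' t)"
  unfolding supn_def
proof (rule cSup_upper)
  show "bdd_above ((\<lambda>t. vnorm (\<xi> t - \<xi>' t)) ` {t0..})"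
  proof (rule bdd_aboveI2)
    fix s assume s: "s \<in> {t0..}"
    have c: "\<xi> s \<in> carrier_vec d" "\<xi>' s \<in> carrier_vec d" using assms s Cinf_carrier by auto
    have "vnorm (\<xi> s - \<xi>' s) \<le> vnorm (\<xi> s - 0\<^sub>v d) + vnorm (0\<^sub>v d - \<xi>' s)"
      using c by (intro vnorm_diff_triangle) auto
    also have "vnorm (0\<^sub>v d - \<xi>' s) = vnorm (\<xi>' s - 0\<^sub>v d)" using c by (intro vnorm_minus_commute) auto
    also have "\<xi> s - 0\<^sub>v d = \<xi> s" using c by auto
    also have "\<xi>' s - 0\<^sub>v d = \<xi>' s" using c by auto
    finally show "vnorm (\<xi> s - \<xi>' s) \<le> supn t0 \<xi> + supn t0 \<xi>'"
      using Cinf_vnorm_le_supn[OF assms(1), of s] Cinf_vnorm_le_supn[OF assms(2), of s] s by auto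
  qed
qed (use assms in auto)

lemma supn_leI: "(\<And>t. t0 \<le> t \<Longrightarrow> vnorm (\<xi> t) \<le> B) \<Longrightarrow> supn t0 \<xi> \<le> B"
  unfolding supn_def by (rule cSUP_least) auto


lemma dim_Fop [simp]: "dim_vec (Fop \<alpha> \<rho> t0 lam ds h x \<xi> t) = sum_list ds"
  by (simp add: Fop_def)

lemma Fop_index:
  assumes "j < sum_list ds"
  shows "Fop \<alpha> \<rho> t0 lam ds h x \<xi> t $ j =
      mittag_leffler \<alpha> 1 (complex_of_real (((t powr \<rho> - t0 powr \<rho>) / \<rho>) powr \<alpha>) * lam ! blk ds j) * x $ j
      + integral {t0..t} (\<lambda>s. ml_conv_kernel \<alpha> \<rho> t (lam ! blk ds j) s * h (\<xi> s) $ j)"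
  using assms unfolding Fop_def ml_conv_kernel_def by simp

text \<open>The spectrum enters only through the two Mittag-Leffler bounds. A single M for all
  blocks is required, because the vector estimate dominates all coordinate kernels by one common
  majorant.\<close>

locale fractional_setting = jordan_setting +
  fixes \<alpha> \<rho> t0 M :: real and lam :: "complex list"
  assumes a: "0 < \<alpha>" and rho: "0 < \<rho>" and t0: "0 < t0" and M: "0 < M" and len_lam: "length ds = length lam"
    and ml: "\<And>i x. i < length lam \<Longrightarrow> 0 \<le> x \<Longrightarrow> norm (mittag_leffler \<alpha> \<alpha> (of_real x * lam ! i)) \<le> M / (1 + x)\<^sup>2"
    and ml1: "\<And>i. i < length lam \<Longrightarrow> \<exists>B. \<forall>x\<ge>0. norm (mittag_leffler \<alpha> 1 (of_real x * lam ! i)) \<le> B"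
begin

lemma h_vnorm_le:
  assumes "y \<in> carrier_vec d" "vnorm y \<le> R" shows "vnorm (h y) \<le> lipc d h R * vnorm y"
proof -
  have "0 \<le> R" using assms(2) vnorm_nonneg[of y] by linarith
  then have "vnorm (h y - h (0\<^sub>v d)) \<le> lipc d h R * vnorm (y - 0\<^sub>v d)"
    using assms by (intro h_lipc) auto
  moreover have "h y - 0\<^sub>v d = h y" "y - 0\<^sub>v d = y" using assms h_carrier[of y] by auto
  ultimately show ?thesis by (simp add: h_zero)
qed

text \<open>The values of \<xi> lie in a ball of radius \<open>supn t0 \<xi>\<close>, on which h has
  a Lipschitz constant, so continuity of the coordinates of \<xi> passes to those of the
  composition. This supplies the measurability behind the integrals.\<close>

lemma continuous_h_comp:
  assumes xi: "\<xi> \<in> Cinf d t0" and j: "j < d"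
  shows "continuous_on {t0..} (\<lambda>s. h (\<xi> s) $ j)"
  unfolding continuous_on_def
proof
  fix s0 assume s0: "s0 \<in> {t0..}"
  let ?L = "lipc d h (supn t0 \<xi>)"
  have c: "\<xi> s \<in> carrier_vec d" if "t0 \<le> s" for s using Cinf_carrier[OF xi that] .
  have "((\<lambda>s. ?L * (\<Sum>i<d. norm (\<xi> s $ i - \<xi> s0 $ i))) \<longlongrightarrow> ?L * (\<Sum>i<d. 0)) (at s0 within {t0..})"
  proof (intro tendsto_mult_left tendsto_sum tendsto_norm_zero LIM_zero)
    fix i assume "i \<in> {..<d}"
    then have "continuous_on {t0..} (\<lambda>t. \<xi> t $ i)" using xi by (auto simp: Cinf_def)
    then show "((\<lambda>s. \<xi> s $ i) \<longlongrightarrow> \<xi> s0 $ i) (at s0 within {t0..})"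
      using s0 by (auto simp: continuous_on_def)
  qed
  then have "((\<lambda>s. ?L * (\<Sum>i<d. norm (\<xi> s $ i - \<xi> s0 $ i))) \<longlongrightarrow> 0) (at s0 within {t0..})" by simp
  then have "((\<lambda>s. h (\<xi> s) $ j - h (\<xi> s0) $ j) \<longlongrightarrow> 0) (at s0 within {t0..})"
  proof (rule Lim_null_comparison[rotated])
    have "norm (h (\<xi> s) $ j - h (\<xi> s0) $ j) \<le> ?L * (\<Sum>i<d. norm (\<xi> s $ i - \<xi> s0 $ i))" if s: "s \<in> {t0..}" for s
    proof -
      have hc: "h (\<xi> s) \<in> carrier_vec d" "h (\<xi> s0) \<in> carrier_vec d" using h_carrier c s s0 by auto
      have "norm (h (\<xi> s) $ j - h (\<xi> s0) $ j) \<le> vnorm (h (\<xi> s) - h (\<xi> s0))"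
        using norm_index_le_vnorm[of j "h (\<xi> s) - h (\<xi> s0)"] hc j by simp
      also have "\<dots> \<le> ?L * vnorm (\<xi> s - \<xi> s0)"
        using s s0 by (intro h_lipc c Cinf_vnorm_le_supn[OF xi]) auto
      also have "vnorm (\<xi> s - \<xi> s0) \<le> (\<Sum>i<d. norm (\<xi> s $ i - \<xi> s0 $ i))"
        using vnorm_le_sum[of "\<xi> s - \<xi> s0"] c[of s] c[of s0] s s0 by simp
      finally show ?thesis by (simp add: mult_left_mono lipc_nonneg)
    qed
    then show "\<forall>\<^sub>F s in at s0 within {t0..}. norm (h (\<xi> s) $ j - h (\<xi> s0) $ j) \<le> ?L * (\<Sum>i<d. norm (\<xi> s $ i - \<xi> s0 $ i))"
      by (auto simp: eventually_at_filter)
  qed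
  then show "((\<lambda>s. h (\<xi> s) $ j) \<longlongrightarrow> h (\<xi> s0) $ j) (at s0 within {t0..})"
    by (rule LIM_zero_cancel)
qed

lemma blk_lam: "j < d \<Longrightarrow> blk ds j < length lam"
  using blk_less[of j ds] dim len_lam by simp

lemma kernel_h_integrable:
  assumes xi: "\<xi> \<in> Cinf d t0" and j: "j < d" and t: "t0 \<le> t"
  shows "(\<lambda>s. ml_conv_kernel \<alpha> \<rho> t (lam ! blk ds j) s * h (\<xi> s) $ j) integrable_on {t0..t}"
proof (rule ml_conv_kernel_integrable[OF a rho t0 t less_imp_le[OF M] ml[OF blk_lam[OF j]] continuous_h_comp[OF xi j]])
  fix s assume s: "t0 \<le> s"
  have c: "\<xi> s \<in> carrier_vec d" by (rule Cinf_carrier[OF xi s])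
  have "norm (h (\<xi> s) $ j) \<le> vnorm (h (\<xi> s))"
    using h_carrier[OF c] j by (intro norm_index_le_vnorm) auto
  also have "\<dots> \<le> lipc d h (supn t0 \<xi>) * vnorm (\<xi> s)"
    by (rule h_vnorm_le[OF c Cinf_vnorm_le_supn[OF xi s]])
  also have "\<dots> \<le> lipc d h (supn t0 \<xi>) * supn t0 \<xi>"
    by (intro mult_left_mono lipc_nonneg Cinf_vnorm_le_supn[OF xi s])
  finally show "norm (h (\<xi> s) $ j) \<le> lipc d h (supn t0 \<xi>) * supn t0 \<xi>" .
qed

lemma vnorm_convolution_le:
  fixes w :: "real \<Rightarrow> complex Matrix.vec"
  assumes w: "\<And>s. t0 \<le> s \<Longrightarrow> w s \<in> carrier_vec d" "\<And>s. t0 \<le> s \<Longrightarrow> vnorm (w s) \<le> L" and L: "0 \<le> L" and t: "t0 \<le> t"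
    and int: "\<And>j. j < d \<Longrightarrow> (\<lambda>s. ml_conv_kernel \<alpha> \<rho> t (lam ! blk ds j) s * w s $ j) integrable_on {t0..t}"
  shows "L2_set (\<lambda>j. norm (integral {t0..t} (\<lambda>s. ml_conv_kernel \<alpha> \<rho> t (lam ! blk ds j) s * w s $ j))) {..<d} \<le> (M / \<alpha>) * L"
proof (rule L2_set_integral_le[OF int])
  fix j s assume "j < d"
  then show "norm (ml_conv_kernel \<alpha> \<rho> t (lam ! blk ds j) s) \<le> kernel_majorant M \<alpha> \<rho> t s"
    by (intro norm_ml_conv_kernel_le ml blk_lam)
next
  fix s assume s: "s \<in> {t0..t}"
  then show "L2_set (\<lambda>j. norm (w s $ j)) {..<d} \<le> L"
    using w(2)[of s] w(1)[of s] by (simp add: vnorm_L2_set)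
qed (use kernel_majorant_integral[OF a rho t0 t less_imp_le[OF M]] kernel_majorant_nonneg M L in auto)

text \<open>Both images share the term with x, which cancels; what is left is one convolution with
  the difference of the values of h, and the common radius is the larger of the two sup
  norms.\<close>

lemma Fop_diff_bound:
  assumes xi: "\<xi> \<in> Cinf d t0" "\<xi>' \<in> Cinf d t0"
  shows "supn t0 (\<lambda>t. Fop \<alpha> \<rho> t0 lam ds h x \<xi> t - Fop \<alpha> \<rho> t0 lam ds h x \<xi>' t)
     \<le> (M / \<alpha>) * lipc d h (max (supn t0 \<xi>) (supn t0 \<xi>')) * supn t0 (\<lambda>t. \<xi> t - \<xi>' t)"
proof (rule supn_leI)
  fix t assume t: "t0 \<le> t"
  let ?R = "max (supn t0 \<xi>) (supn t0 \<xi>')" and ?D = "supn t0 (\<lambda>t. \<xi> t - \<xi>' t)"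
  let ?w = "\<lambda>s. h (\<xi> s) - h (\<xi>' s)"
  let ?k = "\<lambda>j. ml_conv_kernel \<alpha> \<rho> t (lam ! blk ds j)"
  have c: "\<xi> s \<in> carrier_vec d" "\<xi>' s \<in> carrier_vec d" if "t0 \<le> s" for s using Cinf_carrier xi that by auto
  have hc: "h (\<xi> s) \<in> carrier_vec d" "h (\<xi>' s) \<in> carrier_vec d" if "t0 \<le> s" for s using h_carrier c that by auto
  have eqw: "?k j s * ?w s $ j = ?k j s * h (\<xi> s) $ j - ?k j s * h (\<xi>' s) $ j" if "j < d" "s \<in> {t0..t}" for j s
    using that hc[of s] by (simp add: right_diff_distrib)
  have int: "(\<lambda>s. ?k j s * ?w s $ j) integrable_on {t0..t}" if j: "j < d" for j
    using integrable_diff[OF kernel_h_integrable[OF xi(1) j t] kernel_h_integrable[OF xi(2) j t]]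
    by (rule integrable_eq) (use eqw[OF j] in simp)
  have "integral {t0..t} (\<lambda>s. ?k j s * ?w s $ j) = Fop \<alpha> \<rho> t0 lam ds h x \<xi> t $ j - Fop \<alpha> \<rho> t0 lam ds h x \<xi>' t $ j"
    if j: "j < d" for j
  proof -
    have "integral {t0..t} (\<lambda>s. ?k j s * ?w s $ j) = integral {t0..t} (\<lambda>s. ?k j s * h (\<xi> s) $ j - ?k j s * h (\<xi>' s) $ j)"
      by (rule integral_cong) (rule eqw[OF j])
    also have "\<dots> = integral {t0..t} (\<lambda>s. ?k j s * h (\<xi> s) $ j) - integral {t0..t} (\<lambda>s. ?k j s * h (\<xi>' s) $ j)"
      by (rule integral_diff[OF kernel_h_integrable[OF xi(1) j t] kernel_h_integrable[OF xi(2) j t]])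
    finally show ?thesis using j dim by (simp add: Fop_index)
  qed
  then have "vnorm (Fop \<alpha> \<rho> t0 lam ds h x \<xi> t - Fop \<alpha> \<rho> t0 lam ds h x \<xi>' t)
      = L2_set (\<lambda>j. norm (integral {t0..t} (\<lambda>s. ?k j s * ?w s $ j))) {..<d}"
    unfolding vnorm_L2_set using dim by (intro L2_set_cong) auto
  also have "\<dots> \<le> (M / \<alpha>) * (lipc d h ?R * ?D)"
  proof (rule vnorm_convolution_le[OF _ _ _ t int])
    fix s assume s: "t0 \<le> s"
    show "?w s \<in> carrier_vec d" using hc[OF s] by simp
    have "vnorm (?w s) \<le> lipc d h ?R * vnorm (\<xi> s - \<xi>' s)"
      using Cinf_vnorm_le_supn[OF xi(1) s] Cinf_vnorm_le_supn[OF xi(2) s] by (intro h_lipc c s) auto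
    also have "\<dots> \<le> lipc d h ?R * ?D"
      by (intro mult_left_mono lipc_nonneg Cinf_diff_vnorm_le_supn[OF xi s])
    finally show "vnorm (?w s) \<le> lipc d h ?R * ?D" .
  next
    have "0 \<le> ?D" using Cinf_diff_vnorm_le_supn[OF xi order_refl] vnorm_nonneg[of "\<xi> t0 - \<xi>' t0"] by linarith
    then show "0 \<le> lipc d h ?R * ?D" using lipc_nonneg by simp
  qed
  finally show "vnorm (Fop \<alpha> \<rho> t0 lam ds h x \<xi> t - Fop \<alpha> \<rho> t0 lam ds h x \<xi>' t) \<le> (M / \<alpha>) * lipc d h ?R * ?D"
    by (simp add: mult.assoc)
qed

lemma Fop_bound:
  assumes xi: "\<xi> \<in> Cinf d t0" and x: "x \<in> carrier_vec d"
  shows "supn t0 (Fop \<alpha> \<rho> t0 lam ds h x \<xi>)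
     \<le> Max ((\<lambda>i. Sup ((\<lambda>t. cmod (mittag_leffler \<alpha> 1 (lam ! i * complex_of_real (((t powr \<rho> - t0 powr \<rho>) / \<rho>) powr \<alpha>)))) ` {t0..}))
                  ` {..<length lam}) * vnorm x
       + (M / \<alpha>) * lipc d h (supn t0 \<xi>) * supn t0 \<xi>"
proof (rule supn_leI)
  fix t assume t: "t0 \<le> t"
  let ?E = "\<lambda>i t. mittag_leffler \<alpha> 1 (lam ! i * complex_of_real (((t powr \<rho> - t0 powr \<rho>) / \<rho>) powr \<alpha>))"
  define X where "X = Max ((\<lambda>i. Sup ((\<lambda>t. cmod (?E i t)) ` {t0..})) ` {..<length lam})"
  let ?k = "\<lambda>j. ml_conv_kernel \<alpha> \<rho> t (lam ! blk ds j)"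
  let ?I = "\<lambda>j. integral {t0..t} (\<lambda>s. ?k j s * h (\<xi> s) $ j)"
  have EX: "cmod (?E i t) \<le> X" if i: "i < length lam" for i
  proof -
    obtain B where B: "\<And>x. 0 \<le> x \<Longrightarrow> norm (mittag_leffler \<alpha> 1 (of_real x * lam ! i)) \<le> B" using ml1[OF i] by blast
    have "bdd_above ((\<lambda>t. cmod (?E i t)) ` {t0..})"
      using B by (intro bdd_aboveI2[of _ _ B]) (subst mult.commute, rule B, simp)
    then have "cmod (?E i t) \<le> Sup ((\<lambda>t. cmod (?E i t)) ` {t0..})"
      using t by (intro cSup_upper) auto
    also have "\<dots> \<le> X" unfolding X_def using i by (intro Max_ge) auto
    finally show ?thesis .
  qed
  have c: "\<xi> s \<in> carrier_vec d" if "t0 \<le> s" for s using Cinf_carrier[OF xi that] .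
  have "vnorm (Fop \<alpha> \<rho> t0 lam ds h x \<xi> t) = L2_set (\<lambda>j. norm (?E (blk ds j) t * x $ j + ?I j)) {..<d}"
    unfolding vnorm_L2_set using dim by (intro L2_set_cong) (auto simp: Fop_index mult.commute)
  also have "\<dots> \<le> L2_set (\<lambda>j. norm (?E (blk ds j) t * x $ j) + norm (?I j)) {..<d}"
    by (intro L2_set_mono norm_triangle_ineq) auto
  also have "\<dots> \<le> L2_set (\<lambda>j. norm (?E (blk ds j) t * x $ j)) {..<d} + L2_set (\<lambda>j. norm (?I j)) {..<d}"
    by (rule L2_set_triangle_ineq)
  also have "\<dots> \<le> X * vnorm x + (M / \<alpha>) * (lipc d h (supn t0 \<xi>) * supn t0 \<xi>)"
  proof (rule add_mono)
    show "L2_set (\<lambda>j. norm (?E (blk ds j) t * x $ j)) {..<d} \<le> X * vnorm x"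
    \<comment> \<open>In dimension 0 the \<open>Max\<close> may range over the empty set and have no
      known value, but x is then the empty vector of norm 0. Otherwise some block exists and forces
      X to be nonnegative.\<close>
    proof (cases "d = 0")
      case True
      then show ?thesis using x by (simp add: vnorm_L2_set)
    next
      case False
      then have "0 \<le> X" using EX[OF blk_lam[of 0]] norm_ge_zero order_trans by blast
      have "L2_set (\<lambda>j. norm (?E (blk ds j) t * x $ j)) {..<d} \<le> L2_set (\<lambda>j. X * norm (x $ j)) {..<d}"
        using EX[OF blk_lam] by (intro L2_set_mono) (auto simp: norm_mult intro!: mult_right_mono)
      also have "\<dots> = X * vnorm x"
        using x \<open>0 \<le> X\<close> by (simp add: vnorm_L2_set L2_set_right_distrib)
      finally show ?thesis .
    qed
    show "L2_set (\<lambda>j. norm (?I j)) {..<d} \<le> (M / \<alpha>) * (lipc d h (supn t0 \<xi>) * supn t0 \<xi>)"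
    proof (rule vnorm_convolution_le[OF _ _ _ t kernel_h_integrable[OF xi _ t]])
      fix s assume s: "t0 \<le> s"
      show "h (\<xi> s) \<in> carrier_vec d" by (rule h_carrier[OF c[OF s]])
      have "vnorm (h (\<xi> s)) \<le> lipc d h (supn t0 \<xi>) * vnorm (\<xi> s)"
        by (rule h_vnorm_le[OF c[OF s] Cinf_vnorm_le_supn[OF xi s]])
      also have "\<dots> \<le> lipc d h (supn t0 \<xi>) * supn t0 \<xi>"
        by (intro mult_left_mono lipc_nonneg Cinf_vnorm_le_supn[OF xi s])
      finally show "vnorm (h (\<xi> s)) \<le> lipc d h (supn t0 \<xi>) * supn t0 \<xi>" .
    next
      have "0 \<le> supn t0 \<xi>" using Cinf_vnorm_le_supn[OF xi order_refl] vnorm_nonneg[of "\<xi> t0"] by linarith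
      then show "0 \<le> lipc d h (supn t0 \<xi>) * supn t0 \<xi>" using lipc_nonneg by simp
    qed
  qed
  finally show "vnorm (Fop \<alpha> \<rho> t0 lam ds h x \<xi> t) \<le> X * vnorm x + (M / \<alpha>) * lipc d h (supn t0 \<xi>) * supn t0 \<xi>"
    by (simp add: mult.assoc)
qed

end


section \<open>Assembling the constant\<close>

lemma mittag_leffler_decay_uniform:
  assumes "0 < \<alpha>" "\<alpha> < 1" "\<And>i. i < length lam \<Longrightarrow> \<alpha> * pi / 2 < \<bar>Arg (lam ! i)\<bar>"
  obtains M where "0 < M"
    "\<And>i x. i < length lam \<Longrightarrow> 0 \<le> x \<Longrightarrow> norm (mittag_leffler \<alpha> \<alpha> (of_real x * lam ! i)) \<le> M / (1 + x)\<^sup>2"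
proof -
  have "\<exists>M>0. \<forall>x\<ge>0. norm (mittag_leffler \<alpha> \<alpha> (of_real x * lam ! i)) \<le> M / (1 + x)\<^sup>2" if "i < length lam" for i
    using mittag_leffler_decay[OF assms(1,2) assms(3)[OF that]] by metis
  then obtain m where m: "\<And>i. i < length lam \<Longrightarrow> 0 < m i"
    "\<And>i x. i < length lam \<Longrightarrow> 0 \<le> x \<Longrightarrow> norm (mittag_leffler \<alpha> \<alpha> (of_real x * lam ! i)) \<le> m i / (1 + x)\<^sup>2"
    by metis
  \<comment> \<open>The sum dominates each single constant, and the additional 1 keeps it positive
    for an empty list.\<close>
  let ?M = "1 + (\<Sum>i<length lam. m i)"
  show ?thesis
  proof (rule that[of ?M])
    have nn: "0 \<le> (\<Sum>i<length lam. m i)" by (intro sum_nonneg) (use m(1) in \<open>auto intro: less_imp_le\<close>)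
    then show "0 < ?M" by linarith
    fix i and x :: real assume i: "i < length lam" and x: "0 \<le> x"
    have "m i \<le> (\<Sum>i<length lam. m i)"
      by (rule member_le_sum) (use i m(1) in \<open>auto intro: less_imp_le\<close>)
    then have "m i / (1 + x)\<^sup>2 \<le> ?M / (1 + x)\<^sup>2" by (intro divide_right_mono) auto
    then show "norm (mittag_leffler \<alpha> \<alpha> (of_real x * lam ! i)) \<le> ?M / (1 + x)\<^sup>2"
      using m(2)[OF i x] by linarith
  qed
qed

text \<open>Similar matrices share their characteristic polynomial; this carries the sector
  condition from the spectrum of A to the entries of \<open>lam\<close>.\<close>

lemma lam_eigenvalue:
  fixes A :: "complex mat"
  assumes A: "A \<in> carrier_mat d d" and T: "T \<in> carrier_mat d d" "invertible_mat T"
    and len: "length ds = length lam" and ds: "\<And>i. i < length ds \<Longrightarrow> 1 \<le> ds ! i"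
    and J: "minv T * A * T = Jform lam ds eta" and i: "i < length lam"
  shows "eigenvalue A (lam ! i)"
proof -
  note inv = minv_inverse[OF T]
  have Jc: "Jform lam ds eta \<in> carrier_mat d d" using J inv(1) A T(1) by (metis mult_carrier_mat)
  have "similar_mat_wit (Jform lam ds eta) A (minv T) T"
    by (rule similar_mat_witI[OF inv(3,2) J[symmetric] Jc A inv(1) T(1)])
  then have "char_poly (Jform lam ds eta) = char_poly A"
    by (intro char_poly_similar) (auto simp: similar_mat_def)
  moreover have "eigenvalue (Jform lam ds eta) (lam ! i)"
    by (rule Jform_eigenvalue[OF len ds i])
  ultimately show ?thesis
    using eigenvalue_root_char_poly[OF Jc] eigenvalue_root_char_poly[OF A] by simp
qed

text \<open>The order of the quantifiers expresses the dependence of the constant: C is fixed before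
  A is known. The proof therefore decides the sector condition on \<open>lam\<close> itself and
  reaches the spectrum of A only afterwards.\<close>

theorem proposition3p2:
  fixes \<alpha> :: real and lam :: "complex list"
  assumes "0 < \<alpha>" and "\<alpha> < 1"
  shows "\<exists>C>0. \<forall>(\<rho>::real) (t0::real) (d::nat) (A::real mat) (f::real Matrix.vec \<Rightarrow> real Matrix.vec)
      (T::complex mat) (ds::nat list) (eta::bool list) (\<delta>::real).
      0 < \<rho> \<longrightarrow> 0 < t0 \<longrightarrow> 0 < \<delta> \<longrightarrow>
      A \<in> carrier_mat d d \<longrightarrow>
      (\<forall>x\<in>carrier_vec d. f x \<in> carrier_vec d) \<longrightarrow>
      loc_lipschitz d f \<longrightarrow> f (0\<^sub>v d) = 0\<^sub>v d \<longrightarrow> (lipc d f \<longlongrightarrow> 0) (at_right 0) \<longrightarrow>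
      (\<forall>\<mu>. eigenvalue (map_mat complex_of_real A) \<mu> \<longrightarrow> \<alpha> * pi / 2 < \<bar>Arg \<mu>\<bar>) \<longrightarrow>
      T \<in> carrier_mat d d \<longrightarrow> invertible_mat T \<longrightarrow>
      length ds = length lam \<longrightarrow> length eta = length lam \<longrightarrow> (\<forall>i<length ds. 1 \<le> ds ! i) \<longrightarrow>
      minv T * map_mat complex_of_real A * T = Jform lam ds eta \<longrightarrow>
      (\<forall>x\<in>carrier_vec d. \<forall>\<xi> \<xi>'. \<xi> \<in> Cinf d t0 \<longrightarrow> \<xi>' \<in> Cinf d t0 \<longrightarrow>
         supn t0 (\<lambda>t. Fop \<alpha> \<rho> t0 lam ds (hfun f T ds eta \<delta>) x \<xi> t
                     - Fop \<alpha> \<rho> t0 lam ds (hfun f T ds eta \<delta>) x \<xi>' t)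
           \<le> C * lipc d (hfun f T ds eta \<delta>) (max (supn t0 \<xi>) (supn t0 \<xi>')) * supn t0 (\<lambda>t. \<xi> t - \<xi>' t)
       \<and> supn t0 (Fop \<alpha> \<rho> t0 lam ds (hfun f T ds eta \<delta>) x \<xi>)
           \<le> Max ((\<lambda>i. Sup ((\<lambda>t. cmod (mittag_leffler \<alpha> 1 (lam ! i * complex_of_real (((t powr \<rho> - t0 powr \<rho>) / \<rho>) powr \<alpha>)))) ` {t0..}))
                  ` {..<length lam}) * vnorm x
             + C * lipc d (hfun f T ds eta \<delta>) (supn t0 \<xi>) * supn t0 \<xi>)"
proof (cases "\<forall>i<length lam. \<alpha> * pi / 2 < \<bar>Arg (lam ! i)\<bar>")
  case True
  then obtain M where M: "0 < M"
    "\<And>i x. i < length lam \<Longrightarrow> 0 \<le> x \<Longrightarrow> norm (mittag_leffler \<alpha> \<alpha> (of_real x * lam ! i)) \<le> M / (1 + x)\<^sup>2"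
    using mittag_leffler_decay_uniform[OF assms] by blast
  have ml1: "\<exists>B. \<forall>x\<ge>0. norm (mittag_leffler \<alpha> 1 (of_real x * lam ! i)) \<le> B" if "i < length lam" for i
    using mittag_leffler_bounded[OF assms] True that by metis
  show ?thesis
  proof (intro exI[of _ "M / \<alpha>"] conjI allI impI ballI)
    show "0 < M / \<alpha>" using M(1) assms(1) by simp
  next
    fix \<rho> t0 \<delta> :: real and d :: nat and A :: "real mat" and f and T :: "complex mat" and ds eta and x :: "complex Matrix.vec" and \<xi> \<xi>'
    assume H: "0 < \<rho>" "0 < t0" "0 < \<delta>" "A \<in> carrier_mat d d"
      "\<forall>x\<in>carrier_vec d. f x \<in> carrier_vec d" "loc_lipschitz d f" "f (0\<^sub>v d) = 0\<^sub>v d"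
      "T \<in> carrier_mat d d" "invertible_mat T" "length ds = length lam" "length eta = length lam"
      "\<forall>i<length ds. 1 \<le> ds ! i" "minv T * map_mat complex_of_real A * T = Jform lam ds eta"
      "x \<in> carrier_vec d" "\<xi> \<in> Cinf d t0" "\<xi>' \<in> Cinf d t0"
    have Ac: "map_mat complex_of_real A \<in> carrier_mat d d" using H(4) by simp
    \<comment> \<open>That the block sizes add up to d is read off by comparing the two dimensions
      of the Jordan form.\<close>
    have "Jform lam ds eta \<in> carrier_mat d d"
      using H(13) minv_inverse(1)[OF H(8,9)] Ac H(8) by (metis mult_carrier_mat)
    then have dim: "sum_list ds = d" using Jform_carrier[OF H(10), of eta] by auto
    interpret fractional_setting f T ds eta \<delta> d \<alpha> \<rho> t0 M lam
      by unfold_locales (use H M ml1 assms dim in auto)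
    show "supn t0 (\<lambda>t. Fop \<alpha> \<rho> t0 lam ds h x \<xi> t - Fop \<alpha> \<rho> t0 lam ds h x \<xi>' t)
           \<le> M / \<alpha> * lipc d h (max (supn t0 \<xi>) (supn t0 \<xi>')) * supn t0 (\<lambda>t. \<xi> t - \<xi>' t)"
      by (rule Fop_diff_bound[OF H(15,16)])
    show "supn t0 (Fop \<alpha> \<rho> t0 lam ds h x \<xi>)
           \<le> Max ((\<lambda>i. Sup ((\<lambda>t. cmod (mittag_leffler \<alpha> 1 (lam ! i * complex_of_real (((t powr \<rho> - t0 powr \<rho>) / \<rho>) powr \<alpha>)))) ` {t0..}))
                  ` {..<length lam}) * vnorm x
             + M / \<alpha> * lipc d h (supn t0 \<xi>) * supn t0 \<xi>"
      by (rule Fop_bound[OF H(15,14)])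
  qed
next
  case False
  then obtain i where i: "i < length lam" "\<not> \<alpha> * pi / 2 < \<bar>Arg (lam ! i)\<bar>" by blast
  \<comment> \<open>Every entry of \<open>lam\<close> is an eigenvalue of each admissible A, so here
    no A meets the hypotheses and any positive constant serves.\<close>
  have False if "A \<in> carrier_mat d d" "\<forall>\<mu>. eigenvalue (map_mat complex_of_real A) \<mu> \<longrightarrow> \<alpha> * pi / 2 < \<bar>Arg \<mu>\<bar>"
    "T \<in> carrier_mat d d" "invertible_mat T" "length ds = length lam" "\<forall>i<length ds. 1 \<le> ds ! i"
    "minv T * map_mat complex_of_real A * T = Jform lam ds eta"
    for A :: "real mat" and d T ds eta
    using lam_eigenvalue[OF _ that(3-5) _ that(7) i(1)] that i by auto
  note absurd = this
  show ?thesis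
    by (intro exI[of _ 1] conjI allI impI) (simp, rule FalseE, rule absurd, assumption+)
qed

end
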